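(* Let $A$ be a ring and let $\{[M_i,a_i]\}_{i\in I}$ be a multi-center in $A$ (each $M_i$ an ideal of $A$, each $a_i\in A$). Put $L_i=M_i+(a_i)$ for $i\in I$. Let $Ring_A^{a\text{-reg}}$ be the full subcategory of $A$-algebras $f:A\to B$ such that $f(a_i)$ is a non-zero-divisor in $B$ for all $i\in I$. Then the following hold. 1. The covariant functor $Ring_A^{a\text{-reg}}\to Set$ sending $f:A\to B$ to $\{*\}$ if $f(M_i)B\subset f(a_i)B$ for all $i\in I$, and to $\varnothing$ otherwise, is representable by the $A$-algebra $A[\{\frac{M_i}{a_i}\}_{i\in I}]$ (also denoted $A[\frac{M}{a}]$), the dilatation of $A$ with multi-center $\{[M_i,a_i]\}_{i\in I}$. 2. The image of $a_i$ in $A[\frac{M}{a}]$ is a non-zero-divisor for every $i\in I$, and $a_iA[\frac{M}{a}]=L_iA[\frac{M}{a}]$. 3. If $A$ is a domain and $a_i\neq 0$ for all $i$, then $A[\frac{M}{a}]$ is a domain. 4. If $A$ is reduced, then $A[\frac{M}{a}]$ is reduced. 5. If $I=\{1,\ldots,k\}$ is finite, there is a canonical identification of $A$-algebras $$A\Big[\Big\{\frac{M_i}{a_i}\Big\}_{i\in I}\Big]=A\Big[\frac{\sum_{i\in I}\big(M_i\cdot\prod_{j\in I\setminus\{i\}}a_j\big)}{a_1\cdots a_k}\Big],$$ where the right-hand side is the dilatation with one center. 6. If $M_i=A$ for all $i$, then $A[\{\frac{M_i}{a_i}\}_{i\in I}]$ identifies with the localization $S^{-1}A$, where $S$ is the multiplicative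 subset of $A$ generated by $\{a_i\}_{i\in I}$. 7. The $A$-algebra $A[\{\frac{M_i}{a_i}\}_{i\in I}]$ identifies with the sub-$A$-algebra of $S^{-1}A$ generated by the fractions $\frac{m}{a_i}$ ($i\in I$, $m\in M_i$), where $S$ is the multiplicative subset of $A$ generated by $\{a_i\}_{i\in I}$. 8. For any multiplicative subset $S$ of $A$, any sub-$A$-algebra of $S^{-1}A$ is isomorphic, as an $A$-algebra, to a dilatation of $A$ with respect to some multi-center in $A$. 9. Let $K\subset I$ be a subset such that for every $i\in I\setminus K$ there exists $k(i)\in K$ with $a_{k(i)}\in L_i$ and $L_i\subset L_{k(i)}$. Then there is a canonical identification $$A\Big[\Big\{\frac{M_i}{a_i}\Big\}_{i\in I}\Big]=A\Big[\Big\{\frac{M_k}{a_k}\Big\}_{k\in K}\Big]_{\{\frac{a_i}{a_{k(i)}}\}_{i\in I\setminus K}},$$ where the right-hand side is the localization of $A[\{\frac{M_k}{a_k}\}_{k\in K}]$ at the multiplicative subset generated by the elements $\frac{a_i}{a_{k(i)}}$, $i\in I\setminus K$. 10. Let $a,g_1,\ldots,g_n$ be an $H_1$-regular sequence in $A$ and let $d_1,\ldots,d_n$ be positive integers. Then $$A\Big[\frac{(g_1)}{a^{d_1}},\ldots,\frac{(g_n)}{a^{d_n}}\Big]\cong A[x_1,\ldots,x_n]/(g_1-a^{d_1}x_1,\ldots,g_n-a^{d_n}x_n),$$ via the $A$-algebra map sending $x_i$ to $\frac{g_i}{a^{d_i}}$.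
   Context: Rings are commutative and unital; the zero ring is a ring; $\mathbb{N}=\{0,1,2,\ldots\}$; a multiplicative subset is a submonoid of $(A,\times)$. A multi-center in $A$ indexed by a set $I$ is a family $\{[M_i,a_i]\}_{i\in I}$ with $M_i$ an ideal of $A$ and $a_i\in A$. Put $L_i=M_i+(a_i)$, $\mathbb{N}_I=\bigoplus_{i\in I}\mathbb{N}$, and for $\nu\in\mathbb{N}_I$ put $a^\nu=\prod_i a_i^{\nu_i}\in A$ and $L^\nu=\prod_i L_i^{\nu_i}$ (product of ideals, with $L^0=A$). The dilatation $A[\{\frac{M_i}{a_i}\}_{i\in I}]$ is the ring of equivalence classes of symbols $\frac{m}{a^\nu}$ with $\nu\in\mathbb{N}_I$, $m\in L^\nu$, where $\frac{m}{a^\nu}\equiv\frac{p}{a^\lambda}$ iff there is $\beta\in\mathbb{N}_I$ with $ma^{\beta+\lambda}=pa^{\beta+\nu}$ in $A$, with addition $\frac{m}{a^\nu}+\frac{p}{a^\beta}=\frac{ma^\beta+pa^\nu}{a^{\beta+\nu}}$ and multiplication $\frac{m}{a^\nu}\cdot\frac{p}{a^\beta}=\frac{mp}{a^{\nu+\beta}}$. It is an $A$-algebra via $x\mapsto\frac{x}{1}$. A sequence $f_1,\ldots,f_r$ in a ring $R$ is $H_1$-regular if the first homology $H_1$ of the Koszul complex on $f_1,\ldots,f_r$ vanishes. *)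

theory Defs
  imports "HOL-Algebra.Algebra" "HOL-Library.Poly_Mapping"
begin

section \<open>Commutative rings and algebras over them\<close>

text \<open>An algebra over \<open>A\<close> is a ring \<open>B\<close> together with a structure map \<open>f\<close>, subject to
  \<^term>\<open>ring_hom_cring A B f\<close>. The zero ring is allowed, and in the zero ring \<open>0\<close> is a
  non-zero-divisor. Homomorphisms are taken extensional, so that equal homomorphisms are equal
  as functions.\<close>

definition nonzerodivisor :: "('a, 'm) ring_scheme \<Rightarrow> 'a \<Rightarrow> bool" where
  "nonzerodivisor R x \<longleftrightarrow>
     x \<in> carrier R \<and> (\<forall>y \<in> carrier R. x \<otimes>\<^bsub>R\<^esub> y = \<zero>\<^bsub>R\<^esub> \<longrightarrow> y = \<zero>\<^bsub>R\<^esub>)"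

definition reduced :: "('a, 'm) ring_scheme \<Rightarrow> bool" where
  "reduced R \<longleftrightarrow> (\<forall>x \<in> carrier R. \<forall>n::nat. x [^]\<^bsub>R\<^esub> n = \<zero>\<^bsub>R\<^esub> \<longrightarrow> x = \<zero>\<^bsub>R\<^esub>)"

definition alg_hom ::
  "('a, 'm) ring_scheme \<Rightarrow> ('b, 'n) ring_scheme \<Rightarrow> ('a \<Rightarrow> 'b) \<Rightarrow>
   ('c, 'k) ring_scheme \<Rightarrow> ('a \<Rightarrow> 'c) \<Rightarrow> ('b \<Rightarrow> 'c) set" where
  "alg_hom A B f C g =
     {\<theta> \<in> ring_hom B C \<inter> extensional (carrier B). \<forall>x \<in> carrier A. \<theta> (f x) = g x}"

definition alg_iso ::
  "('a, 'm) ring_scheme \<Rightarrow> ('b, 'n) ring_scheme \<Rightarrow> ('a \<Rightarrow> 'b) \<Rightarrow>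
   ('c, 'k) ring_scheme \<Rightarrow> ('a \<Rightarrow> 'c) \<Rightarrow> ('b \<Rightarrow> 'c) set" where
  "alg_iso A B f C g = alg_hom A B f C g \<inter> ring_iso B C"

text \<open>A canonical identification of algebras: there is exactly one algebra homomorphism
  \<open>B \<rightarrow> C\<close>, and it is an isomorphism.\<close>

definition canonically_isomorphic ::
  "('a, 'm) ring_scheme \<Rightarrow> ('b, 'n) ring_scheme \<Rightarrow> ('a \<Rightarrow> 'b) \<Rightarrow>
   ('c, 'k) ring_scheme \<Rightarrow> ('a \<Rightarrow> 'c) \<Rightarrow> bool" where
  "canonically_isomorphic A B f C g \<longleftrightarrow>
     (\<exists>\<theta>. alg_hom A B f C g = {\<theta>} \<and> \<theta> \<in> alg_iso A B f C g)"

definition subalgebra_of ::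
  "('a, 'm) ring_scheme \<Rightarrow> ('b, 'n) ring_scheme \<Rightarrow> ('a \<Rightarrow> 'b) \<Rightarrow> 'b set \<Rightarrow> bool" where
  "subalgebra_of A B f C \<longleftrightarrow> subring C B \<and> f ` carrier A \<subseteq> C"

definition generated_subalgebra ::
  "('a, 'm) ring_scheme \<Rightarrow> ('b, 'n) ring_scheme \<Rightarrow> ('a \<Rightarrow> 'b) \<Rightarrow> 'b set \<Rightarrow> 'b set" where
  "generated_subalgebra A B f V = \<Inter>{C. subalgebra_of A B f C \<and> V \<subseteq> C}"

definition generated_submonoid :: "('a, 'm) monoid_scheme \<Rightarrow> 'a set \<Rightarrow> 'a set" where
  "generated_submonoid G V = \<Inter>{S. submonoid S G \<and> V \<subseteq> S}"


section \<open>Localization at a multiplicative subset\<close>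

definition loc_rel ::
  "('a, 'm) ring_scheme \<Rightarrow> 'a set \<Rightarrow> (('a \<times> 'a) \<times> ('a \<times> 'a)) set" where
  "loc_rel A S = {((m, s), (p, t)). m \<in> carrier A \<and> s \<in> S \<and> p \<in> carrier A \<and> t \<in> S \<and>
     (\<exists>u \<in> S. u \<otimes>\<^bsub>A\<^esub> (m \<otimes>\<^bsub>A\<^esub> t) = u \<otimes>\<^bsub>A\<^esub> (p \<otimes>\<^bsub>A\<^esub> s))}"

definition loc_frac :: "('a, 'm) ring_scheme \<Rightarrow> 'a set \<Rightarrow> 'a \<Rightarrow> 'a \<Rightarrow> ('a \<times> 'a) set" where
  "loc_frac A S m s = loc_rel A S `` {(m, s)}"

definition localization :: "('a, 'm) ring_scheme \<Rightarrow> 'a set \<Rightarrow> (('a \<times> 'a) set) ring" where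
  "localization A S =
     \<lparr>carrier = (carrier A \<times> S) // loc_rel A S,
      monoid.mult = (\<lambda>U V. \<Union>(m, s) \<in> U. \<Union>(p, t) \<in> V. loc_frac A S (m \<otimes>\<^bsub>A\<^esub> p) (s \<otimes>\<^bsub>A\<^esub> t)),
      monoid.one = loc_frac A S \<one>\<^bsub>A\<^esub> \<one>\<^bsub>A\<^esub>,
      ring.zero = loc_frac A S \<zero>\<^bsub>A\<^esub> \<one>\<^bsub>A\<^esub>,
      ring.add = (\<lambda>U V. \<Union>(m, s) \<in> U. \<Union>(p, t) \<in> V.
        loc_frac A S (m \<otimes>\<^bsub>A\<^esub> t \<oplus>\<^bsub>A\<^esub> p \<otimes>\<^bsub>A\<^esub> s) (s \<otimes>\<^bsub>A\<^esub> t))\<rparr>"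

definition loc_map :: "('a, 'm) ring_scheme \<Rightarrow> 'a set \<Rightarrow> 'a \<Rightarrow> ('a \<times> 'a) set" where
  "loc_map A S x = loc_frac A S x \<one>\<^bsub>A\<^esub>"


section \<open>Multi-centers and dilatations\<close>

definition multi_center ::
  "('a, 'm) ring_scheme \<Rightarrow> 'i set \<Rightarrow> ('i \<Rightarrow> 'a set) \<Rightarrow> ('i \<Rightarrow> 'a) \<Rightarrow> bool" where
  "multi_center A I M a \<longleftrightarrow> (\<forall>i \<in> I. ideal (M i) A \<and> a i \<in> carrier A)"

definition center_ideal ::
  "('a, 'm) ring_scheme \<Rightarrow> ('i \<Rightarrow> 'a set) \<Rightarrow> ('i \<Rightarrow> 'a) \<Rightarrow> 'i \<Rightarrow> 'a set" where
  "center_ideal A M a i = M i <+>\<^bsub>A\<^esub> PIdl\<^bsub>A\<^esub> (a i)"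

definition exponents :: "'i set \<Rightarrow> ('i \<Rightarrow>\<^sub>0 nat) set" where
  "exponents I = {\<nu>. Poly_Mapping.keys \<nu> \<subseteq> I}"

definition multi_power ::
  "('a, 'm) ring_scheme \<Rightarrow> ('i \<Rightarrow> 'a) \<Rightarrow> ('i \<Rightarrow>\<^sub>0 nat) \<Rightarrow> 'a" where
  "multi_power A a \<nu> =
     finprod A (\<lambda>i. a i [^]\<^bsub>A\<^esub> Poly_Mapping.lookup \<nu> i) (Poly_Mapping.keys \<nu>)"

text \<open>Powers and products of ideals are taken in the monoid \<^term>\<open>ideals_set A\<close>, whose unit is
  \<open>A\<close> itself; so \<open>L\<^sup>\<nu>\<close> is \<^term>\<open>multi_power\<close> of the family of the ideals \<open>L\<^sub>i\<close> in it.\<close>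

definition dil_symbols ::
  "('a, 'm) ring_scheme \<Rightarrow> 'i set \<Rightarrow> ('i \<Rightarrow> 'a set) \<Rightarrow> ('i \<Rightarrow> 'a) \<Rightarrow> ('a \<times> ('i \<Rightarrow>\<^sub>0 nat)) set" where
  "dil_symbols A I M a =
     {(m, \<nu>). \<nu> \<in> exponents I \<and> m \<in> multi_power (ideals_set A) (center_ideal A M a) \<nu>}"

definition dil_rel ::
  "('a, 'm) ring_scheme \<Rightarrow> 'i set \<Rightarrow> ('i \<Rightarrow> 'a set) \<Rightarrow> ('i \<Rightarrow> 'a) \<Rightarrow>
   (('a \<times> ('i \<Rightarrow>\<^sub>0 nat)) \<times> ('a \<times> ('i \<Rightarrow>\<^sub>0 nat))) set" where
  "dil_rel A I M a = {((m, \<nu>), (p, \<mu>)).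
     (m, \<nu>) \<in> dil_symbols A I M a \<and> (p, \<mu>) \<in> dil_symbols A I M a \<and>
     (\<exists>\<beta> \<in> exponents I. m \<otimes>\<^bsub>A\<^esub> multi_power A a (\<beta> + \<mu>) = p \<otimes>\<^bsub>A\<^esub> multi_power A a (\<beta> + \<nu>))}"

definition dil_frac ::
  "('a, 'm) ring_scheme \<Rightarrow> 'i set \<Rightarrow> ('i \<Rightarrow> 'a set) \<Rightarrow> ('i \<Rightarrow> 'a) \<Rightarrow> 'a \<Rightarrow> ('i \<Rightarrow>\<^sub>0 nat) \<Rightarrow>
   ('a \<times> ('i \<Rightarrow>\<^sub>0 nat)) set" where
  "dil_frac A I M a m \<nu> = dil_rel A I M a `` {(m, \<nu>)}"

definition dilatation ::
  "('a, 'm) ring_scheme \<Rightarrow> 'i set \<Rightarrow> ('i \<Rightarrow> 'a set) \<Rightarrow> ('i \<Rightarrow> 'a) \<Rightarrow>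
   (('a \<times> ('i \<Rightarrow>\<^sub>0 nat)) set) ring" where
  "dilatation A I M a =
     \<lparr>carrier = dil_symbols A I M a // dil_rel A I M a,
      monoid.mult = (\<lambda>U V. \<Union>(m, \<nu>) \<in> U. \<Union>(p, \<beta>) \<in> V. dil_frac A I M a (m \<otimes>\<^bsub>A\<^esub> p) (\<nu> + \<beta>)),
      monoid.one = dil_frac A I M a \<one>\<^bsub>A\<^esub> 0,
      ring.zero = dil_frac A I M a \<zero>\<^bsub>A\<^esub> 0,
      ring.add = (\<lambda>U V. \<Union>(m, \<nu>) \<in> U. \<Union>(p, \<beta>) \<in> V.
        dil_frac A I M a (m \<otimes>\<^bsub>A\<^esub> multi_power A a \<beta> \<oplus>\<^bsub>A\<^esub> p \<otimes>\<^bsub>A\<^esub> multi_power A a \<nu>) (\<beta> + \<nu>))\<rparr>"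

definition dil_map ::
  "('a, 'm) ring_scheme \<Rightarrow> 'i set \<Rightarrow> ('i \<Rightarrow> 'a set) \<Rightarrow> ('i \<Rightarrow> 'a) \<Rightarrow> 'a \<Rightarrow>
   ('a \<times> ('i \<Rightarrow>\<^sub>0 nat)) set" where
  "dil_map A I M a x = dil_frac A I M a x 0"


section \<open>Representable functors on \<open>a\<close>-regular algebras\<close>

text \<open>The category is rendered with its objects carried by an arbitrary type \<open>'b\<close>, which plays
  the role of a universe. The representing object may be carried by another type.\<close>

definition reg_algebra ::
  "('a, 'm) ring_scheme \<Rightarrow> 'i set \<Rightarrow> ('i \<Rightarrow> 'a) \<Rightarrow> 'b ring \<Rightarrow> ('a \<Rightarrow> 'b) \<Rightarrow> bool" where
  "reg_algebra A I a B f \<longleftrightarrow> ring_hom_cring A B f \<and> (\<forall>i \<in> I. nonzerodivisor B (f (a i)))"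

definition set_functor ::
  "('a, 'm) ring_scheme \<Rightarrow> 'i set \<Rightarrow> ('i \<Rightarrow> 'a) \<Rightarrow>
   ('b ring \<Rightarrow> ('a \<Rightarrow> 'b) \<Rightarrow> 'x set) \<Rightarrow>
   ('b ring \<Rightarrow> ('a \<Rightarrow> 'b) \<Rightarrow> 'b ring \<Rightarrow> ('a \<Rightarrow> 'b) \<Rightarrow> ('b \<Rightarrow> 'b) \<Rightarrow> 'x \<Rightarrow> 'x) \<Rightarrow> bool" where
  "set_functor A I a F Fmap \<longleftrightarrow>
     (\<forall>B f C g. reg_algebra A I a B f \<and> reg_algebra A I a C g \<longrightarrow>
        (\<forall>\<theta> \<in> alg_hom A B f C g. Fmap B f C g \<theta> \<in> F B f \<rightarrow> F C g)) \<and>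
     (\<forall>B f. reg_algebra A I a B f \<longrightarrow>
        (\<forall>x \<in> F B f. Fmap B f B f (\<lambda>y \<in> carrier B. y) x = x)) \<and>
     (\<forall>B f C g D h. reg_algebra A I a B f \<and> reg_algebra A I a C g \<and> reg_algebra A I a D h \<longrightarrow>
        (\<forall>\<theta> \<in> alg_hom A B f C g. \<forall>\<psi> \<in> alg_hom A C g D h. \<forall>x \<in> F B f.
           Fmap B f D h (compose (carrier B) \<psi> \<theta>) x = Fmap C g D h \<psi> (Fmap B f C g \<theta> x)))"

text \<open>\<open>(D, \<iota>)\<close> is an object of the category, and some family \<open>\<eta>\<close> is a natural isomorphism from
  the functor of homomorphisms out of \<open>(D, \<iota>)\<close> to \<open>F\<close>.\<close>

definition represents ::
  "('a, 'm) ring_scheme \<Rightarrow> 'i set \<Rightarrow> ('i \<Rightarrow> 'a) \<Rightarrow>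
   ('b ring \<Rightarrow> ('a \<Rightarrow> 'b) \<Rightarrow> 'x set) \<Rightarrow>
   ('b ring \<Rightarrow> ('a \<Rightarrow> 'b) \<Rightarrow> 'b ring \<Rightarrow> ('a \<Rightarrow> 'b) \<Rightarrow> ('b \<Rightarrow> 'b) \<Rightarrow> 'x \<Rightarrow> 'x) \<Rightarrow>
   'd ring \<Rightarrow> ('a \<Rightarrow> 'd) \<Rightarrow> bool" where
  "represents A I a F Fmap D \<iota> \<longleftrightarrow>
     reg_algebra A I a D \<iota> \<and>
     (\<exists>\<eta> :: 'b ring \<Rightarrow> ('a \<Rightarrow> 'b) \<Rightarrow> ('d \<Rightarrow> 'b) \<Rightarrow> 'x.
        (\<forall>B f. reg_algebra A I a B f \<longrightarrow> bij_betw (\<eta> B f) (alg_hom A D \<iota> B f) (F B f)) \<and>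
        (\<forall>B f C g. reg_algebra A I a B f \<and> reg_algebra A I a C g \<longrightarrow>
           (\<forall>\<psi> \<in> alg_hom A B f C g. \<forall>\<theta> \<in> alg_hom A D \<iota> B f.
              \<eta> C g (compose (carrier D) \<psi> \<theta>) = Fmap B f C g \<psi> (\<eta> B f \<theta>))))"

definition dil_functor ::
  "('a, 'm) ring_scheme \<Rightarrow> 'i set \<Rightarrow> ('i \<Rightarrow> 'a set) \<Rightarrow> ('i \<Rightarrow> 'a) \<Rightarrow>
   'b ring \<Rightarrow> ('a \<Rightarrow> 'b) \<Rightarrow> unit set" where
  "dil_functor A I M a B f =
     (if \<forall>i \<in> I. Idl\<^bsub>B\<^esub> (f ` M i) \<subseteq> PIdl\<^bsub>B\<^esub> (f (a i)) then {()} else {})"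

definition dil_functor_map ::
  "'b ring \<Rightarrow> ('a \<Rightarrow> 'b) \<Rightarrow> 'b ring \<Rightarrow> ('a \<Rightarrow> 'b) \<Rightarrow> ('b \<Rightarrow> 'b) \<Rightarrow> unit \<Rightarrow> unit" where
  "dil_functor_map B f C g \<theta> x = x"


section \<open>Koszul homology\<close>

text \<open>The Koszul complex of \<open>f\<^sub>1, \<dots>, f\<^sub>r\<close> has in degree \<open>p\<close> the \<open>p\<close>-th exterior power of \<open>R\<^sup>r\<close>,
  with basis \<open>e\<^sub>U\<close> for the \<open>p\<close>-element subsets \<open>U\<close> of \<open>{0..<r}\<close> (positions in the list). A chain
  is its coordinate function \<open>U \<mapsto> x U\<close>. From
  \<open>d e\<^sub>U = (\<Sum>j\<in>U. (-1)\<^sup>c f\<^sub>j e\<^sub>U\<^sub>-\<^sub>j)\<close>, where \<open>c\<close> is the number of elements of \<open>U\<close> below \<open>j\<close>, the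
  coordinate of \<open>d x\<close> at \<open>T\<close> collects the terms \<open>U = insert j T\<close> with \<open>j \<notin> T\<close>. Degrees are
  integers so that the chain group in degree \<open>-1\<close> is zero.\<close>

definition koszul_basis :: "nat \<Rightarrow> int \<Rightarrow> nat set set" where
  "koszul_basis r p = {U. U \<subseteq> {..<r} \<and> int (card U) = p}"

definition koszul_chains ::
  "('a, 'm) ring_scheme \<Rightarrow> 'a list \<Rightarrow> int \<Rightarrow> (nat set \<Rightarrow> 'a) monoid" where
  "koszul_chains R fs p =
     \<lparr>carrier = koszul_basis (length fs) p \<rightarrow>\<^sub>E carrier R,
      monoid.mult = (\<lambda>x y. \<lambda>U \<in> koszul_basis (length fs) p. x U \<oplus>\<^bsub>R\<^esub> y U),
      monoid.one = (\<lambda>U \<in> koszul_basis (length fs) p. \<zero>\<^bsub>R\<^esub>)\<rparr>"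

definition koszul_diff ::
  "('a, 'm) ring_scheme \<Rightarrow> 'a list \<Rightarrow> int \<Rightarrow> (nat set \<Rightarrow> 'a) \<Rightarrow> (nat set \<Rightarrow> 'a)" where
  "koszul_diff R fs p x =
     (\<lambda>T \<in> koszul_basis (length fs) (p - 1).
        finsum R (\<lambda>j. (\<ominus>\<^bsub>R\<^esub> \<one>\<^bsub>R\<^esub>) [^]\<^bsub>R\<^esub> card {t \<in> T. t < j} \<otimes>\<^bsub>R\<^esub> (fs ! j) \<otimes>\<^bsub>R\<^esub> x (insert j T))
          ({..<length fs} - T))"

definition koszul_homology ::
  "('a, 'm) ring_scheme \<Rightarrow> 'a list \<Rightarrow> int \<Rightarrow> ((nat set \<Rightarrow> 'a) set) monoid" where
  "koszul_homology R fs p =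
     (koszul_chains R fs p
        \<lparr>carrier := kernel (koszul_chains R fs p) (koszul_chains R fs (p - 1)) (koszul_diff R fs p)\<rparr>)
     Mod (koszul_diff R fs (p + 1) ` carrier (koszul_chains R fs (p + 1)))"

definition H1_regular :: "('a, 'm) ring_scheme \<Rightarrow> 'a list \<Rightarrow> bool" where
  "H1_regular R fs \<longleftrightarrow>
     set fs \<subseteq> carrier R \<and>
     carrier (koszul_homology R fs 1) = {\<one>\<^bsub>koszul_homology R fs 1\<^esub>}"


section \<open>Polynomial rings\<close>

text \<open>The library's indexed polynomials are functions from monomials (multisets of variables) to
  coefficients; it provides the set of polynomials, their addition, constants and variables, to
  which the convolution product is added here.\<close>

definition mpoly_ring :: "('a, 'm) ring_scheme \<Rightarrow> 'v set \<Rightarrow> ('v multiset \<Rightarrow> 'a) ring" where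
  "mpoly_ring R V =
     \<lparr>carrier = ring.indexed_pset R V (carrier R),
      monoid.mult = (\<lambda>P Q m. finsum R (\<lambda>u. P u \<otimes>\<^bsub>R\<^esub> Q (m - u)) {u. u \<subseteq># m}),
      monoid.one = ring.indexed_const R \<one>\<^bsub>R\<^esub>,
      ring.zero = ring.indexed_const R \<zero>\<^bsub>R\<^esub>,
      ring.add = ring.indexed_padd R\<rparr>"

end

theory Submission
  imports Defs
begin

text \<open>For \<open>S\<close> the monoid of the monomials \<open>a\<^sup>\<nu>\<close>, the dilatation is a subring of \<open>S\<^sup>-\<^sup>1A\<close>. It maps uniquely to
  every algebra \<open>B\<close> in which each \<open>a\<^sub>i\<close> is a non-zero-divisor that divides \<open>M\<^sub>i\<close>. This map is an
  isomorphism if every element of \<open>A\<close> that vanishes in \<open>B\<close> is killed by a monomial, and every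
  \<open>y \<in> B\<close> satisfies \<open>a\<^sup>\<nu> y = m\<close> for some \<open>\<nu>\<close> and \<open>m \<in> L\<^sup>\<nu>\<close>; such \<open>y\<close> are closed under sums and
  products, so the second condition is checked on generators of \<open>B\<close>. All the identifications are
  instances of this criterion. For \<open>B = A[x]/(g\<^sub>i - a\<^sup>d\<^sup>i x\<^sub>i)\<close> it remains to see that \<open>a\<close> is a
  non-zero-divisor: read coefficientwise, \<open>H\<^sub>1 = 0\<close> says that the relations of \<open>a, g\<^sub>1, \<dots>, g\<^sub>n\<close> over
  \<open>A[x]\<close> come from alternating families \<open>w\<^sub>i\<^sub>j\<close>, and modulo the ideal each \<open>g\<^sub>i\<close> is a multiple of \<open>a\<close>.\<close>


section \<open>Monomials and non-zero-divisors\<close>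

text \<open>The a_i may be zero divisors in A, so A need not embed in its dilatation: exactly the
  elements killed by a monomial are lost. This is why the criterion asks about vanishing in B only
  up to monomials. Numerators come from powers of L_i = M_i + (a_i) so that a fraction can be
  expanded by any monomial, which addition requires; since (m + r a_i)/a_i is m/a_i + r, this yields
  nothing beyond the fractions m/a_i and A.

  For the quotient of A[x] the kernel is not visible directly. It is controlled by evaluating A[x]
  in the dilatation at x_i = g_i/a^d_i: the relations become zero there, so an element of A that
  dies in the quotient dies in the dilatation, where the kernel is known. Regularity of a is the
  only place where H_1 enters. First relations suffice because the question is a single membership:
  a p in the ideal must force p in the ideal. Since g_i is congruent to a times a^(d_i - 1) x_i, the
  multipliers involve the variables; hence the relations have to be understood over A[x] and not
  only over A.\<close>

lemma exponents_zero [simp]: "0 \<in> exponents I"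
  by (simp add: exponents_def)

lemma exponents_single [simp]: "i \<in> I \<Longrightarrow> Poly_Mapping.single i n \<in> exponents I"
  by (auto simp: exponents_def)

lemma exponents_add [simp]:
  fixes \<nu> \<mu> :: "'i \<Rightarrow>\<^sub>0 nat"
  shows "\<nu> \<in> exponents I \<Longrightarrow> \<mu> \<in> exponents I \<Longrightarrow> \<nu> + \<mu> \<in> exponents I"
  using Poly_Mapping.keys_add[of \<nu> \<mu>] by (auto simp: exponents_def)

lemma exponents_mono: "K \<subseteq> I \<Longrightarrow> \<nu> \<in> exponents K \<Longrightarrow> \<nu> \<in> exponents I"
  by (auto simp: exponents_def)

text \<open>The measure is the total degree. Statements about a^nu and L^nu are thereby reduced to
  multiplication by a single a_i or L_i.\<close>

lemma exponents_induct [consumes 1, case_names zero add]: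
  assumes "\<nu> \<in> exponents I"
    and zero: "P 0"
    and add: "\<And>\<nu> i. \<nu> \<in> exponents I \<Longrightarrow> i \<in> I \<Longrightarrow> P \<nu> \<Longrightarrow> P (Poly_Mapping.single i 1 + \<nu>)"
  shows "P \<nu>"
  using assms(1)
proof (induction "\<Sum>i\<in>Poly_Mapping.keys \<nu>. Poly_Mapping.lookup \<nu> i" arbitrary: \<nu> rule: less_induct)
  case less
  show ?case
  proof (cases "\<nu> = 0")
    case False
    then obtain i where i: "i \<in> Poly_Mapping.keys \<nu>"
      by (metis all_not_in_conv keys_eq_empty)
    \<comment> \<open>Subtraction of exponents is truncated; since \<open>i\<close> is a key of
      \<open>\<nu>\<close>, adding \<open>single i 1\<close> back recovers
      \<open>\<nu>\<close>.\<close>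
    define \<mu> where "\<mu> = \<nu> - Poly_Mapping.single i 1"
    have \<nu>: "\<nu> = Poly_Mapping.single i 1 + \<mu>"
      using i by (intro poly_mapping_eqI)
        (auto simp: \<mu>_def lookup_add lookup_minus lookup_single when_def in_keys_iff)
    have keys: "Poly_Mapping.keys \<mu> \<subseteq> Poly_Mapping.keys \<nu>"
      by (auto simp: \<mu>_def lookup_minus in_keys_iff)
    have "(\<Sum>j\<in>Poly_Mapping.keys \<mu>. Poly_Mapping.lookup \<mu> j) = (\<Sum>j\<in>Poly_Mapping.keys \<nu>. Poly_Mapping.lookup \<mu> j)"
      using keys by (intro sum.mono_neutral_left) (auto simp: in_keys_iff)
    also have "\<dots> < (\<Sum>j\<in>Poly_Mapping.keys \<nu>. Poly_Mapping.lookup \<nu> j)"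
      using i by (intro sum_strict_mono_ex1)
        (auto simp: \<mu>_def lookup_minus lookup_single when_def in_keys_iff intro!: bexI[of _ i])
    finally have "P \<mu>"
      using less keys by (auto simp: exponents_def)
    then show ?thesis
      using add[of \<mu> i] less.prems i keys by (subst \<nu>) (auto simp: exponents_def)
  qed (use zero in simp)
qed

text \<open>Stated for a commutative monoid so that the same facts serve the monomials a^nu in a
  ring and the powers L^nu in the monoid of ideals.\<close>

locale monoid_family = comm_monoid R for R :: "('a, 'm) ring_scheme" (structure) +
  fixes I :: "'i set" and a :: "'i \<Rightarrow> 'a"
  assumes family_closed: "i \<in> I \<Longrightarrow> a i \<in> carrier R"
begin

lemma multi_power_eq_finprod:
  assumes "finite J" "Poly_Mapping.keys \<nu> \<subseteq> J" "J \<subseteq> I"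
  shows "multi_power R a \<nu> = (\<Otimes>i\<in>J. a i [^] Poly_Mapping.lookup \<nu> i)"
  unfolding multi_power_def
  using assms family_closed
  by (intro finprod_mono_neutral_cong_left) (auto simp: in_keys_iff)

lemma multi_power_closed [simp]: "\<nu> \<in> exponents I \<Longrightarrow> multi_power R a \<nu> \<in> carrier R"
  unfolding multi_power_def using family_closed by (intro finprod_closed) (auto simp: exponents_def)

lemma multi_power_zero [simp]: "multi_power R a 0 = \<one>"
  by (simp add: multi_power_def)

lemma multi_power_add:
  assumes "\<nu> \<in> exponents I" "\<mu> \<in> exponents I"
  shows "multi_power R a (\<nu> + \<mu>) = multi_power R a \<nu> \<otimes> multi_power R a \<mu>"
proof -
  define J where "J = Poly_Mapping.keys \<nu> \<union> Poly_Mapping.keys \<mu>"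
  have J: "finite J" "Poly_Mapping.keys \<nu> \<subseteq> J" "Poly_Mapping.keys \<mu> \<subseteq> J" "Poly_Mapping.keys (\<nu> + \<mu>) \<subseteq> J" "J \<subseteq> I"
    using assms Poly_Mapping.keys_add[of \<nu> \<mu>] by (auto simp: J_def exponents_def)
  have cl: "i \<in> J \<Longrightarrow> a i \<in> carrier R" for i
    using J family_closed by auto
  have "(\<Otimes>i\<in>J. a i [^] Poly_Mapping.lookup (\<nu> + \<mu>) i) = (\<Otimes>i\<in>J. a i [^] Poly_Mapping.lookup \<nu> i \<otimes> a i [^] Poly_Mapping.lookup \<mu> i)"
    using cl by (intro finprod_cong) (auto simp: lookup_add nat_pow_mult simp_implies_def)
  also have "\<dots> = (\<Otimes>i\<in>J. a i [^] Poly_Mapping.lookup \<nu> i) \<otimes> (\<Otimes>i\<in>J. a i [^] Poly_Mapping.lookup \<mu> i)"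
    using cl by (intro finprod_multf) auto
  finally show ?thesis
    using J by (simp add: multi_power_eq_finprod)
qed

lemma multi_power_single:
  "i \<in> I \<Longrightarrow> multi_power R a (Poly_Mapping.single i n) = a i [^] n"
  using family_closed
  by (subst multi_power_eq_finprod[of "{i}"]) (auto simp: finprod_insert Pi_def)

lemma multi_power_single_one:
  "i \<in> I \<Longrightarrow> multi_power R a (Poly_Mapping.single i 1) = a i"
  using family_closed by (simp add: multi_power_single)

end

lemma (in monoid) generated_submonoid_is_submonoid:
  assumes "V \<subseteq> carrier G"
  shows "submonoid (generated_submonoid G V) G"
proof -
  \<comment> \<open>The intersection must not run over the empty family, which would make it the
    whole type; the carrier is a member.\<close>
  have "submonoid (carrier G) G"
    by (simp add: submonoid.intro)
  then have ne: "generated_submonoid G V \<subseteq> carrier G"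
    using assms by (auto simp: generated_submonoid_def)
  show ?thesis
    using ne
    by (intro submonoid.intro)
      (auto simp: generated_submonoid_def submonoid.one_closed submonoid.m_closed)
qed

lemma generated_submonoid_incl: "x \<in> V \<Longrightarrow> x \<in> generated_submonoid G V"
  by (auto simp: generated_submonoid_def)

lemma generated_submonoid_minimal:
  "submonoid S G \<Longrightarrow> V \<subseteq> S \<Longrightarrow> generated_submonoid G V \<subseteq> S"
  by (auto simp: generated_submonoid_def)

lemma (in monoid) generated_submonoid_induct [consumes 2, case_names one incl mult]:
  assumes "x \<in> generated_submonoid G V" "V \<subseteq> carrier G"
    and one: "P \<one>"
    and incl: "\<And>x. x \<in> V \<Longrightarrow> P x"
    and mult: "\<And>x y. x \<in> carrier G \<Longrightarrow> y \<in> carrier G \<Longrightarrow> P x \<Longrightarrow> P y \<Longrightarrow> P (x \<otimes> y)"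
  shows "P x"
proof -
  have "submonoid {x \<in> carrier G. P x} G"
    by (intro submonoid.intro) (auto intro: one mult)
  then have "generated_submonoid G V \<subseteq> {x \<in> carrier G. P x}"
    using assms(2) incl by (intro generated_submonoid_minimal) auto
  then show ?thesis
    using assms(1) by auto
qed

text \<open>Turns "some element of S" into "some exponent", the form in which the relation on
  symbols quantifies.\<close>

lemma (in monoid_family) generated_submonoid_eq_multi_powers:
  "generated_submonoid R (a ` I) = multi_power R a ` exponents I"
proof
  have "submonoid (multi_power R a ` exponents I) R"
  proof (intro submonoid.intro)
    show "\<one> \<in> multi_power R a ` exponents I"
      by (metis exponents_zero imageI multi_power_zero)
    show "x \<otimes> y \<in> multi_power R a ` exponents I"
      if "x \<in> multi_power R a ` exponents I" "y \<in> multi_power R a ` exponents I" for x y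
      using that by (auto simp: multi_power_add[symmetric] intro!: imageI exponents_add)
  qed auto
  moreover have "a ` I \<subseteq> multi_power R a ` exponents I"
    by (metis exponents_single imageI image_subsetI multi_power_single_one)
  ultimately show "generated_submonoid R (a ` I) \<subseteq> multi_power R a ` exponents I"
    by (rule generated_submonoid_minimal)
next
  have V: "a ` I \<subseteq> carrier R"
    using family_closed by auto
  interpret S: submonoid "generated_submonoid R (a ` I)" R
    using V by (rule generated_submonoid_is_submonoid)
  have "multi_power R a \<nu> \<in> generated_submonoid R (a ` I)" if "\<nu> \<in> exponents I" for \<nu>
    using that
  proof (induction rule: exponents_induct)
    case (add \<nu> i)
    have "a i \<in> generated_submonoid R (a ` I)"
      using add by (intro generated_submonoid_incl) auto
    then show ?case
      using add by (simp add: multi_power_add multi_power_single_one del: One_nat_def)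
  qed simp
  then show "multi_power R a ` exponents I \<subseteq> generated_submonoid R (a ` I)"
    by auto
qed

context cring
begin

lemma nonzerodivisorI:
  "x \<in> carrier R \<Longrightarrow> (\<And>y. y \<in> carrier R \<Longrightarrow> x \<otimes> y = \<zero> \<Longrightarrow> y = \<zero>) \<Longrightarrow> nonzerodivisor R x"
  by (auto simp: nonzerodivisor_def)

lemma nonzerodivisor_closed: "nonzerodivisor R x \<Longrightarrow> x \<in> carrier R"
  unfolding nonzerodivisor_def by blast

lemma nonzerodivisorD:
  "nonzerodivisor R x \<Longrightarrow> y \<in> carrier R \<Longrightarrow> x \<otimes> y = \<zero> \<Longrightarrow> y = \<zero>"
  unfolding nonzerodivisor_def by blast

lemma nonzerodivisor_one: "nonzerodivisor R \<one>"
  by (rule nonzerodivisorI) simp_all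

lemma nonzerodivisor_mult:
  assumes "nonzerodivisor R x" "nonzerodivisor R y"
  shows "nonzerodivisor R (x \<otimes> y)"
proof (rule nonzerodivisorI)
  show "x \<otimes> y \<in> carrier R"
    using assms by (simp add: nonzerodivisor_closed)
  fix z assume z: "z \<in> carrier R" "x \<otimes> y \<otimes> z = \<zero>"
  then have "x \<otimes> (y \<otimes> z) = \<zero>"
    using assms by (simp add: nonzerodivisor_closed m_assoc)
  then show "z = \<zero>"
    using assms z nonzerodivisorD[of x "y \<otimes> z"] nonzerodivisorD[of y z]
    by (simp add: nonzerodivisor_closed)
qed

text \<open>Whatever a factor kills is killed by the product. This covers units, as factors of 1,
  and the a_i as factors of a_1 ... a_k.\<close>

lemma nonzerodivisor_factor:
  assumes "nonzerodivisor R (x \<otimes> y)" "x \<in> carrier R" "y \<in> carrier R"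
  shows "nonzerodivisor R x"
proof (rule nonzerodivisorI)
  fix z assume z: "z \<in> carrier R" "x \<otimes> z = \<zero>"
  have "x \<otimes> y \<otimes> z = y \<otimes> (x \<otimes> z)"
    using assms(2,3) z(1) by algebra
  then show "z = \<zero>"
    using nonzerodivisorD[OF assms(1) z(1)] assms(3) z by simp
qed fact

lemma nonzerodivisor_pow: "nonzerodivisor R x \<Longrightarrow> nonzerodivisor R (x [^] (n::nat))"
  by (induction n) (auto simp: nonzerodivisor_one nonzerodivisor_mult)

lemma nonzerodivisor_cancel:
  assumes "nonzerodivisor R x" "y \<in> carrier R" "z \<in> carrier R" "x \<otimes> y = x \<otimes> z"
  shows "y = z"
proof -
  have x: "x \<in> carrier R"
    using assms(1) by (rule nonzerodivisor_closed)
  have "x \<otimes> (y \<ominus> z) = x \<otimes> y \<ominus> x \<otimes> z"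
    using x assms(2,3) by algebra
  then have "x \<otimes> (y \<ominus> z) = \<zero>"
    using assms x by simp
  then have "y \<ominus> z = \<zero>"
    using nonzerodivisorD[OF assms(1)] assms by simp
  then show ?thesis
    using assms by simp
qed

lemma nonzerodivisor_of_unit:
  assumes "x \<in> carrier R" "y \<in> carrier R" "x \<otimes> y = \<one>"
  shows "nonzerodivisor R x"
  using assms by (metis nonzerodivisor_factor nonzerodivisor_one)

end

lemma (in monoid_family) nonzerodivisor_multi_power:
  assumes "cring R" "\<And>i. i \<in> I \<Longrightarrow> nonzerodivisor R (a i)" "\<nu> \<in> exponents I"
  shows "nonzerodivisor R (multi_power R a \<nu>)"
  using assms(3)
proof (induction rule: exponents_induct)
  case zero
  then show ?case
    by (simp add: cring.nonzerodivisor_one[OF assms(1)])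
next
  case (add \<nu> i)
  then show ?case
    using assms(2) cring.nonzerodivisor_mult[OF assms(1)]
    by (simp add: multi_power_add multi_power_single_one del: One_nat_def)
qed

lemma (in ring_hom_cring) hom_multi_power:
  assumes "\<And>i. i \<in> I \<Longrightarrow> a i \<in> carrier R" "\<nu> \<in> exponents I"
  shows "h (multi_power R a \<nu>) = multi_power S (\<lambda>i. h (a i)) \<nu>"
proof -
  interpret A: monoid_family R I a
    using assms by unfold_locales
  interpret B: monoid_family S I "\<lambda>i. h (a i)"
    using assms by unfold_locales auto
  show ?thesis
    using assms(2)
  proof (induction rule: exponents_induct)
    case (add \<nu> i)
    then show ?case
      by (simp add: A.multi_power_add B.multi_power_add A.multi_power_single_one
          B.multi_power_single_one assms(1) del: One_nat_def)
  qed simp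
qed


section \<open>Localization\<close>

text \<open>Operations on classes are written as unions over all representatives. Once every pair of
  representatives gives the same class, the union is that class, provided that neither argument is
  empty.\<close>

lemma UN_pairs_const:
  assumes "U \<noteq> {}" "V \<noteq> {}"
    and "\<And>m s p t. (m, s) \<in> U \<Longrightarrow> (p, t) \<in> V \<Longrightarrow> F m s p t = c"
  shows "(\<Union>(m, s)\<in>U. \<Union>(p, t)\<in>V. F m s p t) = c"
proof -
  obtain m s p t where "(m, s) \<in> U" "(p, t) \<in> V"
    using assms(1,2) by (metis ex_in_conv surj_pair)
  moreover have "F m s p t = c" if "(m, s) \<in> U" "(p, t) \<in> V" for m s p t
    using that by (rule assms(3))
  ultimately show ?thesis
    by blast
qed

locale mult_subset = cring R + submonoid S R
  for R :: "('a, 'm) ring_scheme" (structure) and S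
begin

abbreviation "L \<equiv> localization R S"
abbreviation "fr \<equiv> loc_frac R S"

lemma S_closed: "s \<in> S \<Longrightarrow> s \<in> carrier R"
  using subset by blast

lemma equiv_loc_rel: "equiv (carrier R \<times> S) (loc_rel R S)"
proof (rule equivI)
  show "refl_on (carrier R \<times> S) (loc_rel R S)"
    by (rule refl_onI) (auto simp: loc_rel_def intro!: bexI[of _ \<one>])
  show "sym (loc_rel R S)"
    by (rule symI) (auto simp: loc_rel_def, metis)
  show "trans (loc_rel R S)"
  proof (rule transI)
    fix x y z assume xy: "(x, y) \<in> loc_rel R S" and yz: "(y, z) \<in> loc_rel R S"
    obtain m s p t q r where x: "x = (m, s)" "y = (p, t)" "z = (q, r)"
      by (metis surj_pair)
    from xy obtain u where u: "u \<in> S" "u \<otimes> (m \<otimes> t) = u \<otimes> (p \<otimes> s)"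
      and xy': "m \<in> carrier R" "s \<in> S" "p \<in> carrier R" "t \<in> S"
      by (auto simp: loc_rel_def x)
    from yz obtain v where v: "v \<in> S" "v \<otimes> (p \<otimes> r) = v \<otimes> (q \<otimes> t)"
      and yz': "q \<in> carrier R" "r \<in> S"
      by (auto simp: loc_rel_def x)
    note cl = xy'(1,3) yz'(1) S_closed[OF xy'(2)] S_closed[OF xy'(4)] S_closed[OF yz'(2)]
      S_closed[OF u(1)] S_closed[OF v(1)]
    \<comment> \<open>The multiplier contains the middle denominator t: chaining the two equations
      leaves this factor, which cannot be cancelled in general.\<close>
    have "u \<otimes> v \<otimes> t \<otimes> (m \<otimes> r) = v \<otimes> r \<otimes> (u \<otimes> (m \<otimes> t))"
      using cl by algebra
    also have "\<dots> = u \<otimes> s \<otimes> (v \<otimes> (p \<otimes> r))"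
      unfolding u(2) using cl by algebra
    also have "\<dots> = u \<otimes> v \<otimes> t \<otimes> (q \<otimes> s)"
      unfolding v(2) using cl by algebra
    finally show "(x, z) \<in> loc_rel R S"
      using xy' yz' u(1) v(1) by (auto simp: loc_rel_def x intro!: bexI[of _ "u \<otimes> v \<otimes> t"])
  qed
qed (auto simp: loc_rel_def)

lemma fr_eq_iff:
  assumes "m \<in> carrier R" "s \<in> S" "p \<in> carrier R" "t \<in> S"
  shows "fr m s = fr p t \<longleftrightarrow> (\<exists>u\<in>S. u \<otimes> (m \<otimes> t) = u \<otimes> (p \<otimes> s))"
  unfolding loc_frac_def using assms
  by (subst eq_equiv_class_iff[OF equiv_loc_rel]) (auto simp: loc_rel_def)

lemma fr_eqI:
  assumes "m \<in> carrier R" "s \<in> S" "p \<in> carrier R" "t \<in> S" "m \<otimes> t = p \<otimes> s"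
  shows "fr m s = fr p t"
  using assms by (auto simp: fr_eq_iff)

lemma fr_memD:
  assumes "(p, t) \<in> fr m s"
  shows "p \<in> carrier R" "t \<in> S" "\<exists>u\<in>S. u \<otimes> (m \<otimes> t) = u \<otimes> (p \<otimes> s)"
  using assms by (auto simp: loc_frac_def loc_rel_def)

lemma fr_closed [simp]: "m \<in> carrier R \<Longrightarrow> s \<in> S \<Longrightarrow> fr m s \<in> carrier L"
  by (auto simp: localization_def loc_frac_def intro!: quotientI)

lemma fr_nonempty: "m \<in> carrier R \<Longrightarrow> s \<in> S \<Longrightarrow> fr m s \<noteq> {}"
  using equiv_class_self[OF equiv_loc_rel, of "(m, s)"] by (auto simp: loc_frac_def)

lemma loc_carrier_cases:
  assumes "x \<in> carrier L"
  obtains m s where "m \<in> carrier R" "s \<in> S" "x = fr m s"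
  using assms by (auto simp: localization_def loc_frac_def elim!: quotientE)

lemma
  assumes "m \<in> carrier R" "s \<in> S" "p \<in> carrier R" "t \<in> S"
  shows loc_mult: "fr m s \<otimes>\<^bsub>L\<^esub> fr p t = fr (m \<otimes> p) (s \<otimes> t)"
    and loc_add: "fr m s \<oplus>\<^bsub>L\<^esub> fr p t = fr (m \<otimes> t \<oplus> p \<otimes> s) (s \<otimes> t)"
proof -
  \<comment> \<open>Independence of the representatives, with the product of the two multipliers as
    multiplier.\<close>
  have "fr (m' \<otimes> p') (s' \<otimes> t') = fr (m \<otimes> p) (s \<otimes> t) \<and>
      fr (m' \<otimes> t' \<oplus> p' \<otimes> s') (s' \<otimes> t') = fr (m \<otimes> t \<oplus> p \<otimes> s) (s \<otimes> t)"
    if h: "(m', s') \<in> fr m s" "(p', t') \<in> fr p t" for m' s' p' t'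
  proof
    obtain u where u: "u \<in> S" "u \<otimes> (m \<otimes> s') = u \<otimes> (m' \<otimes> s)"
      using fr_memD(3)[OF h(1)] by blast
    obtain v where v: "v \<in> S" "v \<otimes> (p \<otimes> t') = v \<otimes> (p' \<otimes> t)"
      using fr_memD(3)[OF h(2)] by blast
    note h' = fr_memD(1,2)[OF h(1)] fr_memD(1,2)[OF h(2)]
    note cl = assms(1,3) assms(2,4)[THEN S_closed] h'(1,3) h'(2,4)[THEN S_closed]
      u(1)[THEN S_closed] v(1)[THEN S_closed]
    have "u \<otimes> v \<otimes> (m' \<otimes> p' \<otimes> (s \<otimes> t)) = (u \<otimes> (m' \<otimes> s)) \<otimes> (v \<otimes> (p' \<otimes> t))"
      using cl by algebra
    also have "\<dots> = u \<otimes> v \<otimes> (m \<otimes> p \<otimes> (s' \<otimes> t'))"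
      unfolding u(2)[symmetric] v(2)[symmetric] using cl by algebra
    finally show "fr (m' \<otimes> p') (s' \<otimes> t') = fr (m \<otimes> p) (s \<otimes> t)"
      using assms u(1) v(1) h' by (subst fr_eq_iff) (auto intro!: bexI[of _ "u \<otimes> v"])
    have "u \<otimes> v \<otimes> ((m' \<otimes> t' \<oplus> p' \<otimes> s') \<otimes> (s \<otimes> t)) =
        v \<otimes> t' \<otimes> t \<otimes> (u \<otimes> (m' \<otimes> s)) \<oplus> u \<otimes> s' \<otimes> s \<otimes> (v \<otimes> (p' \<otimes> t))"
      using cl by algebra
    also have "\<dots> = u \<otimes> v \<otimes> ((m \<otimes> t \<oplus> p \<otimes> s) \<otimes> (s' \<otimes> t'))"
      unfolding u(2)[symmetric] v(2)[symmetric] using cl by algebra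
    finally show "fr (m' \<otimes> t' \<oplus> p' \<otimes> s') (s' \<otimes> t') = fr (m \<otimes> t \<oplus> p \<otimes> s) (s \<otimes> t)"
      using assms u(1) v(1) h' S_closed by (subst fr_eq_iff) (auto intro!: bexI[of _ "u \<otimes> v"])
  qed
  then show "fr m s \<otimes>\<^bsub>L\<^esub> fr p t = fr (m \<otimes> p) (s \<otimes> t)"
    "fr m s \<oplus>\<^bsub>L\<^esub> fr p t = fr (m \<otimes> t \<oplus> p \<otimes> s) (s \<otimes> t)"
    using assms fr_nonempty by (simp_all add: localization_def UN_pairs_const)
qed

lemma loc_one: "\<one>\<^bsub>L\<^esub> = fr \<one> \<one>"
  by (simp add: localization_def)

lemma loc_zero: "\<zero>\<^bsub>L\<^esub> = fr \<zero> \<one>"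
  by (simp add: localization_def)

lemma localization_cring: "cring L"
proof (rule cringI)
  show "abelian_group L"
  proof (rule abelian_groupI)
    fix x y assume xy: "x \<in> carrier L" "y \<in> carrier L"
    then obtain m s p t where
      h: "m \<in> carrier R" "s \<in> S" "x = fr m s" "p \<in> carrier R" "t \<in> S" "y = fr p t"
      by (metis loc_carrier_cases)
    then show "x \<oplus>\<^bsub>L\<^esub> y \<in> carrier L"
      using S_closed by (simp add: loc_add)
    show "x \<oplus>\<^bsub>L\<^esub> y = y \<oplus>\<^bsub>L\<^esub> x"
      using h S_closed by (simp add: loc_add a_comm m_comm)
    fix z assume "z \<in> carrier L"
    then obtain q r where h': "q \<in> carrier R" "r \<in> S" "z = fr q r"
      by (metis loc_carrier_cases)
    note cl = h(1,4) h'(1) S_closed[OF h(2)] S_closed[OF h(5)] S_closed[OF h'(2)]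
    have "(m \<otimes> t \<oplus> p \<otimes> s) \<otimes> r \<oplus> q \<otimes> (s \<otimes> t) = m \<otimes> (t \<otimes> r) \<oplus> (p \<otimes> r \<oplus> q \<otimes> t) \<otimes> s"
      using cl by algebra
    then show "x \<oplus>\<^bsub>L\<^esub> y \<oplus>\<^bsub>L\<^esub> z = x \<oplus>\<^bsub>L\<^esub> (y \<oplus>\<^bsub>L\<^esub> z)"
      using h h' cl by (simp add: loc_add m_assoc)
  next
    fix x assume "x \<in> carrier L"
    then obtain m s where h: "m \<in> carrier R" "s \<in> S" "x = fr m s"
      by (metis loc_carrier_cases)
    then show "\<zero>\<^bsub>L\<^esub> \<oplus>\<^bsub>L\<^esub> x = x"
      using S_closed by (simp add: loc_add loc_zero)
    have "fr (\<ominus> m) s \<oplus>\<^bsub>L\<^esub> x = fr \<zero> \<one>"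
      using h S_closed by (simp add: loc_add) (intro fr_eqI, auto simp: l_minus l_neg)
    then show "\<exists>y\<in>carrier L. y \<oplus>\<^bsub>L\<^esub> x = \<zero>\<^bsub>L\<^esub>"
      using h by (auto simp: loc_zero)
  qed (simp add: loc_zero)
  show "comm_monoid L"
  proof (rule comm_monoidI)
    fix x y assume xy: "x \<in> carrier L" "y \<in> carrier L"
    then obtain m s p t where
      h: "m \<in> carrier R" "s \<in> S" "x = fr m s" "p \<in> carrier R" "t \<in> S" "y = fr p t"
      by (metis loc_carrier_cases)
    then show "x \<otimes>\<^bsub>L\<^esub> y \<in> carrier L"
      using S_closed by (simp add: loc_mult)
    show "x \<otimes>\<^bsub>L\<^esub> y = y \<otimes>\<^bsub>L\<^esub> x"
      using h S_closed by (simp add: loc_mult m_comm)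
    fix z assume "z \<in> carrier L"
    then obtain q r where h': "q \<in> carrier R" "r \<in> S" "z = fr q r"
      by (metis loc_carrier_cases)
    then show "x \<otimes>\<^bsub>L\<^esub> y \<otimes>\<^bsub>L\<^esub> z = x \<otimes>\<^bsub>L\<^esub> (y \<otimes>\<^bsub>L\<^esub> z)"
      using h S_closed by (simp add: loc_mult m_assoc)
  next
    fix x assume "x \<in> carrier L"
    then obtain m s where h: "m \<in> carrier R" "s \<in> S" "x = fr m s"
      by (metis loc_carrier_cases)
    then show "\<one>\<^bsub>L\<^esub> \<otimes>\<^bsub>L\<^esub> x = x"
      using S_closed by (simp add: loc_mult loc_one)
  qed (simp add: loc_one)
  fix x y z assume "x \<in> carrier L" "y \<in> carrier L" "z \<in> carrier L"
  then obtain m s p t q r where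
    h: "m \<in> carrier R" "s \<in> S" "x = fr m s" "p \<in> carrier R" "t \<in> S" "y = fr p t"
      "q \<in> carrier R" "r \<in> S" "z = fr q r"
    by (metis loc_carrier_cases)
  note cl = h(1,4,7) S_closed[OF h(2)] S_closed[OF h(5)] S_closed[OF h(8)]
  have "(m \<otimes> t \<oplus> p \<otimes> s) \<otimes> q \<otimes> (s \<otimes> r \<otimes> (t \<otimes> r)) =
      (m \<otimes> q \<otimes> (t \<otimes> r) \<oplus> p \<otimes> q \<otimes> (s \<otimes> r)) \<otimes> (s \<otimes> t \<otimes> r)"
    using cl by algebra
  then show "(x \<oplus>\<^bsub>L\<^esub> y) \<otimes>\<^bsub>L\<^esub> z = x \<otimes>\<^bsub>L\<^esub> z \<oplus>\<^bsub>L\<^esub> y \<otimes>\<^bsub>L\<^esub> z"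
    using h cl by (simp add: loc_mult loc_add) (intro fr_eqI, auto)
qed

interpretation L: cring L
  by (rule localization_cring)

lemma loc_map_hom: "ring_hom_cring R L (loc_map R S)"
proof (rule ring_hom_cringI)
  show "loc_map R S \<in> ring_hom R L"
    by (rule ring_hom_memI) (auto simp: loc_map_def loc_mult loc_add loc_one)
qed (use is_cring localization_cring in auto)

lemma loc_map_inverse:
  "s \<in> S \<Longrightarrow> loc_map R S s \<otimes>\<^bsub>L\<^esub> fr \<one> s = \<one>\<^bsub>L\<^esub>"
  unfolding loc_map_def loc_one using S_closed
  by (simp add: loc_mult) (intro fr_eqI, auto)

lemma loc_map_times_fr:
  "m \<in> carrier R \<Longrightarrow> s \<in> S \<Longrightarrow> loc_map R S s \<otimes>\<^bsub>L\<^esub> fr m s = loc_map R S m"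
  unfolding loc_map_def using S_closed
  by (simp add: loc_mult) (intro fr_eqI, auto simp: m_comm)

lemma fr_eq_loc_map_times:
  "m \<in> carrier R \<Longrightarrow> s \<in> S \<Longrightarrow> fr m s = loc_map R S m \<otimes>\<^bsub>L\<^esub> fr \<one> s"
  unfolding loc_map_def using S_closed by (simp add: loc_mult)

lemma fr_one_mult:
  "s \<in> S \<Longrightarrow> t \<in> S \<Longrightarrow> fr \<one> (s \<otimes> t) = fr \<one> s \<otimes>\<^bsub>L\<^esub> fr \<one> t"
  using S_closed by (simp add: loc_mult)

lemma loc_map_nonzerodivisor_S:
  assumes "s \<in> S"
  shows "nonzerodivisor L (loc_map R S s)"
proof -
  show ?thesis
    using loc_map_inverse[OF assms] assms S_closed
    by (intro L.nonzerodivisor_of_unit[of _ "fr \<one> s"]) (auto simp: loc_map_def)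
qed

lemma fr_eq_zero_iff:
  assumes "m \<in> carrier R" "s \<in> S"
  shows "fr m s = \<zero>\<^bsub>L\<^esub> \<longleftrightarrow> (\<exists>u\<in>S. u \<otimes> m = \<zero>)"
  unfolding loc_zero using assms S_closed by (subst fr_eq_iff) auto

lemma loc_map_eq_zero_iff:
  "m \<in> carrier R \<Longrightarrow> loc_map R S m = \<zero>\<^bsub>L\<^esub> \<longleftrightarrow> (\<exists>u\<in>S. u \<otimes> m = \<zero>)"
  unfolding loc_map_def by (rule fr_eq_zero_iff) simp_all

text \<open>If x m / s vanishes, some u in S kills x m, and regularity of x shows that u kills m. It
  serves elements that are regular without having to become invertible.\<close>

lemma loc_map_nonzerodivisor:
  assumes "nonzerodivisor R x"
  shows "nonzerodivisor L (loc_map R S x)"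
proof -
  have x: "x \<in> carrier R"
    using assms by (rule nonzerodivisor_closed)
  show ?thesis
  proof (rule L.nonzerodivisorI)
    show "loc_map R S x \<in> carrier L"
      using x by (simp add: loc_map_def)
    fix y assume "y \<in> carrier L" and eq: "loc_map R S x \<otimes>\<^bsub>L\<^esub> y = \<zero>\<^bsub>L\<^esub>"
    then obtain m s where y: "m \<in> carrier R" "s \<in> S" "y = fr m s"
      by (metis loc_carrier_cases)
    have "fr (x \<otimes> m) s = \<zero>\<^bsub>L\<^esub>"
      using eq x y S_closed by (simp add: loc_map_def loc_mult)
    then obtain u where u: "u \<in> S" "u \<otimes> (x \<otimes> m) = \<zero>"
      using x y by (auto simp: fr_eq_zero_iff)
    have "x \<otimes> (u \<otimes> m) = u \<otimes> (x \<otimes> m)"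
      using x y(1) S_closed[OF u(1)] by algebra
    then have "x \<otimes> (u \<otimes> m) = \<zero>"
      unfolding u(2) .
    then have "u \<otimes> m = \<zero>"
      using nonzerodivisorD[OF assms] S_closed[OF u(1)] y(1) by blast
    then show "y = \<zero>\<^bsub>L\<^esub>"
      using u(1) y by (auto simp: fr_eq_zero_iff)
  qed
qed

end


section \<open>The dilatation as a ring\<close>

text \<open>Transports the ring axioms backwards along an injection, so that those of the dilatation
  are read off in the localization. Negation is not a primitive operation of D, so a preimage of the
  negative is asked for instead.\<close>

lemma cring_of_injection:
  fixes D (structure) and B (structure)
  assumes "cring B" and inj: "inj_on \<phi> (carrier D)"
    and closed: "\<And>x. x \<in> carrier D \<Longrightarrow> \<phi> x \<in> carrier B"
    and add: "\<And>x y. x \<in> carrier D \<Longrightarrow> y \<in> carrier D \<Longrightarrow>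
      x \<oplus>\<^bsub>D\<^esub> y \<in> carrier D \<and> \<phi> (x \<oplus>\<^bsub>D\<^esub> y) = \<phi> x \<oplus>\<^bsub>B\<^esub> \<phi> y"
    and mult: "\<And>x y. x \<in> carrier D \<Longrightarrow> y \<in> carrier D \<Longrightarrow>
      x \<otimes>\<^bsub>D\<^esub> y \<in> carrier D \<and> \<phi> (x \<otimes>\<^bsub>D\<^esub> y) = \<phi> x \<otimes>\<^bsub>B\<^esub> \<phi> y"
    and zero: "\<zero>\<^bsub>D\<^esub> \<in> carrier D \<and> \<phi> \<zero>\<^bsub>D\<^esub> = \<zero>\<^bsub>B\<^esub>"
    and one: "\<one>\<^bsub>D\<^esub> \<in> carrier D \<and> \<phi> \<one>\<^bsub>D\<^esub> = \<one>\<^bsub>B\<^esub>"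
    and neg: "\<And>x. x \<in> carrier D \<Longrightarrow> \<exists>y\<in>carrier D. \<phi> y = \<ominus>\<^bsub>B\<^esub> \<phi> x"
  shows "cring D"
proof -
  interpret B: cring B by fact
  note eqI = inj_onD[OF inj]
  show ?thesis
  proof (rule cringI)
    show "abelian_group D"
    proof (rule abelian_groupI)
      fix x assume x: "x \<in> carrier D"
      then obtain y where y: "y \<in> carrier D" "\<phi> y = \<ominus>\<^bsub>B\<^esub> \<phi> x"
        using neg by blast
      have "y \<oplus>\<^bsub>D\<^esub> x = \<zero>\<^bsub>D\<^esub>"
        using x y by (intro eqI) (auto simp: add zero closed B.l_neg)
      then show "\<exists>y\<in>carrier D. y \<oplus>\<^bsub>D\<^esub> x = \<zero>\<^bsub>D\<^esub>"
        using y by blast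
      show "\<zero>\<^bsub>D\<^esub> \<oplus>\<^bsub>D\<^esub> x = x"
        using x by (intro eqI) (auto simp: add zero closed)
    next
      fix x y assume "x \<in> carrier D" "y \<in> carrier D"
      then show "x \<oplus>\<^bsub>D\<^esub> y = y \<oplus>\<^bsub>D\<^esub> x"
        by (intro eqI) (auto simp: add closed B.a_comm)
    next
      fix x y z assume "x \<in> carrier D" "y \<in> carrier D" "z \<in> carrier D"
      then show "x \<oplus>\<^bsub>D\<^esub> y \<oplus>\<^bsub>D\<^esub> z = x \<oplus>\<^bsub>D\<^esub> (y \<oplus>\<^bsub>D\<^esub> z)"
        by (intro eqI) (auto simp: add closed B.a_assoc)
    qed (auto simp: add zero)
    show "comm_monoid D"
    proof (rule comm_monoidI)
      fix x assume "x \<in> carrier D"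
      then show "\<one>\<^bsub>D\<^esub> \<otimes>\<^bsub>D\<^esub> x = x"
        by (intro eqI) (auto simp: mult one closed)
    next
      fix x y assume "x \<in> carrier D" "y \<in> carrier D"
      then show "x \<otimes>\<^bsub>D\<^esub> y = y \<otimes>\<^bsub>D\<^esub> x"
        by (intro eqI) (auto simp: mult closed B.m_comm)
    next
      fix x y z assume "x \<in> carrier D" "y \<in> carrier D" "z \<in> carrier D"
      then show "x \<otimes>\<^bsub>D\<^esub> y \<otimes>\<^bsub>D\<^esub> z = x \<otimes>\<^bsub>D\<^esub> (y \<otimes>\<^bsub>D\<^esub> z)"
        by (intro eqI) (auto simp: mult closed B.m_assoc)
    qed (auto simp: mult one)
    fix x y z assume "x \<in> carrier D" "y \<in> carrier D" "z \<in> carrier D"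
    then show "(x \<oplus>\<^bsub>D\<^esub> y) \<otimes>\<^bsub>D\<^esub> z = x \<otimes>\<^bsub>D\<^esub> z \<oplus>\<^bsub>D\<^esub> y \<otimes>\<^bsub>D\<^esub> z"
      by (intro eqI) (auto simp: add mult closed B.l_distr)
  qed
qed

context cring
begin

lemma ideals_set_simps [simp]:
  "carrier (ideals_set R) = {J. ideal J R}"
  "monoid.mult (ideals_set R) = ideal_prod R"
  "monoid.one (ideals_set R) = carrier R"
  by (simp_all add: ideals_set_def)

lemma ideal_prod_subset_iff:
  assumes "ideal J R" "ideal H R" "ideal K R"
  shows "ideal_prod R J H \<subseteq> K \<longleftrightarrow> (\<forall>x\<in>J. \<forall>y\<in>H. x \<otimes> y \<in> K)"
proof
  interpret K: ideal K R by fact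
  assume h: "\<forall>x\<in>J. \<forall>y\<in>H. x \<otimes> y \<in> K"
  show "ideal_prod R J H \<subseteq> K"
  proof
    fix z assume "z \<in> ideal_prod R J H"
    then show "z \<in> K"
      by induction (auto simp: h)
  qed
qed (auto intro: ideal_prod.prod)

end

section \<open>Powers of the ideals L_i and classes of symbols\<close>

locale multi_centered = cring R for R :: "('a, 'm) ring_scheme" (structure) +
  fixes I :: "'i set" and M :: "'i \<Rightarrow> 'a set" and a :: "'i \<Rightarrow> 'a"
  assumes multi_center: "multi_center R I M a"
begin

abbreviation "pw \<equiv> multi_power R a"
abbreviation "Lid \<equiv> center_ideal R M a"
abbreviation "Lpw \<equiv> multi_power (ideals_set R) Lid"
abbreviation "\<delta> i \<equiv> Poly_Mapping.single i (1 :: nat)"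
abbreviation "D \<equiv> dilatation R I M a"
abbreviation "dfr \<equiv> dil_frac R I M a"
abbreviation "\<iota> \<equiv> dil_map R I M a"

lemma a_closed [simp]: "i \<in> I \<Longrightarrow> a i \<in> carrier R"
  using multi_center by (simp add: multi_center_def)

lemma M_ideal: "i \<in> I \<Longrightarrow> ideal (M i) R"
  using multi_center by (simp add: multi_center_def)

lemma Lid_ideal: "i \<in> I \<Longrightarrow> ideal (Lid i) R"
  unfolding center_ideal_def by (intro add_ideals M_ideal cgenideal_ideal a_closed)

lemma Lid_memI:
  assumes "i \<in> I" "m \<in> M i" "x \<in> carrier R"
  shows "m \<oplus> x \<otimes> a i \<in> Lid i"
  using assms unfolding center_ideal_def set_add_def' by (auto simp: cgenideal_def)

lemma M_subset_Lid: "i \<in> I \<Longrightarrow> M i \<subseteq> Lid i"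
  using Lid_memI[of i _ \<zero>] ideal.Icarr[OF M_ideal] by fastforce

lemma a_in_Lid: "i \<in> I \<Longrightarrow> a i \<in> Lid i"
  using Lid_memI[of i \<zero> \<one>] additive_subgroup.zero_closed[OF ideal.axioms(1)[OF M_ideal]] by simp

sublocale pow: monoid_family R I a
  by unfold_locales simp

lemma ideal_family: "monoid_family (ideals_set R) I Lid"
  by (intro monoid_family.intro monoid_family_axioms.intro ideals_set_is_comm_monoid)
    (simp add: Lid_ideal)

lemma Lpw_ideal: "\<nu> \<in> exponents I \<Longrightarrow> ideal (Lpw \<nu>) R"
  using monoid_family.multi_power_closed[OF ideal_family] by simp

lemma Lpw_closed: "\<nu> \<in> exponents I \<Longrightarrow> m \<in> Lpw \<nu> \<Longrightarrow> m \<in> carrier R"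
  using ideal.Icarr[OF Lpw_ideal] .

lemma Lpw_zero: "Lpw 0 = carrier R"
  using monoid_family.multi_power_zero[OF ideal_family] by simp

lemma Lpw_add: "\<nu> \<in> exponents I \<Longrightarrow> \<mu> \<in> exponents I \<Longrightarrow> Lpw (\<nu> + \<mu>) = ideal_prod R (Lpw \<nu>) (Lpw \<mu>)"
  using monoid_family.multi_power_add[OF ideal_family] by simp

lemma Lpw_single_one: "i \<in> I \<Longrightarrow> Lpw (\<delta> i) = Lid i"
  using monoid_family.multi_power_single_one[OF ideal_family] .

lemma Lpw_mult:
  "\<nu> \<in> exponents I \<Longrightarrow> \<mu> \<in> exponents I \<Longrightarrow> m \<in> Lpw \<nu> \<Longrightarrow> p \<in> Lpw \<mu> \<Longrightarrow> m \<otimes> p \<in> Lpw (\<nu> + \<mu>)"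
  by (simp add: Lpw_add ideal_prod.prod)

text \<open>The reason for adding a_i to M_i: a numerator remains admissible when a fraction is
  expanded by a monomial.\<close>

lemma pw_in_Lpw: "\<nu> \<in> exponents I \<Longrightarrow> pw \<nu> \<in> Lpw \<nu>"
proof (induction rule: exponents_induct)
  case (add \<nu> i)
  have "pw (Poly_Mapping.single i 1 + \<nu>) = a i \<otimes> pw \<nu>"
    using add by (simp add: pow.multi_power_add pow.multi_power_single_one del: One_nat_def)
  moreover have "a i \<in> Lpw (\<delta> i)"
    using add by (simp add: Lpw_single_one a_in_Lid del: One_nat_def)
  ultimately show ?case
    using add by (simp add: Lpw_mult del: One_nat_def)
qed (simp add: Lpw_zero)

lemma Lpw_times_pw:
  assumes "\<nu> \<in> exponents I" "\<mu> \<in> exponents I" "m \<in> Lpw \<nu>"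
  shows "m \<otimes> pw \<mu> \<in> Lpw (\<nu> + \<mu>)"
  using assms by (intro Lpw_mult pw_in_Lpw)

abbreviation "Sm \<equiv> pw ` exponents I"

lemma a_in_Sm: "i \<in> I \<Longrightarrow> a i \<in> Sm"
  by (metis exponents_single imageI pow.multi_power_single_one)

lemma mult_subset_Sm: "mult_subset R Sm"
proof -
  have "a ` I \<subseteq> carrier R"
    by auto
  then have "submonoid Sm R"
    unfolding pow.generated_submonoid_eq_multi_powers[symmetric]
    by (rule generated_submonoid_is_submonoid)
  then show ?thesis
    by (intro mult_subset.intro is_cring)
qed

interpretation loc: mult_subset R Sm
  by (rule mult_subset_Sm)

lemma dil_symbols_iff: "(m, \<nu>) \<in> dil_symbols R I M a \<longleftrightarrow> \<nu> \<in> exponents I \<and> m \<in> Lpw \<nu>"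
  by (simp add: dil_symbols_def)

text \<open>Since a^(beta+mu) = a^beta a^mu, the shift beta plays the role of the multiplier in the
  relation of fractions. Classes of symbols thus correspond to particular elements of the
  localization, and transitivity and compatibility with the operations are inherited from
  there.\<close>

lemma dil_rel_iff:
  "((m, \<nu>), (p, \<mu>)) \<in> dil_rel R I M a \<longleftrightarrow>
    \<nu> \<in> exponents I \<and> m \<in> Lpw \<nu> \<and> \<mu> \<in> exponents I \<and> p \<in> Lpw \<mu> \<and>
    loc.fr m (pw \<nu>) = loc.fr p (pw \<mu>)"
proof (cases "\<nu> \<in> exponents I \<and> m \<in> Lpw \<nu> \<and> \<mu> \<in> exponents I \<and> p \<in> Lpw \<mu>")
  case True
  then have cl: "m \<in> carrier R" "p \<in> carrier R"
    by (auto simp: Lpw_closed)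
  have "m \<otimes> pw (\<beta> + \<mu>) = p \<otimes> pw (\<beta> + \<nu>) \<longleftrightarrow> pw \<beta> \<otimes> (m \<otimes> pw \<mu>) = pw \<beta> \<otimes> (p \<otimes> pw \<nu>)"
    if "\<beta> \<in> exponents I" for \<beta>
    using that True cl by (simp add: pow.multi_power_add m_ac)
  then show ?thesis
    using True cl by (simp add: dil_rel_def dil_symbols_iff loc.fr_eq_iff bex_simps)
qed (auto simp: dil_rel_def dil_symbols_iff)

lemma equiv_dil_rel: "equiv (dil_symbols R I M a) (dil_rel R I M a)"
proof (rule equivI)
  show "dil_rel R I M a \<subseteq> dil_symbols R I M a \<times> dil_symbols R I M a"
    by (auto simp: dil_rel_def)
  show "refl_on (dil_symbols R I M a) (dil_rel R I M a)"
    by (rule refl_onI) (auto simp: dil_rel_iff dil_symbols_iff)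
  show "sym (dil_rel R I M a)"
    by (rule symI) (auto simp: dil_rel_iff)
  show "trans (dil_rel R I M a)"
    by (rule transI) (auto simp: dil_rel_iff)
qed

lemma dfr_eq_iff:
  assumes "\<nu> \<in> exponents I" "m \<in> Lpw \<nu>" "\<mu> \<in> exponents I" "p \<in> Lpw \<mu>"
  shows "dfr m \<nu> = dfr p \<mu> \<longleftrightarrow> loc.fr m (pw \<nu>) = loc.fr p (pw \<mu>)"
  unfolding dil_frac_def using assms
  by (subst eq_equiv_class_iff[OF equiv_dil_rel]) (auto simp: dil_symbols_iff dil_rel_iff)

lemma dfr_memD:
  assumes "(p, \<mu>) \<in> dfr m \<nu>"
  shows "\<mu> \<in> exponents I" "p \<in> Lpw \<mu>" "loc.fr p (pw \<mu>) = loc.fr m (pw \<nu>)"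
  using assms by (auto simp: dil_frac_def dil_rel_iff)

lemma dfr_nonempty: "\<nu> \<in> exponents I \<Longrightarrow> m \<in> Lpw \<nu> \<Longrightarrow> dfr m \<nu> \<noteq> {}"
  using equiv_class_self[OF equiv_dil_rel, of "(m, \<nu>)"] by (auto simp: dil_frac_def dil_symbols_iff)

lemma dfr_closed [simp]: "\<nu> \<in> exponents I \<Longrightarrow> m \<in> Lpw \<nu> \<Longrightarrow> dfr m \<nu> \<in> carrier D"
  by (auto simp: dilatation_def dil_frac_def dil_symbols_iff intro!: quotientI)

lemma D_carrier_cases:
  assumes "x \<in> carrier D"
  obtains m \<nu> where "\<nu> \<in> exponents I" "m \<in> Lpw \<nu>" "x = dfr m \<nu>"
  using assms by (auto simp: dilatation_def dil_frac_def dil_symbols_iff elim!: quotientE)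

lemma dfr_add_num_in:
  assumes "\<nu> \<in> exponents I" "m \<in> Lpw \<nu>" "\<mu> \<in> exponents I" "p \<in> Lpw \<mu>"
  shows "m \<otimes> pw \<mu> \<oplus> p \<otimes> pw \<nu> \<in> Lpw (\<mu> + \<nu>)"
proof -
  interpret J: ideal "Lpw (\<mu> + \<nu>)" R
    using assms by (simp add: Lpw_ideal)
  show ?thesis
    using assms Lpw_times_pw[of \<nu> \<mu> m] Lpw_times_pw[of \<mu> \<nu> p] by (simp add: add.commute)
qed

lemma
  assumes "\<nu> \<in> exponents I" "m \<in> Lpw \<nu>" "\<mu> \<in> exponents I" "p \<in> Lpw \<mu>"
  shows dfr_mult: "dfr m \<nu> \<otimes>\<^bsub>D\<^esub> dfr p \<mu> = dfr (m \<otimes> p) (\<nu> + \<mu>)"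
    and dfr_add: "dfr m \<nu> \<oplus>\<^bsub>D\<^esub> dfr p \<mu> = dfr (m \<otimes> pw \<mu> \<oplus> p \<otimes> pw \<nu>) (\<mu> + \<nu>)"
proof -
  have "dfr (m' \<otimes> p') (\<nu>' + \<mu>') = dfr (m \<otimes> p) (\<nu> + \<mu>) \<and>
      dfr (m' \<otimes> pw \<mu>' \<oplus> p' \<otimes> pw \<nu>') (\<mu>' + \<nu>') = dfr (m \<otimes> pw \<mu> \<oplus> p \<otimes> pw \<nu>) (\<mu> + \<nu>)"
    if h: "(m', \<nu>') \<in> dfr m \<nu>" "(p', \<mu>') \<in> dfr p \<mu>" for m' \<nu>' p' \<mu>'
  proof
    note h' = dfr_memD(1,2)[OF h(1)] dfr_memD(1,2)[OF h(2)]
    \<comment> \<open>Both pairs of representatives have the same fractions in the localization,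
      hence the same product; no multipliers have to be combined again.\<close>
    have "loc.fr m' (pw \<nu>') \<otimes>\<^bsub>loc.L\<^esub> loc.fr p' (pw \<mu>') =
        loc.fr m (pw \<nu>) \<otimes>\<^bsub>loc.L\<^esub> loc.fr p (pw \<mu>)"
      by (simp add: dfr_memD(3)[OF h(1)] dfr_memD(3)[OF h(2)])
    then show "dfr (m' \<otimes> p') (\<nu>' + \<mu>') = dfr (m \<otimes> p) (\<nu> + \<mu>)"
      using assms h'
      by (subst dfr_eq_iff) (auto simp: Lpw_mult loc.loc_mult Lpw_closed pow.multi_power_add)
    have "loc.fr m' (pw \<nu>') \<oplus>\<^bsub>loc.L\<^esub> loc.fr p' (pw \<mu>') =
        loc.fr m (pw \<nu>) \<oplus>\<^bsub>loc.L\<^esub> loc.fr p (pw \<mu>)"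
      by (simp add: dfr_memD(3)[OF h(1)] dfr_memD(3)[OF h(2)])
    then show "dfr (m' \<otimes> pw \<mu>' \<oplus> p' \<otimes> pw \<nu>') (\<mu>' + \<nu>') = dfr (m \<otimes> pw \<mu> \<oplus> p \<otimes> pw \<nu>) (\<mu> + \<nu>)"
      using assms h'
      by (subst dfr_eq_iff)
        (auto simp: dfr_add_num_in loc.loc_add Lpw_closed pow.multi_power_add m_comm)
  qed
  then show "dfr m \<nu> \<otimes>\<^bsub>D\<^esub> dfr p \<mu> = dfr (m \<otimes> p) (\<nu> + \<mu>)"
    "dfr m \<nu> \<oplus>\<^bsub>D\<^esub> dfr p \<mu> = dfr (m \<otimes> pw \<mu> \<oplus> p \<otimes> pw \<nu>) (\<mu> + \<nu>)"
    using assms dfr_nonempty by (simp_all add: dilatation_def UN_pairs_const)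
qed

lemma D_one: "\<one>\<^bsub>D\<^esub> = dfr \<one> 0"
  by (simp add: dilatation_def)

lemma D_zero: "\<zero>\<^bsub>D\<^esub> = dfr \<zero> 0"
  by (simp add: dilatation_def)

lemma dil_cring: "cring D"
proof -
  \<comment> \<open>The inclusion into the localization; the description is unambiguous because
    equal classes have equal fractions.\<close>
  define \<phi> where "\<phi> x = (THE y. \<exists>m \<nu>. \<nu> \<in> exponents I \<and> m \<in> Lpw \<nu> \<and> x = dfr m \<nu> \<and>
    y = loc.fr m (pw \<nu>))" for x
  have \<phi>: "\<phi> (dfr m \<nu>) = loc.fr m (pw \<nu>)" if "\<nu> \<in> exponents I" "m \<in> Lpw \<nu>" for m \<nu>
    unfolding \<phi>_def using that by (intro the_equality) (auto simp: dfr_eq_iff)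
  show ?thesis
  proof (rule cring_of_injection[OF loc.localization_cring])
    show "inj_on \<phi> (carrier D)"
      by (rule inj_onI) (metis D_carrier_cases \<phi> dfr_eq_iff)
    fix x assume "x \<in> carrier D"
    then obtain m \<nu> where x: "\<nu> \<in> exponents I" "m \<in> Lpw \<nu>" "x = dfr m \<nu>"
      by (rule D_carrier_cases)
    have m: "m \<in> carrier R"
      using x by (simp add: Lpw_closed)
    show "\<phi> x \<in> carrier loc.L"
      using x m by (simp add: \<phi>)
    interpret loc_ring: cring loc.L
      by (rule loc.localization_cring)
    interpret J: ideal "Lpw \<nu>" R
      using x by (simp add: Lpw_ideal)
    have "loc.fr (\<ominus> m) (pw \<nu>) \<oplus>\<^bsub>loc.L\<^esub> \<phi> x = \<zero>\<^bsub>loc.L\<^esub>"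
      using x m by (simp add: \<phi> loc.loc_add loc.loc_zero)
        (intro loc.fr_eqI, auto simp: l_minus l_neg pow.multi_power_add[symmetric] intro!: imageI)
    then have "loc.fr (\<ominus> m) (pw \<nu>) = \<ominus>\<^bsub>loc.L\<^esub> \<phi> x"
      using x m by (intro loc_ring.minus_equality[symmetric]) (auto simp: \<phi>)
    then show "\<exists>y\<in>carrier D. \<phi> y = \<ominus>\<^bsub>loc.L\<^esub> \<phi> x"
      using x by (intro bexI[of _ "dfr (\<ominus> m) \<nu>"]) (auto simp: \<phi>)
    fix y assume "y \<in> carrier D"
    then obtain p \<mu> where y: "\<mu> \<in> exponents I" "p \<in> Lpw \<mu>" "y = dfr p \<mu>"
      by (rule D_carrier_cases)
    have p: "p \<in> carrier R"
      using y by (simp add: Lpw_closed)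
    show "x \<oplus>\<^bsub>D\<^esub> y \<in> carrier D \<and> \<phi> (x \<oplus>\<^bsub>D\<^esub> y) = \<phi> x \<oplus>\<^bsub>loc.L\<^esub> \<phi> y"
      using x y m p
      by (simp add: \<phi> loc.loc_add dfr_add dfr_add_num_in pow.multi_power_add m_comm)
    show "x \<otimes>\<^bsub>D\<^esub> y \<in> carrier D \<and> \<phi> (x \<otimes>\<^bsub>D\<^esub> y) = \<phi> x \<otimes>\<^bsub>loc.L\<^esub> \<phi> y"
      using x y m p by (simp add: \<phi> loc.loc_mult dfr_mult Lpw_mult pow.multi_power_add)
  qed (auto simp: \<phi> D_zero D_one Lpw_zero loc.loc_zero loc.loc_one)
qed

lemma dil_map_closed [simp]: "x \<in> carrier R \<Longrightarrow> \<iota> x \<in> carrier D"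
  by (simp add: dil_map_def Lpw_zero)

lemma dil_map_hom: "ring_hom_cring R D \<iota>"
proof (rule ring_hom_cringI)
  show "\<iota> \<in> ring_hom R D"
    by (rule ring_hom_memI) (auto simp: dil_map_def dfr_mult dfr_add D_one Lpw_zero)
qed (use is_cring dil_cring in auto)

lemma dfr_eq_zero_iff:
  assumes "\<nu> \<in> exponents I" "m \<in> Lpw \<nu>"
  shows "dfr m \<nu> = \<zero>\<^bsub>D\<^esub> \<longleftrightarrow> (\<exists>\<beta>\<in>exponents I. m \<otimes> pw \<beta> = \<zero>)"
proof -
  have "dfr m \<nu> = \<zero>\<^bsub>D\<^esub> \<longleftrightarrow> loc.fr m (pw \<nu>) = \<zero>\<^bsub>loc.L\<^esub>"
    using assms by (simp add: D_zero dfr_eq_iff Lpw_zero loc.loc_zero)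
  also have "\<dots> \<longleftrightarrow> (\<exists>\<beta>\<in>exponents I. pw \<beta> \<otimes> m = \<zero>)"
    using assms by (subst loc.fr_eq_zero_iff) (auto simp: Lpw_closed)
  finally show ?thesis
    using assms by (simp add: m_comm Lpw_closed)
qed

lemma dil_map_eq_zero_iff:
  "m \<in> carrier R \<Longrightarrow> \<iota> m = \<zero>\<^bsub>D\<^esub> \<longleftrightarrow> (\<exists>\<beta>\<in>exponents I. m \<otimes> pw \<beta> = \<zero>)"
  unfolding dil_map_def by (subst dfr_eq_zero_iff) (auto simp: Lpw_zero)

lemma dil_map_pw_times_dfr:
  assumes "\<nu> \<in> exponents I" "m \<in> Lpw \<nu>"
  shows "\<iota> (pw \<nu>) \<otimes>\<^bsub>D\<^esub> dfr m \<nu> = \<iota> m"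
proof -
  have m: "m \<in> carrier R"
    using assms by (simp add: Lpw_closed)
  have in': "pw \<nu> \<otimes> m \<in> Lpw \<nu>"
    using Lpw_mult[of 0 \<nu> "pw \<nu>" m] assms m by (simp add: Lpw_zero)
  have "loc.fr (pw \<nu> \<otimes> m) (pw \<nu>) = loc.fr m \<one>"
    using assms m
    by (intro loc.fr_eqI) (auto simp: m_comm)
  then show ?thesis
    using assms m in' by (simp add: dil_map_def dfr_mult Lpw_zero dfr_eq_iff)
qed

lemma dil_map_times_dfr_single:
  assumes "i \<in> I" "m \<in> Lid i"
  shows "\<iota> (a i) \<otimes>\<^bsub>D\<^esub> dfr m (\<delta> i) = \<iota> m"
    and "dfr m (\<delta> i) \<in> carrier D"
  using assms dil_map_pw_times_dfr[of "\<delta> i" m]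
  by (simp_all add: Lpw_single_one pow.multi_power_single_one del: One_nat_def)

text \<open>Clearing the denominator of \<open>y\<close> turns the hypothesis into one about its
  numerator: a monomial kills it, and that is how a fraction vanishes.\<close>

lemma dil_map_pw_nonzerodivisor:
  assumes "\<nu> \<in> exponents I"
  shows "nonzerodivisor D (\<iota> (pw \<nu>))"
proof (rule cring.nonzerodivisorI[OF dil_cring])
  interpret \<iota>: ring_hom_cring R D \<iota>
    by (rule dil_map_hom)
  show "\<iota> (pw \<nu>) \<in> carrier D"
    using assms by simp
  fix y assume "y \<in> carrier D" and eq: "\<iota> (pw \<nu>) \<otimes>\<^bsub>D\<^esub> y = \<zero>\<^bsub>D\<^esub>"
  then obtain m \<mu> where y: "\<mu> \<in> exponents I" "m \<in> Lpw \<mu>" "y = dfr m \<mu>"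
    by (metis D_carrier_cases)
  have m: "m \<in> carrier R"
    using y by (simp add: Lpw_closed)
  have "\<iota> (pw \<nu> \<otimes> m) = \<iota> (pw \<nu>) \<otimes>\<^bsub>D\<^esub> (\<iota> (pw \<mu>) \<otimes>\<^bsub>D\<^esub> y)"
    using assms m y by (simp add: dil_map_pw_times_dfr)
  also have "\<dots> = \<iota> (pw \<mu>) \<otimes>\<^bsub>D\<^esub> (\<iota> (pw \<nu>) \<otimes>\<^bsub>D\<^esub> y)"
    using assms y by (intro \<iota>.S.m_lcomm) auto
  also have "\<dots> = \<zero>\<^bsub>D\<^esub>"
    using y eq by simp
  finally obtain \<beta> where \<beta>: "\<beta> \<in> exponents I" "pw \<nu> \<otimes> m \<otimes> pw \<beta> = \<zero>"
    using assms m dil_map_eq_zero_iff[of "pw \<nu> \<otimes> m"] by auto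
  then have "m \<otimes> pw (\<nu> + \<beta>) = \<zero>"
    using assms m by (simp add: pow.multi_power_add m_ac)
  then show "y = \<zero>\<^bsub>D\<^esub>"
    using assms \<beta>(1) y by (auto simp: dfr_eq_zero_iff)
qed

lemma dil_map_a_nonzerodivisor: "i \<in> I \<Longrightarrow> nonzerodivisor D (\<iota> (a i))"
  using dil_map_pw_nonzerodivisor[of "\<delta> i"]
  by (simp add: pow.multi_power_single_one del: One_nat_def)

end


section \<open>The universal property\<close>

lemma alg_homI:
  assumes "\<theta> \<in> ring_hom B C" "\<theta> \<in> extensional (carrier B)"
    and "\<And>x. x \<in> carrier A \<Longrightarrow> \<theta> (f x) = g x"
  shows "\<theta> \<in> alg_hom A B f C g"
  using assms by (auto simp: alg_hom_def)

lemma alg_homD: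
  assumes "\<theta> \<in> alg_hom A B f C g"
  shows "\<theta> \<in> ring_hom B C" "\<theta> \<in> extensional (carrier B)"
    "\<And>x. x \<in> carrier A \<Longrightarrow> \<theta> (f x) = g x"
  using assms by (auto simp: alg_hom_def)

text \<open>Needed where the algebra to be identified with a dilatation is the source, while the
  criterion yields an isomorphism out of the dilatation. The inverse is cut down to the carrier to
  make it extensional.\<close>

lemma alg_iso_sym:
  assumes "ring B" "ring C" "\<theta> \<in> alg_iso A B f C g" "f \<in> carrier A \<rightarrow> carrier B"
  shows "restrict (inv_into (carrier B) \<theta>) (carrier C) \<in> alg_iso A C g B f"
proof -
  let ?\<psi> = "restrict (inv_into (carrier B) \<theta>) (carrier C)"
  have iso: "\<theta> \<in> ring_iso B C" and hom: "\<theta> \<in> alg_hom A B f C g"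
    using assms by (auto simp: alg_iso_def)
  have bij: "bij_betw \<theta> (carrier B) (carrier C)"
    using iso by (rule ring_iso_memE)
  have "inv_into (carrier B) \<theta> \<in> ring_iso C B"
    using assms(1) iso by (rule ring_iso_set_sym)
  then have "?\<psi> \<in> ring_iso C B"
    by (rule ring.ring_iso_restrict[OF assms(2)]) simp
  moreover have "?\<psi> (g x) = f x" if x: "x \<in> carrier A" for x
  proof -
    have fx: "f x \<in> carrier B"
      using assms(4) x by blast
    have "\<theta> (f x) \<in> carrier C" "inv_into (carrier B) \<theta> (\<theta> (f x)) = f x"
      using bij_betwE[OF bij] bij_betw_inv_into_left[OF bij] fx by auto
    then show ?thesis
      using alg_homD(3)[OF hom x] by simp
  qed
  ultimately show ?thesis
    by (simp add: alg_iso_def alg_hom_def ring_iso_def)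
qed

section \<open>Generators of the dilatation, domains and reduced rings\<close>

context multi_centered
begin

interpretation \<iota>: ring_hom_cring R D \<iota>
  by (rule dil_map_hom)

text \<open>Monomials are regular in the dilatation, so an equation without denominators determines
  the element.\<close>

lemma dfr_eqI:
  assumes "\<nu> \<in> exponents I" "m \<in> Lpw \<nu>" "x \<in> carrier D" "\<iota> (pw \<nu>) \<otimes>\<^bsub>D\<^esub> x = \<iota> m"
  shows "x = dfr m \<nu>"
proof (rule cring.nonzerodivisor_cancel[OF dil_cring dil_map_pw_nonzerodivisor[OF assms(1)]])
  show "\<iota> (pw \<nu>) \<otimes>\<^bsub>D\<^esub> x = \<iota> (pw \<nu>) \<otimes>\<^bsub>D\<^esub> dfr m \<nu>"
    using assms by (simp add: dil_map_pw_times_dfr)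
qed (use assms in auto)

text \<open>The fractions m/a_i generate the dilatation over A: (m + r a_i)/a_i is m/a_i + r, and
  L^(delta_i + nu) consists of sums of products from L_i and L^nu. A generator is described by the
  equation a_i y = m alone, which is the form that \<open>fraction_like\<close> asks for.\<close>

lemma D_carrier_induct [consumes 1, case_names map incl add mult]:
  assumes "x \<in> carrier D"
    and map: "\<And>r. r \<in> carrier R \<Longrightarrow> P (\<iota> r)"
    and incl: "\<And>i m y. i \<in> I \<Longrightarrow> m \<in> M i \<Longrightarrow> y \<in> carrier D \<Longrightarrow> \<iota> (a i) \<otimes>\<^bsub>D\<^esub> y = \<iota> m \<Longrightarrow> P y"
    and add: "\<And>x y. x \<in> carrier D \<Longrightarrow> y \<in> carrier D \<Longrightarrow> P x \<Longrightarrow> P y \<Longrightarrow> P (x \<oplus>\<^bsub>D\<^esub> y)"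
    and mult: "\<And>x y. x \<in> carrier D \<Longrightarrow> y \<in> carrier D \<Longrightarrow> P x \<Longrightarrow> P y \<Longrightarrow> P (x \<otimes>\<^bsub>D\<^esub> y)"
  shows "P x"
proof -
  have single: "P (dfr l (\<delta> i))" if i: "i \<in> I" and l: "l \<in> Lid i" for i l
  proof -
    obtain m r where m: "m \<in> M i" "r \<in> carrier R" "l = m \<oplus> r \<otimes> a i"
      using l by (auto simp: center_ideal_def set_add_def' cgenideal_def)
    have mR: "m \<in> carrier R"
      using ideal.Icarr[OF M_ideal] m i by blast
    define y where "y = dfr m (\<delta> i)"
    have y: "y \<in> carrier D" "\<iota> (a i) \<otimes>\<^bsub>D\<^esub> y = \<iota> m"
      using dil_map_times_dfr_single[of i m] M_subset_Lid i m by (auto simp: y_def)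
    have "y \<oplus>\<^bsub>D\<^esub> \<iota> r = dfr l (\<delta> i)"
    proof (rule dfr_eqI)
    qed (use y m mR i l in \<open>simp_all add: Lpw_single_one pow.multi_power_single_one
        \<iota>.S.r_distr \<iota>.S.m_comm del: One_nat_def\<close>)
    moreover have "P (y \<oplus>\<^bsub>D\<^esub> \<iota> r)"
      using y m i by (intro add map incl[of i m]) auto
    ultimately show ?thesis
      by simp
  qed
  have "\<forall>m\<in>Lpw \<nu>. P (dfr m \<nu>)" if "\<nu> \<in> exponents I" for \<nu>
    using that
  proof (induction rule: exponents_induct)
    case zero
    then show ?case
      using map by (auto simp: Lpw_zero dil_map_def)
  next
    case (add \<nu> i)
    let ?\<mu> = "\<delta> i + \<nu>"
    have \<mu>: "?\<mu> \<in> exponents I"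
      using add by simp
    have eq: "Lpw ?\<mu> = ideal_prod R (Lid i) (Lpw \<nu>)"
      using add by (simp add: Lpw_add Lpw_single_one del: One_nat_def)
    show ?case
    proof
      fix m assume "m \<in> Lpw ?\<mu>"
      then have "m \<in> ideal_prod R (Lid i) (Lpw \<nu>)"
        by (simp only: eq)
      then show "P (dfr m ?\<mu>)"
      proof (induction rule: ideal_prod.induct)
        case (prod x y)
        have "dfr (x \<otimes> y) ?\<mu> = dfr x (\<delta> i) \<otimes>\<^bsub>D\<^esub> dfr y \<nu>"
          using prod add by (subst dfr_mult) (simp_all add: Lpw_single_one del: One_nat_def)
        then show ?case
          using prod add single[of i x]
          by (simp add: mult Lpw_single_one dil_map_times_dfr_single(2) del: One_nat_def)
      next
        case (sum x y)
        have xy: "x \<in> Lpw ?\<mu>" "y \<in> Lpw ?\<mu>"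
          using sum by (simp_all only: eq)
        then have sum_in: "x \<oplus> y \<in> Lpw ?\<mu>"
          using Lpw_ideal[OF \<mu>] by (simp add: additive_subgroup.a_closed ideal.axioms(1))
        have "dfr x ?\<mu> \<oplus>\<^bsub>D\<^esub> dfr y ?\<mu> = dfr (x \<oplus> y) ?\<mu>"
        proof (rule dfr_eqI)
        qed (use \<mu> xy sum_in in \<open>simp_all add: \<iota>.S.r_distr dil_map_pw_times_dfr Lpw_closed[OF \<mu>]\<close>)
        then show ?case
          using assms(4)[of "dfr x ?\<mu>" "dfr y ?\<mu>"] \<mu> xy sum by simp
      qed
    qed
  qed
  then show ?thesis
    using assms(1) by (auto elim!: D_carrier_cases)
qed

text \<open>In a domain the monomials in nonzero a_i are nonzero, so only zero is killed by one. A
  fraction then vanishes exactly when its numerator does, and numerators multiply in A.\<close>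

lemma dil_domain:
  assumes "domain R" "\<And>i. i \<in> I \<Longrightarrow> a i \<noteq> \<zero>"
  shows "domain D"
proof -
  interpret R: domain R by fact
  have pw0: "pw \<nu> \<noteq> \<zero>" if "\<nu> \<in> exponents I" for \<nu>
    using that
  proof (induction rule: exponents_induct)
    case (add \<nu> i)
    then show ?case
      using assms(2)[of i] R.integral[of "a i" "pw \<nu>"]
      by (auto simp: pow.multi_power_add pow.multi_power_single_one simp del: One_nat_def)
  qed simp
  have \<iota>0: "m = \<zero>" if m: "m \<in> carrier R" "\<iota> m = \<zero>\<^bsub>D\<^esub>" for m
  proof -
    obtain \<beta> where "\<beta> \<in> exponents I" "m \<otimes> pw \<beta> = \<zero>"
      using m by (auto simp: dil_map_eq_zero_iff)
    then show ?thesis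
      using R.integral[of m "pw \<beta>"] pw0 m(1) by auto
  qed
  show ?thesis
  proof (rule domainI)
    show "cring D"
      by (rule dil_cring)
    show "\<one>\<^bsub>D\<^esub> \<noteq> \<zero>\<^bsub>D\<^esub>"
      using \<iota>0[of \<one>] by auto
    fix x y assume xy: "x \<otimes>\<^bsub>D\<^esub> y = \<zero>\<^bsub>D\<^esub>" "x \<in> carrier D" "y \<in> carrier D"
    obtain m \<nu> where x: "\<nu> \<in> exponents I" "m \<in> Lpw \<nu>" "x = dfr m \<nu>"
      using xy(2) by (rule D_carrier_cases)
    obtain p \<mu> where y: "\<mu> \<in> exponents I" "p \<in> Lpw \<mu>" "y = dfr p \<mu>"
      using xy(3) by (rule D_carrier_cases)
    have mp: "m \<in> carrier R" "p \<in> carrier R"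
      using x y by (auto simp: Lpw_closed)
    have "\<exists>\<beta>\<in>exponents I. m \<otimes> p \<otimes> pw \<beta> = \<zero>"
      using xy(1) x y by (simp add: dfr_mult dfr_eq_zero_iff Lpw_mult)
    then have "m \<otimes> p = \<zero>"
      using \<iota>0[of "m \<otimes> p"] mp dil_map_eq_zero_iff[of "m \<otimes> p"] by auto
    then have "m = \<zero> \<or> p = \<zero>"
      using mp by (intro R.integral) auto
    then show "x = \<zero>\<^bsub>D\<^esub> \<or> y = \<zero>\<^bsub>D\<^esub>"
      using x y by (auto simp: dfr_eq_zero_iff intro!: bexI[of _ 0])
  qed
qed

lemma dil_reduced:
  assumes "reduced R"
  shows "reduced D"
  unfolding reduced_def
proof (intro ballI allI impI)
  fix x and n :: nat assume xD: "x \<in> carrier D" and xn: "x [^]\<^bsub>D\<^esub> n = \<zero>\<^bsub>D\<^esub>"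
  obtain m \<nu> where x: "\<nu> \<in> exponents I" "m \<in> Lpw \<nu>" "x = dfr m \<nu>"
    using xD by (rule D_carrier_cases)
  have m: "m \<in> carrier R"
    using x by (simp add: Lpw_closed)
  have "\<iota> (m [^] n) = (\<iota> (pw \<nu>) \<otimes>\<^bsub>D\<^esub> x) [^]\<^bsub>D\<^esub> n"
    using x m by (simp add: dil_map_pw_times_dfr)
  also have "\<dots> = \<iota> (pw \<nu>) [^]\<^bsub>D\<^esub> n \<otimes>\<^bsub>D\<^esub> x [^]\<^bsub>D\<^esub> n"
    using x xD by (intro \<iota>.S.nat_pow_distrib) auto
  also have "\<dots> = \<zero>\<^bsub>D\<^esub>"
    using xn x by simp
  finally obtain \<beta> where \<beta>: "\<beta> \<in> exponents I" "m [^] n \<otimes> pw \<beta> = \<zero>"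
    using m dil_map_eq_zero_iff[of "m [^] n"] by auto
  \<comment> \<open>The monomial kills m^n and not m itself, so it is absorbed into the base. The
    exponent n + 1 leaves one full factor a^beta next to m^n even for n = 0.\<close>
  have "(m \<otimes> pw \<beta>) [^] Suc n = (m [^] n \<otimes> pw \<beta>) \<otimes> (m \<otimes> pw \<beta> [^] n)"
    using m \<beta>(1) by (simp add: nat_pow_distrib m_ac)
  also have "\<dots> = \<zero>"
    unfolding \<beta>(2) using m \<beta>(1) by simp
  finally have "m \<otimes> pw \<beta> = \<zero>"
    using assms m \<beta>(1) unfolding reduced_def by (metis m_closed pow.multi_power_closed)
  then show "x = \<zero>\<^bsub>D\<^esub>"
    using x \<beta>(1) by (auto simp: dfr_eq_zero_iff)
qed

text \<open>One inclusion is a_i in L_i; the other is l = a_i (l/a_i), which holds in the dilatation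
  for every l in L_i.\<close>

lemma dil_map_ideal_eq:
  assumes "i \<in> I"
  shows "PIdl\<^bsub>D\<^esub> (\<iota> (a i)) = Idl\<^bsub>D\<^esub> (\<iota> ` Lid i)"
proof -
  have LD: "\<iota> ` Lid i \<subseteq> carrier D"
    using assms ideal.Icarr[OF Lid_ideal] by auto
  have "\<iota> (a i) \<in> Idl\<^bsub>D\<^esub> (\<iota> ` Lid i)"
    using assms a_in_Lid \<iota>.S.genideal_self[OF LD] by auto
  then have "PIdl\<^bsub>D\<^esub> (\<iota> (a i)) \<subseteq> Idl\<^bsub>D\<^esub> (\<iota> ` Lid i)"
    by (intro \<iota>.S.cgenideal_minimal \<iota>.S.genideal_ideal LD)
  moreover have "\<iota> l \<in> PIdl\<^bsub>D\<^esub> (\<iota> (a i))" if l: "l \<in> Lid i" for l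
  proof -
    define y where "y = dfr l (\<delta> i)"
    have y: "y \<in> carrier D" "\<iota> (a i) \<otimes>\<^bsub>D\<^esub> y = \<iota> l"
      using dil_map_times_dfr_single[OF assms l] by (simp_all add: y_def)
    have "\<iota> l = y \<otimes>\<^bsub>D\<^esub> \<iota> (a i)"
      unfolding y(2)[symmetric] using y(1) assms by (intro \<iota>.S.m_comm) auto
    then show ?thesis
      using y(1) unfolding cgenideal_def by blast
  qed
  then have "Idl\<^bsub>D\<^esub> (\<iota> ` Lid i) \<subseteq> PIdl\<^bsub>D\<^esub> (\<iota> (a i))"
    using assms by (intro \<iota>.S.genideal_minimal \<iota>.S.cgenideal_ideal) auto
  ultimately show ?thesis
    by blast
qed

end

text \<open>The algebras on which the functor takes a nonempty value, with the inclusion of ideals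
  replaced by divisibility of elements. Every algebra to which the criterion is applied is first
  shown to be an instance.\<close>

locale regular_target = multi_centered R I M a + hom: ring_hom_cring R B f
  for R :: "('a, 'm) ring_scheme" (structure) and I :: "'i set" and M a
    and B :: "('b, 'n) ring_scheme" (structure) and f +
  assumes regular: "i \<in> I \<Longrightarrow> nonzerodivisor B (f (a i))"
    and divisible: "i \<in> I \<Longrightarrow> m \<in> M i \<Longrightarrow> \<exists>y\<in>carrier B. f m = f (a i) \<otimes>\<^bsub>B\<^esub> y"
begin

interpretation \<iota>: ring_hom_cring R D \<iota>
  by (rule dil_map_hom)

lemma hom_pw_nonzerodivisor:
  assumes "\<nu> \<in> exponents I"
  shows "nonzerodivisor B (f (pw \<nu>))"
proof -
  interpret B: monoid_family B I "\<lambda>i. f (a i)"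
    by unfold_locales simp
  show ?thesis
    using B.nonzerodivisor_multi_power[OF hom.S.is_cring regular] assms
    by (simp add: hom.hom_multi_power[OF a_closed])
qed

lemma divisible_Lid:
  assumes "i \<in> I" "l \<in> Lid i"
  shows "\<exists>y\<in>carrier B. f l = f (a i) \<otimes>\<^bsub>B\<^esub> y"
proof -
  obtain m r where m: "m \<in> M i" "r \<in> carrier R" "l = m \<oplus> r \<otimes> a i"
    using assms by (auto simp: center_ideal_def set_add_def' cgenideal_def)
  then have mR: "m \<in> carrier R"
    using ideal.Icarr[OF M_ideal] assms by blast
  obtain y where y: "y \<in> carrier B" "f m = f (a i) \<otimes>\<^bsub>B\<^esub> y"
    using divisible assms m by blast
  have "f l = f (a i) \<otimes>\<^bsub>B\<^esub> (y \<oplus>\<^bsub>B\<^esub> f r)"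
    using assms y m mR by (simp add: hom.S.r_distr hom.S.m_comm)
  then show ?thesis
    using y m by blast
qed

lemma divisible_Lpw:
  assumes "\<nu> \<in> exponents I" "m \<in> Lpw \<nu>"
  shows "\<exists>y\<in>carrier B. f m = f (pw \<nu>) \<otimes>\<^bsub>B\<^esub> y"
proof -
  \<comment> \<open>The preimage of the principal ideal generated by f(a^nu). As it is an ideal, the
    inclusion of a product of ideals in it may be tested on products of elements.\<close>
  define K where "K \<nu> = {r \<in> carrier R. f r \<in> PIdl\<^bsub>B\<^esub> (f (pw \<nu>))}" for \<nu>
  have K: "ideal (K \<nu>) R" if "\<nu> \<in> exponents I" for \<nu>
    unfolding K_def using that by (intro hom.ring.ideal_vimage hom.S.cgenideal_ideal) simp
  have K_iff: "x \<in> K \<nu> \<longleftrightarrow> x \<in> carrier R \<and> (\<exists>y\<in>carrier B. f x = f (pw \<nu>) \<otimes>\<^bsub>B\<^esub> y)"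
    if "\<nu> \<in> exponents I" for \<nu> x
    using that hom.S.m_comm by (auto simp: K_def cgenideal_def)
  have "Lpw \<nu> \<subseteq> K \<nu>"
    using assms(1)
  proof (induction rule: exponents_induct)
    case zero
    then show ?case
      by (auto simp: Lpw_zero K_iff intro!: bexI)
  next
    case (add \<nu> i)
    have pw: "pw (\<delta> i + \<nu>) = a i \<otimes> pw \<nu>"
      using add.hyps by (simp add: pow.multi_power_add pow.multi_power_single_one del: One_nat_def)
    have "x \<otimes> y \<in> K (\<delta> i + \<nu>)" if xL: "x \<in> Lid i" and yL: "y \<in> Lpw \<nu>" for x y
    proof -
      have xy: "x \<in> carrier R" "y \<in> carrier R"
        using xL yL add.hyps ideal.Icarr[OF Lid_ideal] Lpw_closed by auto
      obtain u where u: "u \<in> carrier B" "f x = f (a i) \<otimes>\<^bsub>B\<^esub> u"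
        using divisible_Lid[OF add.hyps(2) xL] by blast
      obtain v where v: "v \<in> carrier B" "f y = f (pw \<nu>) \<otimes>\<^bsub>B\<^esub> v"
        using add.IH yL K_iff[OF add.hyps(1)] by blast
      have cl: "f (a i) \<in> carrier B" "f (pw \<nu>) \<in> carrier B"
        using add.hyps by auto
      have "f (x \<otimes> y) = (f (a i) \<otimes>\<^bsub>B\<^esub> u) \<otimes>\<^bsub>B\<^esub> (f (pw \<nu>) \<otimes>\<^bsub>B\<^esub> v)"
        using xy by (simp add: u(2) v(2))
      also have "\<dots> = f (a i \<otimes> pw \<nu>) \<otimes>\<^bsub>B\<^esub> (u \<otimes>\<^bsub>B\<^esub> v)"
        using cl u(1) v(1) add.hyps by (simp add: hom.S.m_ac)
      finally show ?thesis
        using u(1) v(1) xy add.hyps K_iff[of "\<delta> i + \<nu>"]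
        by (auto simp: pw simp del: One_nat_def)
    qed
    then show ?case
      using add K by (simp add: Lpw_add Lpw_single_one ideal_prod_subset_iff Lid_ideal Lpw_ideal
          del: One_nat_def)
  qed
  then show ?thesis
    using assms by (auto simp: K_iff)
qed

text \<open>The graph of the homomorphism induced on the dilatation.\<close>

definition induced :: "('a \<times> ('i \<Rightarrow>\<^sub>0 nat)) set \<Rightarrow> 'b \<Rightarrow> bool" where
  "induced x y \<longleftrightarrow> y \<in> carrier B \<and>
    (\<exists>\<nu>\<in>exponents I. \<exists>m\<in>Lpw \<nu>. x = dfr m \<nu> \<and> f (pw \<nu>) \<otimes>\<^bsub>B\<^esub> y = f m)"

lemma inducedI:
  "\<nu> \<in> exponents I \<Longrightarrow> m \<in> Lpw \<nu> \<Longrightarrow> y \<in> carrier B \<Longrightarrow> f (pw \<nu>) \<otimes>\<^bsub>B\<^esub> y = f m \<Longrightarrow>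
    induced (dfr m \<nu>) y"
  unfolding induced_def by blast

lemma induced_map: "r \<in> carrier R \<Longrightarrow> induced (\<iota> r) (f r)"
  unfolding dil_map_def by (rule inducedI) (simp_all add: Lpw_zero)

lemma induced_mult: "induced x y \<Longrightarrow> induced x' y' \<Longrightarrow> induced (x \<otimes>\<^bsub>D\<^esub> x') (y \<otimes>\<^bsub>B\<^esub> y')"
  and induced_add: "induced x y \<Longrightarrow> induced x' y' \<Longrightarrow> induced (x \<oplus>\<^bsub>D\<^esub> x') (y \<oplus>\<^bsub>B\<^esub> y')"
proof -
  assume "induced x y" "induced x' y'"
  then obtain \<nu> m \<mu> p where
    x: "y \<in> carrier B" "\<nu> \<in> exponents I" "m \<in> Lpw \<nu>" "x = dfr m \<nu>" "f (pw \<nu>) \<otimes>\<^bsub>B\<^esub> y = f m"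
    and x': "y' \<in> carrier B" "\<mu> \<in> exponents I" "p \<in> Lpw \<mu>" "x' = dfr p \<mu>"
      "f (pw \<mu>) \<otimes>\<^bsub>B\<^esub> y' = f p"
    unfolding induced_def by blast
  have cl: "pw \<nu> \<in> carrier R" "pw \<mu> \<in> carrier R" "m \<in> carrier R" "p \<in> carrier R"
    using x x' by (auto simp: Lpw_closed)
  note fc = cl[THEN hom.hom_closed]
  have pw: "pw (\<nu> + \<mu>) = pw \<nu> \<otimes> pw \<mu>" "pw (\<mu> + \<nu>) = pw \<nu> \<otimes> pw \<mu>"
    using x(2) x'(2) cl(1,2) by (simp_all add: pow.multi_power_add m_comm)
  have "f (pw \<nu>) \<otimes>\<^bsub>B\<^esub> f (pw \<mu>) \<otimes>\<^bsub>B\<^esub> (y \<otimes>\<^bsub>B\<^esub> y') =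
      (f (pw \<nu>) \<otimes>\<^bsub>B\<^esub> y) \<otimes>\<^bsub>B\<^esub> (f (pw \<mu>) \<otimes>\<^bsub>B\<^esub> y')"
    using fc x(1) x'(1) by (simp add: hom.S.m_ac)
  then have "f (pw (\<nu> + \<mu>)) \<otimes>\<^bsub>B\<^esub> (y \<otimes>\<^bsub>B\<^esub> y') = f (m \<otimes> p)"
    using cl by (simp add: pw x(5) x'(5))
  then show "induced (x \<otimes>\<^bsub>D\<^esub> x') (y \<otimes>\<^bsub>B\<^esub> y')"
    unfolding x(4) x'(4) dfr_mult[OF x(2,3) x'(2,3)] using x(1-3) x'(1-3)
    by (intro inducedI) (simp_all add: Lpw_mult)
  have "f (pw \<nu>) \<otimes>\<^bsub>B\<^esub> f (pw \<mu>) \<otimes>\<^bsub>B\<^esub> (y \<oplus>\<^bsub>B\<^esub> y') =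
      f (pw \<mu>) \<otimes>\<^bsub>B\<^esub> (f (pw \<nu>) \<otimes>\<^bsub>B\<^esub> y) \<oplus>\<^bsub>B\<^esub> f (pw \<nu>) \<otimes>\<^bsub>B\<^esub> (f (pw \<mu>) \<otimes>\<^bsub>B\<^esub> y')"
    using fc x(1) x'(1) by (simp add: hom.S.m_ac hom.S.r_distr hom.S.l_distr)
  then have "f (pw (\<mu> + \<nu>)) \<otimes>\<^bsub>B\<^esub> (y \<oplus>\<^bsub>B\<^esub> y') = f (m \<otimes> pw \<mu> \<oplus> p \<otimes> pw \<nu>)"
    using cl by (simp add: pw x(5) x'(5) hom.S.m_comm)
  then show "induced (x \<oplus>\<^bsub>D\<^esub> x') (y \<oplus>\<^bsub>B\<^esub> y')"
    unfolding x(4) x'(4) dfr_add[OF x(2,3) x'(2,3)] using x(1-3) x'(1-3)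
    by (intro inducedI) (simp_all add: dfr_add_num_in)
qed

lemma induced_total:
  assumes "x \<in> carrier D"
  shows "\<exists>y. induced x y"
proof -
  obtain m \<nu> where x: "\<nu> \<in> exponents I" "m \<in> Lpw \<nu>" "x = dfr m \<nu>"
    using assms by (rule D_carrier_cases)
  then show ?thesis
    using divisible_Lpw[OF x(1,2)] unfolding induced_def by metis
qed

lemma induced_zero:
  assumes "induced \<zero>\<^bsub>D\<^esub> y"
  shows "y = \<zero>\<^bsub>B\<^esub>"
proof -
  obtain \<nu> m where y: "y \<in> carrier B" "\<nu> \<in> exponents I" "m \<in> Lpw \<nu>" "\<zero>\<^bsub>D\<^esub> = dfr m \<nu>"
      "f (pw \<nu>) \<otimes>\<^bsub>B\<^esub> y = f m"
    using assms unfolding induced_def by blast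
  have m: "m \<in> carrier R"
    using y by (simp add: Lpw_closed)
  obtain \<beta> where \<beta>: "\<beta> \<in> exponents I" "m \<otimes> pw \<beta> = \<zero>"
    using dfr_eq_zero_iff[OF y(2,3)] y(4) by auto
  \<comment> \<open>a^beta kills m in A and is regular in B, so f m = 0; regularity of a^nu then
    removes the denominator.\<close>
  have "f (pw \<beta>) \<otimes>\<^bsub>B\<^esub> f m = f (m \<otimes> pw \<beta>)"
    using \<beta>(1) m by (simp add: hom.S.m_comm)
  then have "f m = \<zero>\<^bsub>B\<^esub>"
    using hom.S.nonzerodivisorD[OF hom_pw_nonzerodivisor[OF \<beta>(1)], of "f m"] \<beta> m by simp
  then show ?thesis
    using hom.S.nonzerodivisorD[OF hom_pw_nonzerodivisor[OF y(2)] y(1)] y by simp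
qed

lemma induced_unique:
  assumes "induced x y" "induced x z"
  shows "y = z"
proof -
  have cl: "x \<in> carrier D" "y \<in> carrier B" "z \<in> carrier B"
    using assms unfolding induced_def by auto
  \<comment> \<open>The graph is closed under sums and products and contains the pairs coming from
    A, so the difference is formed with the factor -1 taken from A.\<close>
  have "induced (x \<oplus>\<^bsub>D\<^esub> \<iota> (\<ominus> \<one>) \<otimes>\<^bsub>D\<^esub> x) (y \<oplus>\<^bsub>B\<^esub> f (\<ominus> \<one>) \<otimes>\<^bsub>B\<^esub> z)"
    using assms by (intro induced_add induced_mult induced_map) auto
  moreover have "x \<oplus>\<^bsub>D\<^esub> \<iota> (\<ominus> \<one>) \<otimes>\<^bsub>D\<^esub> x = \<zero>\<^bsub>D\<^esub>"
    using cl by (simp add: \<iota>.S.l_minus \<iota>.S.r_neg)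
  moreover have "y \<oplus>\<^bsub>B\<^esub> f (\<ominus> \<one>) \<otimes>\<^bsub>B\<^esub> z = y \<ominus>\<^bsub>B\<^esub> z"
    using cl by (simp add: hom.S.l_minus hom.S.minus_eq)
  ultimately have "y \<ominus>\<^bsub>B\<^esub> z = \<zero>\<^bsub>B\<^esub>"
    using induced_zero by simp
  then show ?thesis
    using cl by simp
qed

lemma alg_hom_times_pw:
  assumes \<theta>: "\<theta> \<in> alg_hom R D \<iota> B f" and "\<nu> \<in> exponents I" "m \<in> Lpw \<nu>"
  shows "f (pw \<nu>) \<otimes>\<^bsub>B\<^esub> \<theta> (dfr m \<nu>) = f m"
proof -
  have "\<theta> (\<iota> (pw \<nu>) \<otimes>\<^bsub>D\<^esub> dfr m \<nu>) = \<theta> (\<iota> (pw \<nu>)) \<otimes>\<^bsub>B\<^esub> \<theta> (dfr m \<nu>)"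
    using assms by (intro ring_hom_mult[OF alg_homD(1)[OF \<theta>]]) auto
  then show ?thesis
    using assms alg_homD(3)[OF \<theta>] by (simp add: dil_map_pw_times_dfr Lpw_closed)
qed

text \<open>Existence comes from the graph, which is total and single-valued. For uniqueness, the
  value y at m/a^nu must satisfy f(a^nu) y = f m, and f(a^nu) is regular.\<close>

lemma alg_hom_dil_singleton: "\<exists>\<theta>. alg_hom R D \<iota> B f = {\<theta>}"
proof -
  have dom: "x \<in> carrier D" if "induced x y" for x y
    using that unfolding induced_def by auto
  define \<theta> where "\<theta> = (\<lambda>x\<in>carrier D. THE y. induced x y)"
  have \<theta>: "\<theta> x = y" if "induced x y" for x y
  proof -
    have "(THE y. induced x y) = y"
      using that by (intro the_equality) (auto intro: induced_unique)
    then show ?thesis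
      using dom[OF that] by (simp add: \<theta>_def)
  qed
  have \<theta>': "induced x (\<theta> x)" if "x \<in> carrier D" for x
    using induced_total[OF that] \<theta> by auto
  have "\<theta> \<in> alg_hom R D \<iota> B f"
  proof (rule alg_homI)
    show "\<theta> \<in> ring_hom D B"
    proof (rule ring_hom_memI)
      show "\<theta> x \<in> carrier B" if "x \<in> carrier D" for x
        using \<theta>'[OF that] by (simp add: induced_def)
      show "\<theta> \<one>\<^bsub>D\<^esub> = \<one>\<^bsub>B\<^esub>"
        using \<theta>[OF induced_map[of \<one>]] by simp
    qed (auto intro!: \<theta> induced_mult induced_add \<theta>')
    show "\<theta> \<in> extensional (carrier D)"
      by (simp add: \<theta>_def)
  qed (auto intro: \<theta> induced_map)
  moreover have "\<psi> = \<theta>'" if "\<psi> \<in> alg_hom R D \<iota> B f" "\<theta>' \<in> alg_hom R D \<iota> B f" for \<psi> \<theta>'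
  proof (rule extensionalityI)
    show "\<psi> \<in> extensional (carrier D)" "\<theta>' \<in> extensional (carrier D)"
      using that by (auto dest: alg_homD)
    fix x assume xD: "x \<in> carrier D"
    then obtain m \<nu> where x: "\<nu> \<in> exponents I" "m \<in> Lpw \<nu>" "x = dfr m \<nu>"
      by (rule D_carrier_cases)
    show "\<psi> x = \<theta>' x"
    proof (rule hom.S.nonzerodivisor_cancel[OF hom_pw_nonzerodivisor[OF x(1)]])
      show "f (pw \<nu>) \<otimes>\<^bsub>B\<^esub> \<psi> x = f (pw \<nu>) \<otimes>\<^bsub>B\<^esub> \<theta>' x"
        using alg_hom_times_pw[OF that(1) x(1,2)] alg_hom_times_pw[OF that(2) x(1,2)] x(3) by simp
    qed (rule ring_hom_closed[OF alg_homD(1)[OF that(1)] xD]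
          ring_hom_closed[OF alg_homD(1)[OF that(2)] xD])+
  qed
  ultimately show ?thesis
    by blast
qed

text \<open>The image in B of the homomorphism from the dilatation, expressed without mentioning the
  dilatation. Through the graph \<open>induced\<close> it inherits closure under the
  operations.\<close>

definition fraction_like :: "'b set" where
  "fraction_like = {y \<in> carrier B. \<exists>\<nu>\<in>exponents I. \<exists>m\<in>Lpw \<nu>. f (pw \<nu>) \<otimes>\<^bsub>B\<^esub> y = f m}"

lemma fraction_like_iff: "y \<in> fraction_like \<longleftrightarrow> (\<exists>x. induced x y)"
  unfolding fraction_like_def induced_def by blast

lemma fraction_like_map: "r \<in> carrier R \<Longrightarrow> f r \<in> fraction_like"
  unfolding fraction_like_iff by (blast intro: induced_map)

lemma fraction_like_single:
  assumes "i \<in> I" "m \<in> Lid i" "y \<in> carrier B" "f (a i) \<otimes>\<^bsub>B\<^esub> y = f m"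
  shows "y \<in> fraction_like"
  using assms unfolding fraction_like_def
  by (auto simp: Lpw_single_one pow.multi_power_single_one simp del: One_nat_def
      intro!: bexI[of _ "\<delta> i"] bexI[of _ m])

lemma fraction_like_mult:
    "x \<in> fraction_like \<Longrightarrow> y \<in> fraction_like \<Longrightarrow> x \<otimes>\<^bsub>B\<^esub> y \<in> fraction_like"
  and fraction_like_add:
    "x \<in> fraction_like \<Longrightarrow> y \<in> fraction_like \<Longrightarrow> x \<oplus>\<^bsub>B\<^esub> y \<in> fraction_like"
  unfolding fraction_like_iff by (blast intro: induced_mult induced_add)+

theorem canonically_isomorphicI:
  assumes kernel: "\<And>m. m \<in> carrier R \<Longrightarrow> f m = \<zero>\<^bsub>B\<^esub> \<Longrightarrow> \<exists>\<beta>\<in>exponents I. m \<otimes> pw \<beta> = \<zero>"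
    and surj: "\<And>y. y \<in> carrier B \<Longrightarrow> y \<in> fraction_like"
  shows "canonically_isomorphic R D \<iota> B f"
proof -
  obtain \<theta> where hom_set: "alg_hom R D \<iota> B f = {\<theta>}"
    using alg_hom_dil_singleton by blast
  then have \<theta>: "\<theta> \<in> alg_hom R D \<iota> B f"
    by simp
  interpret \<theta>: ring_hom_cring D B \<theta>
    using \<theta> dil_cring by (intro ring_hom_cringI alg_homD(1)[OF \<theta>]) (auto simp: hom.S.is_cring)
  have ker: "x = \<zero>\<^bsub>D\<^esub>" if xD: "x \<in> carrier D" and "\<theta> x = \<zero>\<^bsub>B\<^esub>" for x
  proof -
    obtain m \<nu> where x: "\<nu> \<in> exponents I" "m \<in> Lpw \<nu>" "x = dfr m \<nu>"
      using xD by (rule D_carrier_cases)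
    \<comment> \<open>Multiplying by f(a^nu) moves the question from the fraction to its numerator,
      which lies in A; hence a hypothesis on the kernel of f suffices.\<close>
    have "f m = \<zero>\<^bsub>B\<^esub>"
      using alg_hom_times_pw[OF \<theta> x(1,2)] that x by simp
    then show ?thesis
      using kernel[of m] x Lpw_closed by (auto simp: dfr_eq_zero_iff)
  qed
  have "a_kernel D B \<theta> = {\<zero>\<^bsub>D\<^esub>}"
  proof
    show "a_kernel D B \<theta> \<subseteq> {\<zero>\<^bsub>D\<^esub>}"
      unfolding a_kernel_def' using ker by blast
    show "{\<zero>\<^bsub>D\<^esub>} \<subseteq> a_kernel D B \<theta>"
      using \<theta>.hom_zero \<iota>.S.zero_closed unfolding a_kernel_def' by blast
  qed
  then have "inj_on \<theta> (carrier D)"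
    by (rule \<theta>.ring.trivial_ker_imp_inj)
  moreover have "y \<in> \<theta> ` carrier D" if y: "y \<in> carrier B" for y
  proof -
    obtain \<nu> m where m: "\<nu> \<in> exponents I" "m \<in> Lpw \<nu>" "f (pw \<nu>) \<otimes>\<^bsub>B\<^esub> y = f m"
      using surj[OF y] by (auto simp: fraction_like_def)
    have "\<theta> (dfr m \<nu>) = y"
    proof (rule hom.S.nonzerodivisor_cancel[OF hom_pw_nonzerodivisor[OF m(1)]])
    qed (use m y alg_hom_times_pw[OF \<theta> m(1,2)] in simp_all)
    then show ?thesis
      using dfr_closed[OF m(1,2)] by blast
  qed
  ultimately have "bij_betw \<theta> (carrier D) (carrier B)"
    unfolding bij_betw_def using \<theta>.hom_closed by blast
  then have "\<theta> \<in> ring_iso D B"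
    using alg_homD(1)[OF \<theta>] by (simp add: ring_iso_def)
  then show ?thesis
    using hom_set \<theta> by (auto simp: canonically_isomorphic_def alg_iso_def)
qed

end


section \<open>Dilatations inside localizations\<close>

text \<open>Divisibility is pushed forward by homomorphisms, while regularity is part of being an
  object. Besides functoriality this shows that every object receiving a map from the dilatation has
  a nonempty value.\<close>

lemma regular_target_transfer:
  assumes "regular_target A I M a B f" "reg_algebra A I a C g" "\<theta> \<in> alg_hom A B f C g"
  shows "regular_target A I M a C g"
proof -
  interpret B: regular_target A I M a B f by fact
  have hom: "ring_hom_cring A C g" and reg: "\<And>i. i \<in> I \<Longrightarrow> nonzerodivisor C (g (a i))"
    using assms(2) by (auto simp: reg_algebra_def)
  have div: "\<exists>y\<in>carrier C. g m = g (a i) \<otimes>\<^bsub>C\<^esub> y" if i: "i \<in> I" and m: "m \<in> M i" for i m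
  proof -
    obtain y where y: "y \<in> carrier B" "f m = f (a i) \<otimes>\<^bsub>B\<^esub> y"
      using B.divisible[OF i m] by blast
    have mA: "m \<in> carrier A"
      using ideal.Icarr[OF B.M_ideal[OF i] m] .
    have "g m = \<theta> (f (a i) \<otimes>\<^bsub>B\<^esub> y)"
      using alg_homD(3)[OF assms(3) mA] by (simp add: y(2))
    also have "\<dots> = g (a i) \<otimes>\<^bsub>C\<^esub> \<theta> y"
      using ring_hom_mult[OF alg_homD(1)[OF assms(3)], of "f (a i)" y] y(1) i
        alg_homD(3)[OF assms(3), of "a i"] by simp
    finally show ?thesis
      using ring_hom_closed[OF alg_homD(1)[OF assms(3)] y(1)] by blast
  qed
  show ?thesis
    by (intro regular_target.intro regular_target_axioms.intro B.multi_centered_axioms hom reg div)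
qed

section \<open>Representability\<close>

context multi_centered
begin

lemma dil_reg_algebra: "reg_algebra R I a D \<iota>"
  by (simp add: reg_algebra_def dil_map_hom dil_map_a_nonzerodivisor)

lemma dil_regular_target: "regular_target R I M a D \<iota>"
proof (rule regular_target.intro[OF multi_centered_axioms dil_map_hom regular_target_axioms.intro])
  show "nonzerodivisor D (\<iota> (a i))" if "i \<in> I" for i
    using that by (rule dil_map_a_nonzerodivisor)
  show "\<exists>y\<in>carrier D. \<iota> m = \<iota> (a i) \<otimes>\<^bsub>D\<^esub> y" if i: "i \<in> I" and m: "m \<in> M i" for i m
  proof -
    have l: "m \<in> Lid i"
      using M_subset_Lid[OF i] m by blast
    show ?thesis
      using dil_map_times_dfr_single(1)[OF i l, symmetric] dil_map_times_dfr_single(2)[OF i l]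
      by blast
  qed
qed

lemma regular_target_iff_ideals:
  assumes "reg_algebra R I a B f"
  shows "regular_target R I M a B f \<longleftrightarrow>
    (\<forall>i\<in>I. Idl\<^bsub>B\<^esub> (f ` M i) \<subseteq> PIdl\<^bsub>B\<^esub> (f (a i)))"
proof -
  have hom: "ring_hom_cring R B f" and reg: "\<And>i. i \<in> I \<Longrightarrow> nonzerodivisor B (f (a i))"
    using assms by (auto simp: reg_algebra_def)
  interpret f: ring_hom_cring R B f
    by (rule hom)
  have eq: "Idl\<^bsub>B\<^esub> (f ` M i) \<subseteq> PIdl\<^bsub>B\<^esub> (f (a i)) \<longleftrightarrow>
      (\<forall>m\<in>M i. \<exists>y\<in>carrier B. f m = f (a i) \<otimes>\<^bsub>B\<^esub> y)" if i: "i \<in> I" for i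
  proof -
    have MR: "M i \<subseteq> carrier R"
      using ideal.Icarr[OF M_ideal[OF i]] by blast
    have ai: "f (a i) \<in> carrier B"
      using i by simp
    have "Idl\<^bsub>B\<^esub> (f ` M i) \<subseteq> PIdl\<^bsub>B\<^esub> (f (a i)) \<longleftrightarrow> f ` M i \<subseteq> PIdl\<^bsub>B\<^esub> (f (a i))"
      using MR by (intro f.S.Idl_subset_ideal f.S.cgenideal_ideal ai) auto
    also have "\<dots> \<longleftrightarrow> (\<forall>m\<in>M i. \<exists>y\<in>carrier B. f m = f (a i) \<otimes>\<^bsub>B\<^esub> y)"
      using f.S.m_comm[OF ai] by (auto simp: cgenideal_def image_subset_iff)
    finally show ?thesis .
  qed
  show ?thesis
    unfolding regular_target_def regular_target_axioms_def
    using eq reg hom multi_centered_axioms by auto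
qed

lemma dil_functor_eq:
  "reg_algebra R I a B f \<Longrightarrow>
    dil_functor R I M a B f = (if regular_target R I M a B f then {()} else {})"
  by (simp add: dil_functor_def regular_target_iff_ideals)

lemma dil_set_functor:
  "set_functor R I a (dil_functor R I M a :: 'b ring \<Rightarrow> ('a \<Rightarrow> 'b) \<Rightarrow> unit set) dil_functor_map"
  unfolding set_functor_def dil_functor_map_def
  by (auto simp: dil_functor_eq intro: regular_target_transfer)

lemma dil_represents:
  "represents R I a (dil_functor R I M a :: 'b ring \<Rightarrow> ('a \<Rightarrow> 'b) \<Rightarrow> unit set) dil_functor_map D \<iota>"
proof -
  have "bij_betw (\<lambda>_. ()) (alg_hom R D \<iota> B f) (dil_functor R I M a B f)"
    if B: "reg_algebra R I a B f" for B :: "'b ring" and f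
  proof (cases "regular_target R I M a B f")
    case True
    obtain \<theta> where "alg_hom R D \<iota> B f = {\<theta>}"
      using regular_target.alg_hom_dil_singleton[OF True] by blast
    then show ?thesis
      using True B by (simp add: dil_functor_eq bij_betw_def)
  next
    case False
    \<comment> \<open>A homomorphism out of the dilatation would carry the divisibility of M_i by
      a_i into B.\<close>
    then have "alg_hom R D \<iota> B f = {}"
      using regular_target_transfer[OF dil_regular_target B] by blast
    then show ?thesis
      using False B by (simp add: dil_functor_eq bij_betw_def)
  qed
  then show ?thesis
    unfolding represents_def dil_functor_map_def
    \<comment> \<open>The functor has values in a one-point type, so there is only one candidate for
      the natural isomorphism and naturality is automatic.\<close>
    by (intro conjI dil_reg_algebra exI[of _ "\<lambda>_ _ _. ()"]) auto
qed

end

section \<open>Subalgebras of a localization\<close>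

context mult_subset
begin

interpretation L: cring L
  by (rule localization_cring)

interpretation f: ring_hom_cring R L "loc_map R S"
  by (rule loc_map_hom)

lemma subalgebra_ring_hom:
  assumes "subalgebra_of R L (loc_map R S) C"
  shows "ring_hom_cring R (L\<lparr>carrier := C\<rparr>) (loc_map R S)"
proof (rule ring_hom_cringI)
  have C: "subring C L" "loc_map R S ` carrier R \<subseteq> C"
    using assms by (auto simp: subalgebra_of_def)
  show "cring R"
    by (rule is_cring)
  show "cring (L\<lparr>carrier := C\<rparr>)"
    using L.subcringI'[OF C(1)] L.subcring_iff subringE(1)[OF C(1)] by blast
  show "loc_map R S \<in> ring_hom R (L\<lparr>carrier := C\<rparr>)"
    using C(2) by (intro ring_hom_memI) auto
qed

text \<open>Elements of S are units in the localization, hence regular there, and regularity passes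
  to subrings.\<close>

lemma subalgebra_nonzerodivisor:
  assumes "subalgebra_of R L (loc_map R S) C" "s \<in> S"
  shows "nonzerodivisor (L\<lparr>carrier := C\<rparr>) (loc_map R S s)"
proof -
  have "C \<subseteq> carrier L" "loc_map R S s \<in> C"
    using assms S_closed by (auto simp: subalgebra_of_def dest: subringE(1))
  then show ?thesis
    using L.nonzerodivisorD[OF loc_map_nonzerodivisor_S[OF assms(2)]]
    unfolding nonzerodivisor_def by auto
qed

text \<open>Negation comes from multiplication by the image of -1, so closure under sums and
  products is all there is to check.\<close>

lemma subalgebra_ofI:
  assumes "C \<subseteq> carrier L" "loc_map R S ` carrier R \<subseteq> C"
    and "\<And>x y. x \<in> C \<Longrightarrow> y \<in> C \<Longrightarrow> x \<otimes>\<^bsub>L\<^esub> y \<in> C"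
    and "\<And>x y. x \<in> C \<Longrightarrow> y \<in> C \<Longrightarrow> x \<oplus>\<^bsub>L\<^esub> y \<in> C"
  shows "subalgebra_of R L (loc_map R S) C"
proof -
  have "subring C L"
  proof (rule L.subringI)
    have fC: "loc_map R S r \<in> C" if "r \<in> carrier R" for r
      using assms(2) that by blast
    show "\<one>\<^bsub>L\<^esub> \<in> C"
      using fC[of \<one>] by simp
    fix x assume x: "x \<in> C"
    have "loc_map R S (\<ominus> \<one>) \<in> C"
      by (rule fC) simp
    then have "loc_map R S (\<ominus> \<one>) \<otimes>\<^bsub>L\<^esub> x \<in> C"
      using x by (rule assms(3))
    then show "\<ominus>\<^bsub>L\<^esub> x \<in> C"
      using x assms(1) by (simp add: L.l_minus subset_iff)
  qed (rule assms(1,3,4); assumption)+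
  then show ?thesis
    using assms(2) by (simp add: subalgebra_of_def)
qed

lemma subalgebra_carrier: "subalgebra_of R L (loc_map R S) (carrier L)"
  by (rule subalgebra_ofI) (auto simp: loc_map_def)

lemma generated_subalgebra_subalgebra:
  assumes "V \<subseteq> carrier L"
  shows "subalgebra_of R L (loc_map R S) (generated_subalgebra R L (loc_map R S) V)"
proof (rule subalgebra_ofI)
  show "generated_subalgebra R L (loc_map R S) V \<subseteq> carrier L"
    using subalgebra_carrier assms by (auto simp: generated_subalgebra_def)
qed (auto simp: generated_subalgebra_def subalgebra_of_def dest: subringE(6,7))

lemma generated_subalgebra_incl: "x \<in> V \<Longrightarrow> x \<in> generated_subalgebra R L (loc_map R S) V"
  by (auto simp: generated_subalgebra_def)

lemma generated_subalgebra_minimal: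
  "subalgebra_of R L (loc_map R S) C \<Longrightarrow> V \<subseteq> C \<Longrightarrow>
    generated_subalgebra R L (loc_map R S) V \<subseteq> C"
  by (auto simp: generated_subalgebra_def)

end

text \<open>A subalgebra C that contains all m/a_i is already a target of the dilatation, and only
  the inclusion of C in the image remains to be proved. C will be the subalgebra generated by these
  fractions, the whole localization, or an arbitrary given subalgebra.\<close>

locale subalgebra_target = multi_centered +
  fixes C
  assumes subalgebra: "subalgebra_of R (localization R Sm) (loc_map R Sm) C"
    and fractions: "i \<in> I \<Longrightarrow> m \<in> M i \<Longrightarrow> loc_frac R Sm m (a i) \<in> C"
begin

sublocale loc: mult_subset R Sm
  by (rule mult_subset_Sm)

sublocale target: regular_target R I M a "loc.L\<lparr>carrier := C\<rparr>" "loc_map R Sm"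
proof (rule regular_target.intro[OF multi_centered_axioms loc.subalgebra_ring_hom[OF subalgebra]
      regular_target_axioms.intro])
  show "nonzerodivisor (loc.L\<lparr>carrier := C\<rparr>) (loc_map R Sm (a i))" if "i \<in> I" for i
    using that by (intro loc.subalgebra_nonzerodivisor[OF subalgebra] a_in_Sm)
  show "\<exists>y\<in>carrier (loc.L\<lparr>carrier := C\<rparr>).
      loc_map R Sm m = loc_map R Sm (a i) \<otimes>\<^bsub>loc.L\<lparr>carrier := C\<rparr>\<^esub> y" if "i \<in> I" "m \<in> M i" for i m
    using loc.loc_map_times_fr[of m "a i"] fractions[OF that] a_in_Sm[OF that(1)]
      ideal.Icarr[OF M_ideal[OF that(1)] that(2)] by auto
qed

lemma canonically_isomorphic_subalgebra:
  assumes "C \<subseteq> target.fraction_like"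
  shows "canonically_isomorphic R D \<iota> (loc.L\<lparr>carrier := C\<rparr>) (loc_map R Sm)"
proof (rule target.canonically_isomorphicI)
  fix m assume m: "m \<in> carrier R" "loc_map R Sm m = \<zero>\<^bsub>loc.L\<lparr>carrier := C\<rparr>\<^esub>"
  then obtain u where "u \<in> Sm" "u \<otimes> m = \<zero>"
    using loc.loc_map_eq_zero_iff[of m] by auto
  then show "\<exists>\<beta>\<in>exponents I. m \<otimes> pw \<beta> = \<zero>"
    using m(1) by (auto simp: m_comm)
qed (use assms in auto)

end

context multi_centered
begin

interpretation loc: mult_subset R Sm
  by (rule mult_subset_Sm)

lemma dil_iso_generated_subalgebra:
  "canonically_isomorphic R D \<iota>
    (localization R Sm\<lparr>carrier := generated_subalgebra R (localization R Sm) (loc_map R Sm)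
      {loc.fr m (a i) | i m. i \<in> I \<and> m \<in> M i}\<rparr>) (loc_map R Sm)"
proof -
  let ?V = "{loc.fr m (a i) | i m. i \<in> I \<and> m \<in> M i}"
  define C where "C = generated_subalgebra R loc.L (loc_map R Sm) ?V"
  have V: "?V \<subseteq> carrier loc.L"
    using a_in_Sm ideal.Icarr[OF M_ideal] by auto
  interpret C: subalgebra_target R I M a C
  proof unfold_locales
    show "subalgebra_of R loc.L (loc_map R Sm) C"
      unfolding C_def by (rule loc.generated_subalgebra_subalgebra[OF V])
    show "loc.fr m (a i) \<in> C" if "i \<in> I" "m \<in> M i" for i m
      unfolding C_def using that by (intro loc.generated_subalgebra_incl) auto
  qed
  have CL: "C \<subseteq> carrier loc.L"
    using C.subalgebra by (auto simp: subalgebra_of_def dest: subringE(1))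
  have fl: "C.target.fraction_like \<subseteq> C"
    by (auto simp: C.target.fraction_like_def)
  \<comment> \<open>The image of the dilatation is itself a subalgebra that contains the generators,
    so minimality of C gives the inclusion.\<close>
  have "subalgebra_of R loc.L (loc_map R Sm) C.target.fraction_like"
    using fl CL C.target.fraction_like_map C.target.fraction_like_mult C.target.fraction_like_add
    by (intro loc.subalgebra_ofI) auto
  moreover have "?V \<subseteq> C.target.fraction_like"
  proof
    fix y assume "y \<in> ?V"
    then obtain i m where y: "i \<in> I" "m \<in> M i" "y = loc.fr m (a i)"
      by blast
    have "m \<in> carrier R"
      using ideal.Icarr[OF M_ideal] y by blast
    then show "y \<in> C.target.fraction_like"
      using y C.fractions M_subset_Lid loc.loc_map_times_fr[OF _ a_in_Sm]
      by (intro C.target.fraction_like_single[of i m]) auto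
  qed
  ultimately have "C \<subseteq> C.target.fraction_like"
    unfolding C_def by (rule loc.generated_subalgebra_minimal)
  then show ?thesis
    using C.canonically_isomorphic_subalgebra unfolding C_def by blast
qed

lemma dil_iso_localization:
  assumes "\<And>i. i \<in> I \<Longrightarrow> M i = carrier R"
  shows "canonically_isomorphic R D \<iota> (localization R Sm) (loc_map R Sm)"
proof -
  interpret C: subalgebra_target R I M a "carrier loc.L"
    using loc.subalgebra_carrier a_in_Sm assms by unfold_locales auto
  \<comment> \<open>Here 1 lies in M_i, so 1/a_i is in the image, and with it the inverse of every
    monomial.\<close>
  have inv: "loc.fr \<one> (pw \<nu>) \<in> C.target.fraction_like" if "\<nu> \<in> exponents I" for \<nu>
    using that
  proof (induction rule: exponents_induct)
    case zero
    then show ?case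
      using C.target.fraction_like_map[OF one_closed]
      by (simp only: pow.multi_power_zero loc_map_def[of R Sm \<one>])
  next
    case (add \<nu> i)
    have "loc.fr \<one> (a i) \<in> C.target.fraction_like"
      using add a_in_Sm assms M_subset_Lid[of i] loc.loc_map_times_fr[of \<one> "a i"]
      by (intro C.target.fraction_like_single[of i \<one>]) auto
    then have "loc.fr \<one> (a i) \<otimes>\<^bsub>loc.L\<^esub> loc.fr \<one> (pw \<nu>) \<in> C.target.fraction_like"
      using C.target.fraction_like_mult add.IH by simp
    then show ?case
      using add.hyps a_in_Sm loc.fr_one_mult[of "a i" "pw \<nu>"]
      by (simp add: pow.multi_power_add pow.multi_power_single_one del: One_nat_def)
  qed
  have "carrier loc.L \<subseteq> C.target.fraction_like"
  proof
    fix y assume "y \<in> carrier loc.L"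
    then obtain m s where y: "m \<in> carrier R" "s \<in> Sm" "y = loc.fr m s"
      by (rule loc.loc_carrier_cases)
    then have "y = loc_map R Sm m \<otimes>\<^bsub>loc.L\<^esub> loc.fr \<one> s"
      by (simp add: loc.fr_eq_loc_map_times[symmetric])
    moreover have "loc.fr \<one> s \<in> C.target.fraction_like"
      using inv y by auto
    ultimately show "y \<in> C.target.fraction_like"
      using C.target.fraction_like_mult C.target.fraction_like_map[OF y(1)] by simp
  qed
  then show ?thesis
    using C.canonically_isomorphic_subalgebra by simp
qed

end

text \<open>S itself is the index set, and N_s collects all numerators that occur in C over the
  denominator s. Each element m/s of C is then one of the generating fractions, and all of these lie
  in C.\<close>

theorem (in cring) subalgebra_iso_dilatation:
  assumes "submonoid S R" and C: "subalgebra_of R (localization R S) (loc_map R S) C"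
  shows "\<exists>N. multi_center R S N (\<lambda>s. s) \<and>
    alg_iso R (localization R S\<lparr>carrier := C\<rparr>) (loc_map R S)
      (dilatation R S N (\<lambda>s. s)) (dil_map R S N (\<lambda>s. s)) \<noteq> {}"
proof -
  interpret loc: mult_subset R S
    using assms by (intro mult_subset.intro is_cring)
  interpret L: cring loc.L
    by (rule loc.localization_cring)
  define N where "N s = {m \<in> carrier R. loc_frac R S m s \<in> C}" for s
  have sub: "subring C loc.L" and fC: "loc_map R S ` carrier R \<subseteq> C"
    using C by (auto simp: subalgebra_of_def)
  interpret f: ring_hom_cring R loc.L "loc_map R S"
    by (rule loc.loc_map_hom)
  have fr_times: "loc_frac R S (x \<otimes> m) s = loc_map R S x \<otimes>\<^bsub>loc.L\<^esub> loc_frac R S m s"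
    if "x \<in> carrier R" "m \<in> carrier R" "s \<in> S" for x m s
    using that loc.S_closed by (simp add: loc_map_def loc.loc_mult)
  have fr_add: "loc_frac R S (m \<oplus> p) s = loc_frac R S m s \<oplus>\<^bsub>loc.L\<^esub> loc_frac R S p s"
    if "m \<in> carrier R" "p \<in> carrier R" "s \<in> S" for m p s
    using that loc.fr_eq_loc_map_times[of "m \<oplus> p" s] loc.fr_eq_loc_map_times[of m s]
      loc.fr_eq_loc_map_times[of p s] by (simp add: L.l_distr)
  have N: "ideal (N s) R" if s: "s \<in> S" for s
  proof (rule idealI[OF ring_axioms])
    have smult: "x \<otimes> m \<in> N s" if "m \<in> N s" "x \<in> carrier R" for m x
      using that s fC subringE(6)[OF sub] by (auto simp: N_def fr_times)
    then show "x \<otimes> m \<in> N s" if "m \<in> N s" "x \<in> carrier R" for m x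
      using that by simp
    then show "m \<otimes> x \<in> N s" if "m \<in> N s" "x \<in> carrier R" for m x
      using that smult[OF that] by (simp add: N_def m_comm)
    show "subgroup (N s) (add_monoid R)"
    proof (rule add.subgroupI)
      show "N s \<subseteq> carrier R"
        by (auto simp: N_def)
      have "loc_frac R S \<zero> s = \<zero>\<^bsub>loc.L\<^esub>"
        using s loc.S_closed by (subst loc.fr_eq_zero_iff) auto
      then have "\<zero> \<in> N s"
        using subringE(2)[OF sub] by (simp add: N_def)
      then show "N s \<noteq> {}"
        by blast
      show "\<ominus> m \<in> N s" if "m \<in> N s" for m
        using smult[OF that, of "\<ominus> \<one>"] that by (simp add: N_def l_minus)
      show "m \<oplus> p \<in> N s" if "m \<in> N s" "p \<in> N s" for m p
        using that s subringE(7)[OF sub] by (auto simp: N_def fr_add)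
    qed
  qed
  interpret J: multi_centered R S N "\<lambda>s. s"
    using N loc.S_closed by unfold_locales (auto simp: multi_center_def)
  \<comment> \<open>For the identity family the monoid of monomials is S again, so the localization
    in which the dilatation lives is the given one.\<close>
  have "generated_submonoid R ((\<lambda>s. s) ` S) = S"
    using assms(1) by (auto simp: generated_submonoid_def)
  then have Sm: "J.Sm = S"
    using J.pow.generated_submonoid_eq_multi_powers by simp
  interpret C: subalgebra_target R S N "\<lambda>s. s" C
    using C by unfold_locales (auto simp: Sm N_def)
  have "C \<subseteq> C.target.fraction_like"
  proof
    fix y assume y: "y \<in> C"
    then have "y \<in> carrier loc.L"
      using subringE(1)[OF sub] by blast
    then obtain m s where m: "m \<in> carrier R" "s \<in> S" "y = loc_frac R S m s"
      by (rule loc.loc_carrier_cases)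
    then have "m \<in> N s"
      using y by (simp add: N_def)
    then show "y \<in> C.target.fraction_like"
      using m y J.M_subset_Lid[OF m(2)] loc.loc_map_times_fr[OF m(1,2)]
      by (intro C.target.fraction_like_single[of s m]) (auto simp: Sm)
  qed
  then obtain \<theta> where \<theta>: "\<theta> \<in> alg_iso R J.D J.\<iota> (loc.L\<lparr>carrier := C\<rparr>) (loc_map R S)"
    using C.canonically_isomorphic_subalgebra unfolding Sm canonically_isomorphic_def by blast
  have "ring (loc.L\<lparr>carrier := C\<rparr>)" "ring J.D"
    using L.subring_is_ring[OF sub] cring.axioms(1)[OF J.dil_cring] by auto
  then have "alg_iso R (loc.L\<lparr>carrier := C\<rparr>) (loc_map R S) J.D J.\<iota> \<noteq> {}"
    using alg_iso_sym[OF _ _ \<theta>] J.dil_map_closed by blast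
  then show ?thesis
    using J.multi_center by blast
qed


section \<open>Change of centers\<close>

context cring
begin

lemma set_add_subset_iff:
  assumes "ideal H R" "ideal J R" "ideal K R"
  shows "H <+>\<^bsub>R\<^esub> J \<subseteq> K \<longleftrightarrow> H \<subseteq> K \<and> J \<subseteq> K"
proof
  interpret H: ideal H R by fact
  interpret J: ideal J R by fact
  show "H \<subseteq> K \<and> J \<subseteq> K" if sub: "H <+>\<^bsub>R\<^esub> J \<subseteq> K"
  proof -
    have "x \<oplus> \<zero> \<in> H <+>\<^bsub>R\<^esub> J" if "x \<in> H" for x
      unfolding set_add_def' using that J.zero_closed by blast
    moreover have "\<zero> \<oplus> x \<in> H <+>\<^bsub>R\<^esub> J" if "x \<in> J" for x
      unfolding set_add_def' using that H.zero_closed by blast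
    ultimately show ?thesis
      using sub by fastforce
  qed
next
  interpret K: ideal K R by fact
  show "H <+>\<^bsub>R\<^esub> J \<subseteq> K" if "H \<subseteq> K \<and> J \<subseteq> K"
    unfolding set_add_def' using that by auto
qed

text \<open>The sum of ideals enters only as the least ideal above its summands. Both facts are
  proved in one induction, since the step for the bound needs the partial sum to be an
  ideal.\<close>

lemma finsum_ideals_set:
  assumes "finite J" "\<And>i. i \<in> J \<Longrightarrow> ideal (F i) R"
  shows ideal_finsum_ideals_set: "ideal (finsum (ideals_set R) F J) R"
    and finsum_ideals_set_subset_iff:
      "ideal K R \<Longrightarrow> finsum (ideals_set R) F J \<subseteq> K \<longleftrightarrow> (\<forall>i\<in>J. F i \<subseteq> K)"
proof -
  interpret S: semiring "ideals_set R"
    by (rule ideals_set_is_semiring)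
  have zero: "\<zero>\<^bsub>ideals_set R\<^esub> = {\<zero>}" and add: "add (ideals_set R) = set_add R"
    by (simp_all add: ideals_set_def)
  have "ideal (finsum (ideals_set R) F J) R \<and>
      (ideal K R \<longrightarrow> finsum (ideals_set R) F J \<subseteq> K \<longleftrightarrow> (\<forall>i\<in>J. F i \<subseteq> K))" for K
    using assms
  proof (induction rule: finite_induct)
    case empty
    then show ?case
      using additive_subgroup.zero_closed[OF ideal.axioms(1)] by (auto simp: zero zeroideal)
  next
    case (insert j J)
    then have "finsum (ideals_set R) F (insert j J) = F j <+>\<^bsub>R\<^esub> finsum (ideals_set R) F J"
      by (subst S.finsum_insert) (auto simp: add)
    then show ?case
      using insert by (simp add: add_ideals set_add_subset_iff)
  qed
  then show "ideal (finsum (ideals_set R) F J) R"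
    "ideal K R \<Longrightarrow> finsum (ideals_set R) F J \<subseteq> K \<longleftrightarrow> (\<forall>i\<in>J. F i \<subseteq> K)"
    by blast+
qed

end

section \<open>Replacing several centers by one, or by fewer and a localization\<close>

context multi_centered
begin

lemma sum_single_exponents:
  "J \<subseteq> I \<Longrightarrow> (\<Sum>i\<in>J. Poly_Mapping.single i (1::nat)) \<in> exponents I"
  by (induction J rule: infinite_finite_induct) auto

lemma pw_sum_single:
  assumes "finite J" "J \<subseteq> I"
  shows "pw (\<Sum>i\<in>J. \<delta> i) = (\<Otimes>i\<in>J. a i)"
  using assms
proof (induction rule: finite_induct)
  case (insert i J)
  then have "pw (\<Sum>i\<in>insert i J. \<delta> i) = a i \<otimes> (\<Otimes>i\<in>J. a i)"
    using sum_single_exponents[of J]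
    by (simp add: pow.multi_power_add pow.multi_power_single_one del: One_nat_def)
  then show ?case
    using insert by (subst finprod_insert) auto
qed simp

text \<open>In the dilatation with one center b = a_1 ... a_k, both a_i and its cofactor q_i are
  factors of the regular element b. For m in M_i the element m q_i is divisible by b = a_i q_i, and
  cancelling q_i leaves m divisible by a_i. Surjectivity holds because N is contained in
  L^(1,...,1).\<close>

lemma dil_iso_single_center:
  assumes fin: "finite I"
  defines "N \<equiv> finsum (ideals_set R)
      (\<lambda>i. ideal_prod R (M i) (PIdl (\<Otimes>j\<in>I - {i}. a j))) I"
    and "b \<equiv> (\<Otimes>i\<in>I. a i)"
  shows "canonically_isomorphic R D \<iota>
    (dilatation R {()} (\<lambda>_. N) (\<lambda>_. b)) (dil_map R {()} (\<lambda>_. N) (\<lambda>_. b))"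
proof -
  define q where "q i = (\<Otimes>j\<in>I - {i}. a j)" for i
  define F where "F i = ideal_prod R (M i) (PIdl (q i))" for i
  \<comment> \<open>The exponent (1,...,1), chosen so that its monomial is \<open>b\<close>.\<close>
  define \<epsilon> where "\<epsilon> = (\<Sum>i\<in>I. Poly_Mapping.single i (1::nat))"
  have q [simp]: "q i \<in> carrier R" for i
    unfolding q_def by (intro finprod_closed) auto
  have b [simp]: "b \<in> carrier R"
    unfolding b_def by (intro finprod_closed) auto
  have \<epsilon>: "\<epsilon> \<in> exponents I" "pw \<epsilon> = b"
    unfolding \<epsilon>_def b_def using sum_single_exponents[of I] pw_sum_single[OF fin] by simp_all
  have b_eq: "b = a i \<otimes> q i" if "i \<in> I" for i
    unfolding b_def q_def using fin that
    by (subst insert_Diff[symmetric, of i I], simp, subst finprod_insert) auto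
  have F: "ideal (F i) R" if "i \<in> I" for i
    unfolding F_def using that by (intro ideal_prod_is_ideal M_ideal cgenideal_ideal q)
  have N_eq: "N = finsum (ideals_set R) F I"
    unfolding N_def F_def q_def ..
  have N: "ideal N R" and N_sub: "ideal K R \<Longrightarrow> N \<subseteq> K \<longleftrightarrow> (\<forall>i\<in>I. F i \<subseteq> K)" for K
    unfolding N_eq using fin F
    by (auto intro: ideal_finsum_ideals_set simp: finsum_ideals_set_subset_iff)
  have "F i \<subseteq> Lpw \<epsilon>" if i: "i \<in> I" for i
  proof -
    interpret L: ideal "Lpw \<epsilon>" R
      using \<epsilon> by (intro Lpw_ideal)
    have "m \<otimes> y \<in> Lpw \<epsilon>" if m: "m \<in> M i" and y: "y \<in> PIdl (q i)" for m y
    proof -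
      define \<mu> where "\<mu> = (\<Sum>j\<in>I - {i}. Poly_Mapping.single j (1::nat))"
      have \<mu>: "\<mu> \<in> exponents I" "pw \<mu> = q i" "\<epsilon> = \<delta> i + \<mu>"
        using sum_single_exponents[of "I - {i}"] pw_sum_single[of "I - {i}"] fin i
        by (auto simp: \<mu>_def q_def \<epsilon>_def sum.remove)
      have mL: "m \<in> Lpw (\<delta> i)"
        using m i M_subset_Lid by (simp add: Lpw_single_one subset_iff del: One_nat_def)
      \<comment> \<open>m lies in L_i and q_i is the monomial of the other centers, so m q_i lies in
        the power of degree (1,...,1).\<close>
      have mq: "m \<otimes> q i \<in> Lpw \<epsilon>"
        unfolding \<mu>(2)[symmetric] \<mu>(3) using mL \<mu>(1) i by (intro Lpw_times_pw) auto
      obtain x where x: "x \<in> carrier R" "y = x \<otimes> q i"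
        using y by (auto simp: cgenideal_def)
      have "m \<in> carrier R"
        using ideal.Icarr[OF M_ideal] m i by blast
      then have "m \<otimes> y = x \<otimes> (m \<otimes> q i)"
        using x by (simp add: m_ac)
      then show ?thesis
        using mq x by (simp add: L.I_l_closed)
    qed
    then show ?thesis
      unfolding F_def using i \<epsilon>(1)
      by (subst ideal_prod_subset_iff) (auto intro: M_ideal cgenideal_ideal Lpw_ideal)
  qed
  then have N_Lpw: "N \<subseteq> Lpw \<epsilon>"
    using N_sub[OF Lpw_ideal[OF \<epsilon>(1)]] by blast
  have N_mem: "m \<otimes> q i \<in> N" if "i \<in> I" "m \<in> M i" for i m
  proof -
    have "m \<otimes> q i \<in> F i"
      unfolding F_def using that by (intro ideal_prod.prod cgenideal_self) auto
    then show ?thesis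
      using N_sub[OF N] that by blast
  qed
  interpret E: multi_centered R "{()}" "\<lambda>_. N" "\<lambda>_. b"
    using N by unfold_locales (simp add: multi_center_def)
  interpret E\<iota>: ring_hom_cring R E.D E.\<iota>
    by (rule E.dil_map_hom)
  have b_nzd: "nonzerodivisor E.D (E.\<iota> b)"
    by (rule E.dil_map_a_nonzerodivisor) simp
  have \<iota>b: "E.\<iota> b = E.\<iota> (a i) \<otimes>\<^bsub>E.D\<^esub> E.\<iota> (q i)" if "i \<in> I" for i
    using E\<iota>.hom_mult[of "a i" "q i"] that by (simp add: b_eq[OF that, symmetric])
  have nzd: "nonzerodivisor E.D (E.\<iota> (a i))" "nonzerodivisor E.D (E.\<iota> (q i))" if "i \<in> I" for i
  proof -
    have eq: "E.\<iota> b = E.\<iota> (a i) \<otimes>\<^bsub>E.D\<^esub> E.\<iota> (q i)" "E.\<iota> b = E.\<iota> (q i) \<otimes>\<^bsub>E.D\<^esub> E.\<iota> (a i)"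
      using \<iota>b that E\<iota>.S.m_comm[of "E.\<iota> (a i)" "E.\<iota> (q i)"] by simp_all
    show "nonzerodivisor E.D (E.\<iota> (a i))"
      using b_nzd[unfolded eq(1)] by (rule E\<iota>.S.nonzerodivisor_factor) (use that in simp_all)
    show "nonzerodivisor E.D (E.\<iota> (q i))"
      using b_nzd[unfolded eq(2)] by (rule E\<iota>.S.nonzerodivisor_factor) (use that in simp_all)
  qed
  have div: "\<exists>y\<in>carrier E.D. E.\<iota> m = E.\<iota> (a i) \<otimes>\<^bsub>E.D\<^esub> y" if i: "i \<in> I" and m: "m \<in> M i" for i m
  proof -
    have mR: "m \<in> carrier R"
      using ideal.Icarr[OF M_ideal[OF i] m] .
    have "m \<otimes> q i \<in> E.Lid ()"
      using N_mem[OF i m] E.M_subset_Lid[of "()"] by blast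
    then obtain y where y: "y \<in> carrier E.D" "E.\<iota> b \<otimes>\<^bsub>E.D\<^esub> y = E.\<iota> (m \<otimes> q i)"
      using E.dil_map_times_dfr_single[of "()" "m \<otimes> q i"] by blast
    have "E.\<iota> (q i) \<otimes>\<^bsub>E.D\<^esub> E.\<iota> m = E.\<iota> b \<otimes>\<^bsub>E.D\<^esub> y"
      unfolding y(2) using mR by (simp add: E\<iota>.S.m_comm)
    also have "\<dots> = E.\<iota> (q i) \<otimes>\<^bsub>E.D\<^esub> (E.\<iota> (a i) \<otimes>\<^bsub>E.D\<^esub> y)"
      unfolding \<iota>b[OF i] using y(1) i by (simp add: E\<iota>.S.m_ac)
    finally have "E.\<iota> m = E.\<iota> (a i) \<otimes>\<^bsub>E.D\<^esub> y"
      using E\<iota>.S.nonzerodivisor_cancel[OF nzd(2)[OF i]] mR y(1) i by simp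
    then show ?thesis
      using y(1) by blast
  qed
  interpret T: regular_target R I M a E.D E.\<iota>
    by (intro regular_target.intro regular_target_axioms.intro multi_centered_axioms
        E.dil_map_hom nzd div)
  show ?thesis
  proof (rule T.canonically_isomorphicI)
    fix m assume m: "m \<in> carrier R" "E.\<iota> m = \<zero>\<^bsub>E.D\<^esub>"
    \<comment> \<open>Powers of b are monomials in the a_i, so what a power of b kills is killed by
      such a monomial.\<close>
    have "\<exists>\<nu>\<in>exponents I. E.pw \<beta> = pw \<nu>" if "\<beta> \<in> exponents {()}" for \<beta>
      using that
    proof (induction rule: exponents_induct)
      case zero
      show ?case
        by (rule bexI[of _ 0]) simp_all
    next
      case (add \<beta> i)
      then obtain \<nu> where \<nu>: "\<nu> \<in> exponents I" "E.pw \<beta> = pw \<nu>"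
        by blast
      have "E.pw (\<delta> i + \<beta>) = b \<otimes> E.pw \<beta>"
        using E.pow.multi_power_add[of "\<delta> i" \<beta>]
          E.pow.multi_power_single_one[of i] add.hyps by (simp del: One_nat_def)
      also have "\<dots> = pw (\<epsilon> + \<nu>)"
        using pow.multi_power_add[OF \<epsilon>(1) \<nu>(1)] by (simp only: \<nu>(2) \<epsilon>(2))
      finally have "E.pw (\<delta> i + \<beta>) = pw (\<epsilon> + \<nu>)" .
      then show ?case
        using exponents_add[OF \<epsilon>(1) \<nu>(1)] by blast
    qed
    moreover obtain \<beta> where "\<beta> \<in> exponents {()}" "m \<otimes> E.pw \<beta> = \<zero>"
      using m(2) E.dil_map_eq_zero_iff[OF m(1)] by blast
    ultimately show "\<exists>\<beta>\<in>exponents I. m \<otimes> pw \<beta> = \<zero>"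
      by fastforce
  next
    fix y assume "y \<in> carrier E.D"
    then show "y \<in> T.fraction_like"
    proof (induction rule: E.D_carrier_induct)
      case (incl i m y)
      then show ?case
        using N_Lpw \<epsilon> by (auto simp: T.fraction_like_def)
    qed (auto intro: T.fraction_like_map T.fraction_like_add T.fraction_like_mult)
  qed
qed

text \<open>Since a_i lies in L_i, hence in L_k(i), the fraction u_i = a_i/a_k(i) exists over K.
  Inverting it makes a_i and a_k(i) associates, so regularity of a_i and divisibility of M_i, a
  subset of L_k(i), follow from the facts for k(i). Conversely, a_k(i) in L_i makes the inverse
  a_k(i)/a_i a fraction of the dilatation over I.\<close>

lemma dil_iso_localized_dil:
  assumes K: "K \<subseteq> I"
    and k: "\<And>i. i \<in> I - K \<Longrightarrow> k i \<in> K \<and> a (k i) \<in> Lid i \<and> Lid i \<subseteq> Lid (k i)"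
  defines "E \<equiv> dilatation R K M a"
  defines "T \<equiv> generated_submonoid E {dil_frac R K M a (a i) (Poly_Mapping.single (k i) 1) | i. i \<in> I - K}"
  shows "canonically_isomorphic R D \<iota> (localization E T) (\<lambda>x. loc_map E T (dil_map R K M a x))"
proof -
  interpret K: multi_centered R K M a
    using multi_center K by unfold_locales (auto simp: multi_center_def)
  have E: "E = K.D"
    unfolding E_def ..
  interpret K\<iota>: ring_hom_cring R E K.\<iota>
    unfolding E by (rule K.dil_map_hom)
  define u where "u i = K.dfr (a i) (Poly_Mapping.single (k i) 1)" for i
  have u: "u i \<in> carrier E" "K.\<iota> (a (k i)) \<otimes>\<^bsub>E\<^esub> u i = K.\<iota> (a i)" if "i \<in> I - K" for i
    using K.dil_map_times_dfr_single[of "k i" "a i"] k[OF that] a_in_Lid[of i] that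
    unfolding u_def E by auto
  have T: "T = generated_submonoid E {u i | i. i \<in> I - K}"
    unfolding T_def u_def ..
  have V: "{u i | i. i \<in> I - K} \<subseteq> carrier E"
    using u by blast
  interpret loc: mult_subset E T
    unfolding T
    by (intro mult_subset.intro K\<iota>.S.generated_submonoid_is_submonoid V K\<iota>.S.is_cring)
  define j where "j = loc_map E T"
  define f where "f x = j (K.\<iota> x)" for x
  interpret j: ring_hom_cring E loc.L j
    unfolding j_def by (rule loc.loc_map_hom)
  have f: "ring_hom_cring R loc.L f"
  proof (rule ring_hom_cringI)
    show "f \<in> ring_hom R loc.L"
      by (rule ring_hom_memI) (auto simp: f_def)
  qed (use is_cring j.S.is_cring in auto)
  have uT: "u i \<in> T" if "i \<in> I - K" for i
    unfolding T using that by (intro generated_submonoid_incl) blast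
  \<comment> \<open>The inverse of u_i, recognized below as a_k(i)/a_i.\<close>
  define w where "w i = loc_frac E T \<one>\<^bsub>E\<^esub> (u i)" for i
  have w: "w i \<in> carrier loc.L" "j (u i) \<otimes>\<^bsub>loc.L\<^esub> w i = \<one>\<^bsub>loc.L\<^esub>" if "i \<in> I - K" for i
    unfolding w_def j_def using uT[OF that] loc.loc_map_inverse by auto
  have kI: "k i \<in> I" "k i \<in> K" if "i \<in> I - K" for i
    using k[OF that] K by auto
  have fu: "f (a i) = f (a (k i)) \<otimes>\<^bsub>loc.L\<^esub> j (u i)" if "i \<in> I - K" for i
    unfolding f_def u(2)[OF that, symmetric] using u(1)[OF that] kI[OF that] by simp
  have fw: "f (a i) \<otimes>\<^bsub>loc.L\<^esub> w i = f (a (k i))" if "i \<in> I - K" for i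
    unfolding fu[OF that] using w[OF that] u(1)[OF that] kI[OF that]
    by (simp add: j.S.m_assoc f_def)
  have regK: "nonzerodivisor loc.L (f (a i))" if "i \<in> K" for i
    unfolding f_def j_def using K.dil_map_a_nonzerodivisor[OF that]
    by (intro loc.loc_map_nonzerodivisor) (simp add: E)
  have reg: "nonzerodivisor loc.L (f (a i))" if i: "i \<in> I" for i
  proof (cases "i \<in> K")
    case False
    then have i': "i \<in> I - K"
      using i by blast
    have "nonzerodivisor loc.L (j (u i))"
      unfolding j_def using uT[OF i'] by (rule loc.loc_map_nonzerodivisor_S)
    then show ?thesis
      unfolding fu[OF i'] by (intro j.S.nonzerodivisor_mult regK kI(2)[OF i'])
  qed (rule regK)
  have divK: "\<exists>y\<in>carrier loc.L. f l = f (a i) \<otimes>\<^bsub>loc.L\<^esub> y" if i: "i \<in> K" and l: "l \<in> Lid i" for i l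
  proof -
    define x where "x = K.dfr l (\<delta> i)"
    have x: "x \<in> carrier E" "K.\<iota> (a i) \<otimes>\<^bsub>E\<^esub> x = K.\<iota> l"
      using K.dil_map_times_dfr_single[OF i l] unfolding x_def E by auto
    have "f l = f (a i) \<otimes>\<^bsub>loc.L\<^esub> j x"
      unfolding f_def x(2)[symmetric] using x(1) i by simp
    then show ?thesis
      using x(1) by blast
  qed
  have div: "\<exists>y\<in>carrier loc.L. f m = f (a i) \<otimes>\<^bsub>loc.L\<^esub> y" if i: "i \<in> I" and m: "m \<in> M i" for i m
  proof (cases "i \<in> K")
    case True
    then show ?thesis
      using m M_subset_Lid[OF i] by (intro divK) auto
  next
    case False
    then have i': "i \<in> I - K"
      using i by blast
    have "m \<in> Lid (k i)"
      using m M_subset_Lid[OF i] k[OF i'] by blast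
    then obtain y where y: "y \<in> carrier loc.L" "f m = f (a (k i)) \<otimes>\<^bsub>loc.L\<^esub> y"
      using divK kI(2)[OF i'] by blast
    have "f m = f (a i) \<otimes>\<^bsub>loc.L\<^esub> (w i \<otimes>\<^bsub>loc.L\<^esub> y)"
      unfolding y(2) fw[OF i', symmetric] using w(1)[OF i'] y(1) i
      by (simp add: j.S.m_assoc f_def)
    then show ?thesis
      using w(1)[OF i'] y(1) by blast
  qed
  interpret T: regular_target R I M a loc.L f
    by (intro regular_target.intro regular_target_axioms.intro multi_centered_axioms f reg div)
  have exp: "\<nu> \<in> exponents I" if "\<nu> \<in> exponents K" for \<nu>
    using that by (rule exponents_mono[OF K])
  have "canonically_isomorphic R D \<iota> loc.L f"
  proof (rule T.canonically_isomorphicI)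
    fix m assume m: "m \<in> carrier R" "f m = \<zero>\<^bsub>loc.L\<^esub>"
    obtain t where t: "t \<in> T" "t \<otimes>\<^bsub>E\<^esub> K.\<iota> m = \<zero>\<^bsub>E\<^esub>"
      using m loc.loc_map_eq_zero_iff[of "K.\<iota> m"] by (auto simp: f_def j_def)
    \<comment> \<open>Every t in T divides the image of a monomial, because u_i a_k(i) = a_i. This
      converts killing by t into killing by a monomial over I.\<close>
    have "\<exists>\<mu>\<in>exponents I. \<exists>p\<in>carrier E. p \<otimes>\<^bsub>E\<^esub> t = K.\<iota> (pw \<mu>)"
      using t(1) V unfolding T
    proof (induction rule: K\<iota>.S.generated_submonoid_induct)
      case one
      show ?case
        by (intro bexI[of _ 0] bexI[of _ "\<one>\<^bsub>E\<^esub>"]) simp_all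
    next
      case (incl x)
      then obtain i where i: "i \<in> I - K" "x = u i"
        by blast
      then show ?case
        using u(2)[OF i(1)] kI[OF i(1)]
        by (intro bexI[of _ "\<delta> i"] bexI[of _ "K.\<iota> (a (k i))"])
          (simp_all add: pow.multi_power_single_one del: One_nat_def)
    next
      case (mult x y)
      obtain \<mu> p where x: "\<mu> \<in> exponents I" "p \<in> carrier E" "p \<otimes>\<^bsub>E\<^esub> x = K.\<iota> (pw \<mu>)"
        using mult.IH(1) by blast
      obtain \<nu> q where y: "\<nu> \<in> exponents I" "q \<in> carrier E" "q \<otimes>\<^bsub>E\<^esub> y = K.\<iota> (pw \<nu>)"
        using mult.IH(2) by blast
      have "p \<otimes>\<^bsub>E\<^esub> q \<otimes>\<^bsub>E\<^esub> (x \<otimes>\<^bsub>E\<^esub> y) = (p \<otimes>\<^bsub>E\<^esub> x) \<otimes>\<^bsub>E\<^esub> (q \<otimes>\<^bsub>E\<^esub> y)"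
        using mult.hyps x(2) y(2) by (simp add: K\<iota>.S.m_ac)
      also have "\<dots> = K.\<iota> (pw (\<mu> + \<nu>))"
        unfolding x(3) y(3) using x(1) y(1) by (simp add: pow.multi_power_add)
      finally show ?case
        using x(1,2) y(1,2) by (intro bexI[of _ "\<mu> + \<nu>"] bexI[of _ "p \<otimes>\<^bsub>E\<^esub> q"]) simp_all
    qed
    then obtain \<mu> p where \<mu>: "\<mu> \<in> exponents I" "p \<in> carrier E" "p \<otimes>\<^bsub>E\<^esub> t = K.\<iota> (pw \<mu>)"
      by blast
    have "K.\<iota> (pw \<mu> \<otimes> m) = p \<otimes>\<^bsub>E\<^esub> (t \<otimes>\<^bsub>E\<^esub> K.\<iota> m)"
      using \<mu> m(1) loc.S_closed[OF t(1)] by (simp add: \<mu>(3)[symmetric] K\<iota>.S.m_assoc)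
    also have "\<dots> = \<zero>\<^bsub>E\<^esub>"
      unfolding t(2) using \<mu>(2) by simp
    finally obtain \<beta> where \<beta>: "\<beta> \<in> exponents K" "pw \<mu> \<otimes> m \<otimes> pw \<beta> = \<zero>"
      using K.dil_map_eq_zero_iff[of "pw \<mu> \<otimes> m"] \<mu>(1) m(1) by (auto simp: E)
    have "m \<otimes> pw (\<mu> + \<beta>) = pw \<mu> \<otimes> m \<otimes> pw \<beta>"
      using \<mu>(1) m(1) exp[OF \<beta>(1)] by (simp add: pow.multi_power_add m_ac)
    then show "\<exists>\<beta>\<in>exponents I. m \<otimes> pw \<beta> = \<zero>"
      unfolding \<beta>(2) using exponents_add[OF \<mu>(1) exp[OF \<beta>(1)]] by blast
  next
    have inv: "loc_frac E T \<one>\<^bsub>E\<^esub> t \<in> T.fraction_like" if "t \<in> T" for t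
    proof -
      \<comment> \<open>Membership in T is carried along because splitting 1/(x y) into 1/x and 1/y
        needs it for both factors.\<close>
      have "t \<in> T \<and> loc_frac E T \<one>\<^bsub>E\<^esub> t \<in> T.fraction_like"
        using that[unfolded T] V
      proof (induction rule: K\<iota>.S.generated_submonoid_induct)
        case one
        show ?case
          using T.fraction_like_map[OF one_closed] loc.one_closed
          by (simp add: loc.loc_one[symmetric])
      next
        case (incl x)
        then obtain i where i: "i \<in> I - K" "x = u i"
          by blast
        have "w i \<in> T.fraction_like"
          using k[OF i(1)] i(1) w(1)[OF i(1)] fw[OF i(1)]
          by (intro T.fraction_like_single[of i "a (k i)"]) auto
        then show ?case
          using uT[OF i(1)] by (simp add: i(2) w_def)
      next
        case (mult x y)
        then show ?case
          using T.fraction_like_mult by (auto simp: loc.fr_one_mult)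
      qed
      then show ?thesis ..
    qed
    fix y assume "y \<in> carrier loc.L"
    then obtain x t where y: "x \<in> carrier E" "t \<in> T" "y = loc_frac E T x t"
      by (rule loc.loc_carrier_cases)
    obtain m \<nu> where x: "\<nu> \<in> exponents K" "m \<in> K.Lpw \<nu>" "x = K.dfr m \<nu>"
      using y(1) unfolding E by (rule K.D_carrier_cases)
    have "f (pw \<nu>) \<otimes>\<^bsub>loc.L\<^esub> j x = j (K.\<iota> (pw \<nu>) \<otimes>\<^bsub>E\<^esub> x)"
      unfolding f_def using x(1) y(1) by simp
    also have "\<dots> = f m"
      unfolding f_def using K.dil_map_pw_times_dfr[OF x(1,2)] by (simp add: E x(3))
    finally have "j x \<in> T.fraction_like"
      using exp[OF x(1)] x(2) y(1) by (auto simp: T.fraction_like_def)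
    then have "j x \<otimes>\<^bsub>loc.L\<^esub> loc_frac E T \<one>\<^bsub>E\<^esub> t \<in> T.fraction_like"
      using inv[OF y(2)] by (rule T.fraction_like_mult)
    then show "y \<in> T.fraction_like"
      unfolding y(3) loc.fr_eq_loc_map_times[OF y(1,2)] j_def .
  qed
  then show ?thesis
    unfolding f_def j_def .
qed

end


section \<open>Polynomial rings\<close>

lemma finite_submultisets: "finite {u. u \<subseteq># m}"
proof (induction m)
  case (add x m)
  have "{u. u \<subseteq># add_mset x m} \<subseteq> {u. u \<subseteq># m} \<union> add_mset x ` {u. u \<subseteq># m}"
  proof
    fix u assume "u \<in> {u. u \<subseteq># add_mset x m}"
    then have u: "u \<subseteq># add_mset x m"
      by simp
    show "u \<in> {u. u \<subseteq># m} \<union> add_mset x ` {u. u \<subseteq># m}"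
    proof (cases "x \<in># u")
      case True
      then obtain v where "u = add_mset x v"
        by (metis insert_DiffM)
      then show ?thesis
        using u by auto
    next
      case False
      have "u \<subseteq># m"
      proof (rule mset_subset_eqI)
        fix y
        show "count u y \<le> count m y"
          using mset_subset_eq_count[OF u, of y] False by (cases "y = x") (auto simp: not_in_iff)
      qed
      then show ?thesis
        by simp
    qed
  qed
  then show ?case
    using add by (meson finite_UnI finite_imageI finite_subset)
qed simp

context cring
begin

text \<open>The Cauchy product. A monomial has finitely many divisors, so it makes sense for all
  coefficient functions; finite support matters for closure of the polynomials and where a proof is
  an induction over them.\<close>

definition conv :: "('v multiset \<Rightarrow> 'a) \<Rightarrow> ('v multiset \<Rightarrow> 'a) \<Rightarrow> 'v multiset \<Rightarrow> 'a" where
  "conv P Q = (\<lambda>m. \<Oplus>u\<in>{u. u \<subseteq># m}. P u \<otimes> Q (m - u))"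

lemma mpoly_ring_simps:
  "carrier (mpoly_ring R V) = indexed_pset V (carrier R)"
  "P \<otimes>\<^bsub>mpoly_ring R V\<^esub> Q = conv P Q"
  "\<one>\<^bsub>mpoly_ring R V\<^esub> = indexed_const \<one>"
  "\<zero>\<^bsub>mpoly_ring R V\<^esub> = indexed_const \<zero>"
  "P \<oplus>\<^bsub>mpoly_ring R V\<^esub> Q = indexed_padd P Q"
  by (simp_all add: mpoly_ring_def conv_def)

lemma conv_coeff: "carrier_coeff P \<Longrightarrow> carrier_coeff Q \<Longrightarrow> carrier_coeff (conv P Q)"
  unfolding carrier_coeff_def conv_def by (auto intro!: finsum_closed)

lemma conv_comm:
  fixes P Q :: "'v multiset \<Rightarrow> 'a"
  assumes "carrier_coeff P" "carrier_coeff Q"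
  shows "conv P Q = conv Q P"
proof
  fix m :: "'v multiset"
  have dd: "m - (m - u) = u" if "u \<subseteq># m" for u
    using that by (auto simp: multiset_eq_iff subseteq_mset_def)
  \<comment> \<open>Each divisor u of m is exchanged with its complement m - u.\<close>
  have bij: "bij_betw (\<lambda>u. m - u) {u. u \<subseteq># m} {u. u \<subseteq># m}"
    by (rule bij_betw_byWitness[of _ "\<lambda>u. m - u"]) (auto simp: dd)
  have "conv P Q m = (\<Oplus>u\<in>(\<lambda>u. m - u) ` {u. u \<subseteq># m}. P u \<otimes> Q (m - u))"
    unfolding conv_def using bij by (simp add: bij_betw_def)
  also have "\<dots> = (\<Oplus>u\<in>{u. u \<subseteq># m}. P (m - u) \<otimes> Q (m - (m - u)))"
    using assms bij by (intro finsum_reindex) (auto simp: carrier_coeff_def bij_betw_def)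
  also have "\<dots> = conv Q P m"
    unfolding conv_def using assms
    by (intro finsum_cong') (auto simp: carrier_coeff_def m_comm dd)
  finally show "conv P Q m = conv Q P m" .
qed

lemma conv_const:
  fixes Q :: "'v multiset \<Rightarrow> 'a"
  assumes "k \<in> carrier R" "carrier_coeff Q"
  shows "conv (indexed_const k) Q = (\<lambda>m. k \<otimes> Q m)"
proof
  fix m :: "'v multiset"
  have "conv (indexed_const k) Q m = (\<Oplus>u\<in>{{#}}. indexed_const k u \<otimes> Q (m - u))"
    unfolding conv_def using assms
    by (intro add.finprod_mono_neutral_cong_right)
      (auto simp: finite_submultisets indexed_const_def carrier_coeff_def)
  also have "\<dots> = k \<otimes> Q m"
    using assms by (subst finsum_insert) (auto simp: indexed_const_def carrier_coeff_def)
  finally show "conv (indexed_const k) Q m = k \<otimes> Q m" .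
qed

lemma conv_padd:
  fixes P Q T :: "'v multiset \<Rightarrow> 'a"
  assumes "carrier_coeff P" "carrier_coeff Q" "carrier_coeff T"
  shows "conv (indexed_padd P Q) T = indexed_padd (conv P T) (conv Q T)"
proof
  fix m :: "'v multiset"
  have "conv (indexed_padd P Q) T m =
      (\<Oplus>u\<in>{u. u \<subseteq># m}. P u \<otimes> T (m - u) \<oplus> Q u \<otimes> T (m - u))"
    unfolding conv_def using assms
    by (intro finsum_cong') (auto simp: carrier_coeff_def indexed_padd_def l_distr)
  also have "\<dots> = indexed_padd (conv P T) (conv Q T) m"
    unfolding conv_def indexed_padd_def using assms
    by (intro finsum_addf) (auto simp: carrier_coeff_def)
  finally show "conv (indexed_padd P Q) T m = indexed_padd (conv P T) (conv Q T) m" .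
qed

lemma conv_pmult:
  fixes P Q :: "'v multiset \<Rightarrow> 'a"
  assumes "carrier_coeff P" "carrier_coeff Q"
  shows "conv (indexed_pmult P i) Q = indexed_pmult (conv P Q) i"
proof
  fix m :: "'v multiset"
  show "conv (indexed_pmult P i) Q m = indexed_pmult (conv P Q) i m"
  proof (cases "i \<in># m")
    case False
    then have "conv (indexed_pmult P i) Q m = (\<Oplus>u\<in>{u. u \<subseteq># m}. \<zero>)"
      unfolding conv_def using assms
      by (intro finsum_cong') (auto simp: carrier_coeff_def indexed_pmult_def dest: mset_subset_eqD)
    then show ?thesis
      using False by (simp add: indexed_pmult_def)
  next
    case True
    then obtain m' where m: "m = add_mset i m'"
      by (metis insert_DiffM)
    \<comment> \<open>Only divisors that contain the variable \<open>i\<close> contribute, and these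
      are the \<open>add_mset i u\<close> with \<open>u\<close> a divisor of
      \<open>m'\<close>.\<close>
    have "conv (indexed_pmult P i) Q m =
        (\<Oplus>u\<in>add_mset i ` {u. u \<subseteq># m'}. indexed_pmult P i u \<otimes> Q (m - u))"
      unfolding conv_def
    proof (rule add.finprod_mono_neutral_cong_right)
      show "indexed_pmult P i u \<otimes> Q (m - u) = \<zero>"
        if u: "u \<in> {u. u \<subseteq># m} - add_mset i ` {u. u \<subseteq># m'}" for u
      proof -
        have "i \<notin># u"
        proof
          assume "i \<in># u"
          then obtain v where "u = add_mset i v"
            by (metis insert_DiffM)
          then show False
            using u by (auto simp: m)
        qed
        then show "indexed_pmult P i u \<otimes> Q (m - u) = \<zero>"
          using assms by (simp add: indexed_pmult_def carrier_coeff_def)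
      qed
    qed (use assms in \<open>auto simp: m finite_submultisets carrier_coeff_def indexed_pmult_def\<close>)
    also have "\<dots> = (\<Oplus>u\<in>{u. u \<subseteq># m'}. indexed_pmult P i (add_mset i u) \<otimes> Q (m - add_mset i u))"
      using assms by (intro finsum_reindex) (auto simp: carrier_coeff_def indexed_pmult_def inj_on_def)
    also have "\<dots> = indexed_pmult (conv P Q) i m"
      unfolding conv_def indexed_pmult_def using assms
      by (simp add: m)
    finally show ?thesis .
  qed
qed

abbreviation mpolys :: "'v set \<Rightarrow> ('v multiset \<Rightarrow> 'a) set" where
  "mpolys V \<equiv> indexed_pset V (carrier R)"

lemma mpolys_coeff: "P \<in> mpolys V \<Longrightarrow> carrier_coeff P"
  by (rule indexed_pset_in_carrier) simp_all

lemma smult_mpolys: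
  fixes V :: "'v set"
  assumes "k \<in> carrier R" "Q \<in> mpolys V"
  shows "(\<lambda>m. k \<otimes> Q m) \<in> mpolys V"
  using assms(2)
proof (induction rule: indexed_pset.induct)
  case (indexed_const r)
  have "(\<lambda>m :: 'v multiset. k \<otimes> indexed_const r m) = indexed_const (k \<otimes> r)"
    using assms(1) by (auto simp: indexed_const_def)
  then show ?case
    using indexed_const assms(1) by (simp add: indexed_pset.indexed_const)
next
  case (indexed_padd P Q)
  have "(\<lambda>m. k \<otimes> indexed_padd P Q m) = indexed_padd (\<lambda>m. k \<otimes> P m) (\<lambda>m. k \<otimes> Q m)"
    using assms(1) mpolys_coeff[OF indexed_padd.hyps(1)] mpolys_coeff[OF indexed_padd.hyps(2)]
    by (auto simp: indexed_padd_def r_distr carrier_coeff_def)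
  then show ?case
    using indexed_padd.IH by (simp add: indexed_pset.indexed_padd)
next
  case (indexed_pmult P i)
  have "(\<lambda>m. k \<otimes> indexed_pmult P i m) = indexed_pmult (\<lambda>m. k \<otimes> P m) i"
    using assms(1) by (auto simp: indexed_pmult_def)
  then show ?case
    using indexed_pmult by (simp add: indexed_pset.indexed_pmult)
qed

lemma conv_mpolys:
  assumes "P \<in> mpolys V" "Q \<in> mpolys V"
  shows "conv P Q \<in> mpolys V"
  using assms(1)
proof (induction rule: indexed_pset.induct)
  case (indexed_const k)
  then show ?case
    using assms(2) by (simp add: conv_const mpolys_coeff smult_mpolys)
next
  case (indexed_padd P P')
  then show ?case
    using assms(2) by (simp add: conv_padd mpolys_coeff indexed_pset.indexed_padd)
next
  case (indexed_pmult P i)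
  then show ?case
    using assms(2) by (simp add: conv_pmult mpolys_coeff indexed_pset.indexed_pmult)
qed

text \<open>Constants, sums and variables pass through the left argument, so induction on
  \<open>P\<close> avoids reindexing a double sum over chains of divisors.\<close>

lemma conv_assoc:
  assumes "P \<in> mpolys V" "carrier_coeff Q" "carrier_coeff T"
  shows "conv (conv P Q) T = conv P (conv Q T)"
  using assms(1)
proof (induction rule: indexed_pset.induct)
  case (indexed_const k)
  have "conv (\<lambda>m. k \<otimes> Q m) T m = k \<otimes> conv Q T m" for m
  proof -
    have "conv (\<lambda>m. k \<otimes> Q m) T m = (\<Oplus>u\<in>{u. u \<subseteq># m}. k \<otimes> (Q u \<otimes> T (m - u)))"
      unfolding conv_def using indexed_const assms
      by (intro finsum_cong') (auto simp: carrier_coeff_def m_assoc)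
    also have "\<dots> = k \<otimes> conv Q T m"
      unfolding conv_def using indexed_const assms
      by (intro finsum_rdistr[symmetric]) (auto simp: carrier_coeff_def finite_submultisets)
    finally show ?thesis .
  qed
  then show ?case
    using indexed_const assms(2,3) by (simp add: conv_const conv_coeff)
next
  case (indexed_padd P P')
  then show ?case
    using assms(2,3) by (simp add: conv_padd mpolys_coeff conv_coeff)
next
  case (indexed_pmult P i)
  then show ?case
    using assms(2,3) by (simp add: conv_pmult mpolys_coeff conv_coeff)
qed

lemma mpoly_ring_cring: "cring (mpoly_ring R V)"
proof (rule cringI)
  show "abelian_group (mpoly_ring R V)"
  proof (rule abelian_groupI, unfold mpoly_ring_simps)
    fix P assume P: "P \<in> mpolys V"
    have "(\<lambda>m. \<ominus> \<one> \<otimes> P m) \<in> mpolys V"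
      using P by (intro smult_mpolys) simp_all
    moreover have "indexed_padd (\<lambda>m. \<ominus> \<one> \<otimes> P m) P = indexed_const \<zero>"
      using mpolys_coeff[OF P] by (auto simp: indexed_padd_def indexed_const_def carrier_coeff_def l_minus l_neg)
    ultimately show "\<exists>Q\<in>mpolys V. indexed_padd Q P = indexed_const \<zero>"
      by blast
  qed (auto simp: indexed_padd_zero mpolys_coeff indexed_pset.indexed_const indexed_pset.indexed_padd,
      auto simp: indexed_padd_def a_ac dest!: mpolys_coeff simp: carrier_coeff_def)
  show "comm_monoid (mpoly_ring R V)"
  proof (rule comm_monoidI, unfold mpoly_ring_simps)
    fix P Q T assume PQ: "P \<in> mpolys V" "Q \<in> mpolys V"
    show "conv P Q = conv Q P"
      using PQ by (intro conv_comm mpolys_coeff)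
    assume "T \<in> mpolys V"
    then show "conv (conv P Q) T = conv P (conv Q T)"
      using PQ by (intro conv_assoc mpolys_coeff)
  next
    fix P assume P: "P \<in> mpolys V"
    show "conv (indexed_const \<one>) P = P"
      using mpolys_coeff[OF P] by (auto simp: conv_const carrier_coeff_def)
  qed (auto intro: conv_mpolys indexed_pset.indexed_const)
  fix P Q T assume "P \<in> carrier (mpoly_ring R V)" "Q \<in> carrier (mpoly_ring R V)"
    "T \<in> carrier (mpoly_ring R V)"
  then show "(P \<oplus>\<^bsub>mpoly_ring R V\<^esub> Q) \<otimes>\<^bsub>mpoly_ring R V\<^esub> T =
      P \<otimes>\<^bsub>mpoly_ring R V\<^esub> T \<oplus>\<^bsub>mpoly_ring R V\<^esub> Q \<otimes>\<^bsub>mpoly_ring R V\<^esub> T"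
    unfolding mpoly_ring_simps by (intro conv_padd mpolys_coeff)
qed

lemma indexed_const_hom:
  fixes V :: "'v set"
  shows "ring_hom_cring R (mpoly_ring R V) indexed_const"
proof (rule ring_hom_cringI)
  show "indexed_const \<in> ring_hom R (mpoly_ring R V)"
  proof (rule ring_hom_memI, unfold mpoly_ring_simps)
    fix x y assume xy: "x \<in> carrier R" "y \<in> carrier R"
    then have "carrier_coeff (indexed_const y :: 'v multiset \<Rightarrow> 'a)"
      by (auto simp: carrier_coeff_def indexed_const_def)
    then show "indexed_const (x \<otimes> y) = conv (indexed_const x) (indexed_const y :: 'v multiset \<Rightarrow> 'a)"
      using xy by (simp add: conv_const) (auto simp: indexed_const_def)
  qed (auto simp: indexed_padd_const indexed_pset.indexed_const)
qed (use is_cring mpoly_ring_cring in auto)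

lemma indexed_pmult_eq_conv:
  assumes "P \<in> mpolys V"
  shows "indexed_pmult P i = conv P (indexed_var i)"
proof -
  have 1: "carrier_coeff (indexed_const \<one>)"
    by (auto simp: carrier_coeff_def indexed_const_def)
  have "conv P (indexed_var i) = conv (indexed_var i) P"
    using mpolys_coeff[OF assms] indexed_pmult_in_carrier[OF 1] unfolding indexed_var_def
    by (intro conv_comm)
  also have "\<dots> = indexed_pmult (conv (indexed_const \<one>) P) i"
    unfolding indexed_var_def by (rule conv_pmult[OF 1 mpolys_coeff[OF assms]])
  also have "conv (indexed_const \<one>) P = P"
    using mpolys_coeff[OF assms] by (auto simp: conv_const carrier_coeff_def)
  finally show ?thesis ..
qed

lemma indexed_var_mpolys: "i \<in> V \<Longrightarrow> indexed_var i \<in> mpolys V"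
  unfolding indexed_var_def by (intro indexed_pset.intros) simp_all

text \<open>Multiplication by a variable appears as a ring product, so that ring homomorphisms can
  be applied to it.\<close>

lemma mpolys_induct [consumes 1, case_names const add times_var]:
  fixes V
  defines "M \<equiv> mpoly_ring R V"
  assumes "P \<in> carrier M"
    and "\<And>r. r \<in> carrier R \<Longrightarrow> Pr (indexed_const r)"
    and "\<And>P Q. P \<in> carrier M \<Longrightarrow> Q \<in> carrier M \<Longrightarrow> Pr P \<Longrightarrow> Pr Q \<Longrightarrow> Pr (P \<oplus>\<^bsub>M\<^esub> Q)"
    and "\<And>P i. P \<in> carrier M \<Longrightarrow> i \<in> V \<Longrightarrow> Pr P \<Longrightarrow> Pr (P \<otimes>\<^bsub>M\<^esub> indexed_var i)"
  shows "Pr P"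
  using assms(2) unfolding M_def mpoly_ring_simps(1)
proof (induction rule: indexed_pset.induct)
  case (indexed_pmult P i)
  then show ?case
    using assms(5)[of P i] by (simp add: M_def mpoly_ring_simps indexed_pmult_eq_conv)
qed (use assms(3,4) in \<open>auto simp: M_def mpoly_ring_simps\<close>)

text \<open>Makes the inductively generated set usable for coefficient functions that are obtained
  by choice, as in \<open>koszul_exact_mpoly\<close>.\<close>

lemma mpolys_iff:
  "P \<in> mpolys V \<longleftrightarrow> carrier_coeff P \<and> finite {m. P m \<noteq> \<zero>} \<and> (\<forall>m. P m \<noteq> \<zero> \<longrightarrow> set_mset m \<subseteq> V)"
proof
  assume P: "P \<in> mpolys V"
  then have "finite {m. P m \<noteq> \<zero>} \<and> (\<forall>m. P m \<noteq> \<zero> \<longrightarrow> set_mset m \<subseteq> V)"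
  proof (induction rule: indexed_pset.induct)
    case (indexed_const k)
    have "{m. indexed_const k m \<noteq> \<zero>} \<subseteq> {{#}}"
      by (auto simp: indexed_const_def)
    then show ?case
      using finite_subset by (auto simp: indexed_const_def)
  next
    case (indexed_padd P Q)
    have "{m. indexed_padd P Q m \<noteq> \<zero>} \<subseteq> {m. P m \<noteq> \<zero>} \<union> {m. Q m \<noteq> \<zero>}"
      by (auto simp: indexed_padd_def)
    moreover have "finite ({m. P m \<noteq> \<zero>} \<union> {m. Q m \<noteq> \<zero>})"
      using indexed_padd.IH by simp
    ultimately show ?case
      using indexed_padd.IH by (auto intro: finite_subset)
  next
    case (indexed_pmult P i)
    have sub: "{m. indexed_pmult P i m \<noteq> \<zero>} \<subseteq> add_mset i ` {m. P m \<noteq> \<zero>}"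
      by (auto simp: indexed_pmult_def image_iff split: if_splits intro!: exI[of _ "_ - {#i#}"])
    then have "finite {m. indexed_pmult P i m \<noteq> \<zero>}"
      using indexed_pmult.IH finite_subset by blast
    moreover have "set_mset m \<subseteq> V" if "indexed_pmult P i m \<noteq> \<zero>" for m
    proof -
      obtain m' where "m = add_mset i m'" "P m' \<noteq> \<zero>"
        using sub \<open>indexed_pmult P i m \<noteq> \<zero>\<close> by blast
      then show ?thesis
        using indexed_pmult.IH indexed_pmult.hyps(2) by simp
    qed
    ultimately show ?case
      by blast
  qed
  then show "carrier_coeff P \<and> finite {m. P m \<noteq> \<zero>} \<and> (\<forall>m. P m \<noteq> \<zero> \<longrightarrow> set_mset m \<subseteq> V)"
    using mpolys_coeff[OF P] by blast
next
  assume "carrier_coeff P \<and> finite {m. P m \<noteq> \<zero>} \<and> (\<forall>m. P m \<noteq> \<zero> \<longrightarrow> set_mset m \<subseteq> V)"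
  then have fin: "finite {m. P m \<noteq> \<zero>}" and coeff: "\<And>m. P m \<in> carrier R"
    and V: "\<And>m. P m \<noteq> \<zero> \<Longrightarrow> set_mset m \<subseteq> V"
    by (auto simp: carrier_coeff_def)
  have monomial: "(\<lambda>m. if m = m0 then c else \<zero>) \<in> mpolys V"
    if "c \<in> carrier R" "set_mset m0 \<subseteq> V" for m0 c
    using that(2)
  proof (induction m0)
    case empty
    show ?case
      using indexed_pset.indexed_const[of c "carrier R" V] that(1) by (simp add: indexed_const_def)
  next
    case (add x m0)
    have "(\<lambda>m. if m = add_mset x m0 then c else \<zero>) = indexed_pmult (\<lambda>m. if m = m0 then c else \<zero>) x"
      by (auto simp: indexed_pmult_def fun_eq_iff)
    then show ?case
      using add by (simp add: indexed_pset.indexed_pmult)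
  qed
  have "(\<lambda>m. if m \<in> F then P m else \<zero>) \<in> mpolys V" if "finite F" "F \<subseteq> {m. P m \<noteq> \<zero>}" for F
    using that
  proof (induction rule: finite_induct)
    case empty
    show ?case
      using indexed_pset.indexed_const[of \<zero> "carrier R" V] by (simp add: indexed_const_def)
  next
    case (insert m0 F)
    have "(\<lambda>m. if m \<in> insert m0 F then P m else \<zero>) =
        indexed_padd (\<lambda>m. if m = m0 then P m0 else \<zero>) (\<lambda>m. if m \<in> F then P m else \<zero>)"
      using insert.hyps coeff by (auto simp: indexed_padd_def fun_eq_iff)
    moreover have "(\<lambda>m. if m = m0 then P m0 else \<zero>) \<in> mpolys V"
      using insert.prems V coeff by (intro monomial) auto
    ultimately show ?case
      using insert by (simp add: indexed_pset.indexed_padd)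
  qed
  from this[OF fin] have "(\<lambda>m. if m \<in> {m. P m \<noteq> \<zero>} then P m else \<zero>) \<in> mpolys V"
    by simp
  moreover have "(\<lambda>m. if m \<in> {m. P m \<noteq> \<zero>} then P m else \<zero>) = P"
    by auto
  ultimately show "P \<in> mpolys V"
    by simp
qed

lemma mpoly_finsum_coeff:
  assumes "finite J" "\<And>j. j \<in> J \<Longrightarrow> F j \<in> carrier (mpoly_ring R V)"
  shows "finsum (mpoly_ring R V) F J m = (\<Oplus>j\<in>J. F j m)"
proof -
  interpret P: cring "mpoly_ring R V"
    by (rule mpoly_ring_cring)
  show ?thesis
    using assms
  proof (induction rule: finite_induct)
    case empty
    show ?case
      by (simp add: mpoly_ring_simps indexed_const_def)
  next
    case (insert j J)
    have "finsum (mpoly_ring R V) F (insert j J) m = F j m \<oplus> finsum (mpoly_ring R V) F J m"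
      using insert by (subst P.finsum_insert) (auto simp: mpoly_ring_simps(5) indexed_padd_def)
    moreover have "F k m \<in> carrier R" if "k \<in> insert j J" for k
      using mpolys_coeff[of "F k"] insert.prems[OF that] by (simp add: mpoly_ring_simps carrier_coeff_def)
    ultimately show ?case
      using insert by (subst finsum_insert) auto
  qed
qed

end

section \<open>Evaluation of polynomials\<close>

context ring_hom_cring
begin

text \<open>Supplies the homomorphism from A[x] to the dilatation that sends x_i to
  g_i/a^d_i.\<close>

lemma mpoly_eval_exists:
  assumes "finite V" "\<And>i. i \<in> V \<Longrightarrow> y i \<in> carrier S"
  shows "\<exists>\<phi>. ring_hom_cring (mpoly_ring R V) S \<phi> \<and>
    (\<forall>r\<in>carrier R. \<phi> (R.indexed_const r) = h r) \<and> (\<forall>i\<in>V. \<phi> (R.indexed_var i) = y i)"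
proof -
  define mon where "mon m = (\<Otimes>\<^bsub>S\<^esub>i\<in>V. y i [^]\<^bsub>S\<^esub> count m i)" for m
  define \<phi> where "\<phi> P = (\<Oplus>\<^bsub>S\<^esub>m\<in>{m. P m \<noteq> \<zero>}. h (P m) \<otimes>\<^bsub>S\<^esub> mon m)" for P
  have mon [simp]: "mon m \<in> carrier S" for m
    unfolding mon_def using assms(2) by (intro S.finprod_closed) auto
  have mon_empty: "mon {#} = \<one>\<^bsub>S\<^esub>"
    unfolding mon_def using assms(2) by (intro S.finprod_one_eqI) simp
  have mon_add: "mon (add_mset i m) = mon m \<otimes>\<^bsub>S\<^esub> y i" if "i \<in> V" for i m
  proof -
    have "mon (add_mset i m) =
        (\<Otimes>\<^bsub>S\<^esub>j\<in>V. y j [^]\<^bsub>S\<^esub> count m j \<otimes>\<^bsub>S\<^esub> (if i = j then y j else \<one>\<^bsub>S\<^esub>))"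
      unfolding mon_def using assms(2) by (intro S.finprod_cong') auto
    also have "\<dots> = mon m \<otimes>\<^bsub>S\<^esub> (\<Otimes>\<^bsub>S\<^esub>j\<in>V. if i = j then y j else \<one>\<^bsub>S\<^esub>)"
      unfolding mon_def using assms(2) by (intro S.finprod_multf) auto
    also have "(\<Otimes>\<^bsub>S\<^esub>j\<in>V. if i = j then y j else \<one>\<^bsub>S\<^esub>) = y i"
      using assms that by (intro S.finprod_singleton) auto
    finally show ?thesis .
  qed
  \<comment> \<open>Sums over different supports are compared by extending them to a common finite
    set of monomials.\<close>
  have \<phi>_superset: "\<phi> P = (\<Oplus>\<^bsub>S\<^esub>m\<in>J. h (P m) \<otimes>\<^bsub>S\<^esub> mon m)"
    if "finite J" "{m. P m \<noteq> \<zero>} \<subseteq> J" "R.carrier_coeff P" for P J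
    unfolding \<phi>_def using that
    by (intro S.add.finprod_mono_neutral_cong_left) (auto simp: R.carrier_coeff_def)
  have fin: "finite {m. P m \<noteq> \<zero>}" if "P \<in> R.mpolys V" for P
    using that R.mpolys_iff by blast
  have closed: "\<phi> P \<in> carrier S" if "P \<in> R.mpolys V" for P
    unfolding \<phi>_def using R.mpolys_coeff[OF that]
    by (intro S.finsum_closed) (auto simp: R.carrier_coeff_def)
  have const: "\<phi> (R.indexed_const r) = h r" if "r \<in> carrier R" for r
  proof -
    have "\<phi> (R.indexed_const r) = (\<Oplus>\<^bsub>S\<^esub>m\<in>{{#}}. h (R.indexed_const r m) \<otimes>\<^bsub>S\<^esub> mon m)"
      using that by (intro \<phi>_superset) (auto simp: R.indexed_const_def R.carrier_coeff_def)
    also have "\<dots> = h r"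
      using that by (subst S.finsum_insert) (auto simp: R.indexed_const_def mon_empty)
    finally show ?thesis .
  qed
  have add: "\<phi> (R.indexed_padd P Q) = \<phi> P \<oplus>\<^bsub>S\<^esub> \<phi> Q" if PQ: "P \<in> R.mpolys V" "Q \<in> R.mpolys V" for P Q
  proof -
    define J where "J = {m. P m \<noteq> \<zero>} \<union> {m. Q m \<noteq> \<zero>}"
    have J: "finite J"
      unfolding J_def using fin PQ by simp
    have c: "P m \<in> carrier R" "Q m \<in> carrier R" for m
      using R.mpolys_coeff[OF PQ(1)] R.mpolys_coeff[OF PQ(2)] by (auto simp: R.carrier_coeff_def)
    have "\<phi> (R.indexed_padd P Q) = (\<Oplus>\<^bsub>S\<^esub>m\<in>J. h (R.indexed_padd P Q m) \<otimes>\<^bsub>S\<^esub> mon m)"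
      using J c by (intro \<phi>_superset) (auto simp: J_def R.indexed_padd_def R.carrier_coeff_def)
    also have "\<dots> = (\<Oplus>\<^bsub>S\<^esub>m\<in>J. h (P m) \<otimes>\<^bsub>S\<^esub> mon m \<oplus>\<^bsub>S\<^esub> h (Q m) \<otimes>\<^bsub>S\<^esub> mon m)"
      using c by (intro S.finsum_cong') (auto simp: R.indexed_padd_def S.l_distr)
    also have "\<dots> = (\<Oplus>\<^bsub>S\<^esub>m\<in>J. h (P m) \<otimes>\<^bsub>S\<^esub> mon m) \<oplus>\<^bsub>S\<^esub> (\<Oplus>\<^bsub>S\<^esub>m\<in>J. h (Q m) \<otimes>\<^bsub>S\<^esub> mon m)"
      using c by (intro S.finsum_addf) auto
    also have "\<dots> = \<phi> P \<oplus>\<^bsub>S\<^esub> \<phi> Q"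
      using J c \<phi>_superset[of J P] \<phi>_superset[of J Q] by (simp add: J_def R.carrier_coeff_def)
    finally show ?thesis .
  qed
  have pmult: "\<phi> (R.indexed_pmult P i) = \<phi> P \<otimes>\<^bsub>S\<^esub> y i" if P: "P \<in> R.mpolys V" and i: "i \<in> V" for P i
  proof -
    define J where "J = {m. P m \<noteq> \<zero>}"
    have c: "P m \<in> carrier R" for m
      using R.mpolys_coeff[OF P] by (auto simp: R.carrier_coeff_def)
    have sub: "{m. R.indexed_pmult P i m \<noteq> \<zero>} \<subseteq> add_mset i ` J"
    proof
      fix m assume "m \<in> {m. R.indexed_pmult P i m \<noteq> \<zero>}"
      then have "i \<in># m" "P (m - {#i#}) \<noteq> \<zero>"
        by (auto simp: R.indexed_pmult_def split: if_splits)
      then show "m \<in> add_mset i ` J"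
        unfolding J_def by (intro image_eqI[of _ _ "m - {#i#}"]) auto
    qed
    have "\<phi> (R.indexed_pmult P i) =
        (\<Oplus>\<^bsub>S\<^esub>m\<in>add_mset i ` J. h (R.indexed_pmult P i m) \<otimes>\<^bsub>S\<^esub> mon m)"
      using sub c fin[OF P] by (intro \<phi>_superset) (auto simp: J_def R.indexed_pmult_def R.carrier_coeff_def)
    also have "\<dots> = (\<Oplus>\<^bsub>S\<^esub>m\<in>J. h (R.indexed_pmult P i (add_mset i m)) \<otimes>\<^bsub>S\<^esub> mon (add_mset i m))"
      using c by (intro S.finsum_reindex) (auto simp: R.indexed_pmult_def inj_on_def)
    also have "\<dots> = (\<Oplus>\<^bsub>S\<^esub>m\<in>J. h (P m) \<otimes>\<^bsub>S\<^esub> mon m \<otimes>\<^bsub>S\<^esub> y i)"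
      using c i assms(2) by (intro S.finsum_cong') (auto simp: R.indexed_pmult_def mon_add S.m_assoc)
    also have "\<dots> = \<phi> P \<otimes>\<^bsub>S\<^esub> y i"
      unfolding \<phi>_def J_def using c i assms(2) fin[OF P]
      by (intro S.finsum_ldistr[symmetric]) auto
    finally show ?thesis .
  qed
  \<comment> \<open>Induction on the left factor, in the same way as for associativity of the
    product.\<close>
  have mult: "\<phi> (R.conv P Q) = \<phi> P \<otimes>\<^bsub>S\<^esub> \<phi> Q" if P: "P \<in> R.mpolys V" and Q: "Q \<in> R.mpolys V" for P Q
    using P
  proof (induction rule: R.indexed_pset.induct)
    case (indexed_const k)
    have c: "Q m \<in> carrier R" for m
      using R.mpolys_coeff[OF Q] by (auto simp: R.carrier_coeff_def)
    have "\<phi> (\<lambda>m. k \<otimes> Q m) = (\<Oplus>\<^bsub>S\<^esub>m\<in>{m. Q m \<noteq> \<zero>}. h (k \<otimes> Q m) \<otimes>\<^bsub>S\<^esub> mon m)"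
      using indexed_const c fin[OF Q] by (intro \<phi>_superset) (auto simp: R.carrier_coeff_def)
    also have "\<dots> = (\<Oplus>\<^bsub>S\<^esub>m\<in>{m. Q m \<noteq> \<zero>}. h k \<otimes>\<^bsub>S\<^esub> (h (Q m) \<otimes>\<^bsub>S\<^esub> mon m))"
      using indexed_const c by (intro S.finsum_cong') (auto simp: S.m_assoc)
    also have "\<dots> = h k \<otimes>\<^bsub>S\<^esub> \<phi> Q"
      unfolding \<phi>_def using indexed_const c fin[OF Q]
      by (intro S.finsum_rdistr[symmetric]) auto
    finally show ?case
      using indexed_const by (simp add: const R.conv_const R.mpolys_coeff[OF Q])
  next
    case (indexed_padd P P')
    then show ?case
      using Q closed by (simp add: R.conv_padd R.mpolys_coeff add R.conv_mpolys S.l_distr)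
  next
    case (indexed_pmult P i)
    then show ?case
      using Q closed assms(2) by (simp add: R.conv_pmult R.mpolys_coeff pmult R.conv_mpolys S.m_ac)
  qed
  have one: "\<phi> (R.indexed_const \<one>) = \<one>\<^bsub>S\<^esub>"
    by (simp add: const)
  have "ring_hom_cring (mpoly_ring R V) S \<phi>"
  proof (rule ring_hom_cringI)
    show "\<phi> \<in> ring_hom (mpoly_ring R V) S"
      by (rule ring_hom_memI, unfold R.mpoly_ring_simps) (auto simp: closed mult add one)
  qed (use R.mpoly_ring_cring S.is_cring in auto)
  moreover have "\<phi> (R.indexed_var i) = y i" if "i \<in> V" for i
    unfolding R.indexed_var_def using that pmult[of "R.indexed_const \<one>" i] assms(2)
    by (simp add: R.indexed_pset.indexed_const one)
  ultimately show ?thesis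
    using const by blast
qed

end


section \<open>Koszul homology\<close>

context cring
begin

text \<open>The coefficients are indexed by \<open>J\<close> and not by the generators themselves,
  since \<open>h\<close> may repeat values.\<close>

lemma Idl_finite_imageE:
  assumes "finite J" "h \<in> J \<rightarrow> carrier R" "x \<in> Idl (h ` J)"
  obtains q where "q \<in> J \<rightarrow> carrier R" "x = (\<Oplus>j\<in>J. q j \<otimes> h j)"
proof -
  have "\<exists>q. q \<in> J \<rightarrow> carrier R \<and> x = (\<Oplus>j\<in>J. q j \<otimes> h j)"
    using assms
  proof (induction arbitrary: x rule: finite_induct)
    case empty
    have "Idl {} \<subseteq> {\<zero>}"
      by (intro genideal_minimal zeroideal) simp
    then show ?case
      using empty by auto
  next
    case (insert k J)
    have hk: "h k \<in> carrier R" and hJ: "h ` J \<subseteq> carrier R"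
      using insert.prems(1) by auto
    note ideals = cgenideal_ideal[OF hk] genideal_ideal[OF hJ]
    have "PIdl (h k) \<subseteq> PIdl (h k) <+>\<^bsub>R\<^esub> Idl (h ` J) \<and> Idl (h ` J) \<subseteq> PIdl (h k) <+>\<^bsub>R\<^esub> Idl (h ` J)"
      using set_add_subset_iff[OF ideals add_ideals[OF ideals]] by blast
    then have "Idl (h ` insert k J) \<subseteq> PIdl (h k) <+>\<^bsub>R\<^esub> Idl (h ` J)"
      using cgenideal_self[OF hk] genideal_self[OF hJ]
      by (intro genideal_minimal add_ideals ideals) auto
    then obtain r y where r: "r \<in> carrier R" "y \<in> Idl (h ` J)" "x = r \<otimes> h k \<oplus> y"
      using insert.prems(2) by (auto simp: set_add_def' cgenideal_def)
    then obtain q where q: "q \<in> J \<rightarrow> carrier R" "y = (\<Oplus>j\<in>J. q j \<otimes> h j)"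
      using insert.IH[of y] insert.prems(1) by auto
    have "(\<Oplus>j\<in>insert k J. (q(k := r)) j \<otimes> h j) = r \<otimes> h k \<oplus> (\<Oplus>j\<in>J. (q(k := r)) j \<otimes> h j)"
      using insert.hyps insert.prems(1) q(1) r(1) by (subst finsum_insert) (auto simp: Pi_iff)
    also have "(\<Oplus>j\<in>J. (q(k := r)) j \<otimes> h j) = y"
      unfolding q(2) using insert.hyps insert.prems(1) q(1) by (intro finsum_cong') (auto simp: Pi_iff)
    finally show ?case
      using q(1) r(1,3) by (intro exI[of _ "q(k := r)"]) auto
  qed
  then show ?thesis
    using that by blast
qed

lemma finsum_in_ideal:
  assumes "ideal K R" "finite J" "\<And>j. j \<in> J \<Longrightarrow> f j \<in> K"
  shows "(\<Oplus>j\<in>J. f j) \<in> K"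
proof -
  interpret K: ideal K R by fact
  show ?thesis
    using assms(2,3)
  proof (induction rule: finite_induct)
    case (insert j J)
    then show ?case
      by (subst finsum_insert) (auto intro: K.a_closed K.Icarr)
  qed simp
qed

text \<open>Peeling off one index leaves its diagonal term, which is zero, and pairs of opposite
  terms. The zero diagonal is a separate hypothesis because antisymmetry alone only gives 2 t i i =
  0.\<close>

lemma finsum_alternating:
  assumes "finite J" "\<And>i j. i \<in> J \<Longrightarrow> j \<in> J \<Longrightarrow> t i j \<in> carrier R"
    and "\<And>i j. i \<in> J \<Longrightarrow> j \<in> J \<Longrightarrow> t i j = \<ominus> t j i" and "\<And>i. i \<in> J \<Longrightarrow> t i i = \<zero>"
  shows "(\<Oplus>i\<in>J. \<Oplus>j\<in>J. t i j) = \<zero>"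
  using assms
proof (induction rule: finite_induct)
  case (insert k J)
  have cl: "t i j \<in> carrier R" if "i \<in> insert k J" "j \<in> insert k J" for i j
    using insert.prems(1) that .
  have IH: "(\<Oplus>i\<in>J. \<Oplus>j\<in>J. t i j) = \<zero>"
  proof (rule insert.IH)
    fix i j assume "i \<in> J" "j \<in> J"
    then have "i \<in> insert k J" "j \<in> insert k J"
      by auto
    then show "t i j \<in> carrier R" "t i j = \<ominus> t j i"
      by (rule insert.prems)+
    show "t i i = \<zero>"
      using \<open>i \<in> insert k J\<close> by (rule insert.prems)
  qed
  have row: "(\<Oplus>j\<in>insert k J. t i j) = t i k \<oplus> (\<Oplus>j\<in>J. t i j)" if "i \<in> insert k J" for i
    using insert.hyps cl that by (intro finsum_insert) auto
  have "(\<Oplus>i\<in>insert k J. \<Oplus>j\<in>insert k J. t i j) =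
      (\<Oplus>i\<in>insert k J. t i k \<oplus> (\<Oplus>j\<in>J. t i j))"
    using cl by (intro finsum_cong') (auto simp: row intro!: finsum_closed a_closed)
  also have "\<dots> = (t k k \<oplus> (\<Oplus>j\<in>J. t k j)) \<oplus> (\<Oplus>i\<in>J. t i k \<oplus> (\<Oplus>j\<in>J. t i j))"
    using insert.hyps cl by (intro finsum_insert) (auto intro!: finsum_closed a_closed)
  also have "(\<Oplus>i\<in>J. t i k \<oplus> (\<Oplus>j\<in>J. t i j)) = (\<Oplus>i\<in>J. t i k) \<oplus> (\<Oplus>i\<in>J. \<Oplus>j\<in>J. t i j)"
    using cl by (intro finsum_addf) (auto intro!: finsum_closed)
  also have "(t k k \<oplus> (\<Oplus>j\<in>J. t k j)) \<oplus> ((\<Oplus>i\<in>J. t i k) \<oplus> (\<Oplus>i\<in>J. \<Oplus>j\<in>J. t i j)) =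
      (\<Oplus>j\<in>J. t k j) \<oplus> (\<Oplus>i\<in>J. t i k)"
    using cl insert.prems(3)[of k] by (simp add: IH finsum_closed Pi_iff)
  also have "\<dots> = (\<Oplus>j\<in>J. t k j \<oplus> t j k)"
    using cl by (intro finsum_addf[symmetric]) auto
  also have "\<dots> = (\<Oplus>j\<in>J. \<zero>)"
  proof (rule finsum_cong')
    fix j assume j: "j \<in> J"
    then have "t k j = \<ominus> t j k"
      by (intro insert.prems(2)) auto
    then show "t k j \<oplus> t j k = \<zero>"
      using cl[of j k] j by (simp add: l_neg)
  qed auto
  also have "\<dots> = \<zero>"
    by simp
  finally show ?case .
next
  case empty
  show ?case
    by simp
qed

text \<open>Vanishing of the first Koszul homology of a family \<open>F\<close>: the relations between its members
  are generated by the alternating ones.\<close>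

definition koszul_exact :: "'j set \<Rightarrow> ('j \<Rightarrow> 'a) \<Rightarrow> bool" where
  "koszul_exact J F \<longleftrightarrow> (\<forall>z. z \<in> J \<rightarrow> carrier R \<and> (\<Oplus>j\<in>J. F j \<otimes> z j) = \<zero> \<longrightarrow>
    (\<exists>w. (\<forall>i\<in>J. \<forall>j\<in>J. w i j \<in> carrier R \<and> w i j = \<ominus> w j i) \<and> (\<forall>i\<in>J. w i i = \<zero>) \<and>
      (\<forall>i\<in>J. z i = (\<Oplus>j\<in>J. F j \<otimes> w i j))))"

text \<open>A relation is a 1-cycle, and triviality of the quotient group yields a 2-chain with this
  boundary. Spreading its values over ordered pairs, with signs, gives the alternating
  family.\<close>

lemma H1_regular_koszul_exact:
  assumes "H1_regular R fs"
  shows "koszul_exact {..<length fs} (\<lambda>j. fs ! j)"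
  unfolding koszul_exact_def
proof (intro allI impI)
  define r where "r = length fs"
  have fs: "fs ! j \<in> carrier R" if "j < r" for j
    using assms that by (auto simp: H1_regular_def r_def)
  fix x assume x: "x \<in> {..<length fs} \<rightarrow> carrier R \<and> (\<Oplus>j\<in>{..<length fs}. fs ! j \<otimes> x j) = \<zero>"
  have basis0: "koszul_basis r 0 = {{}}"
    by (auto simp: koszul_basis_def dest: finite_subset)
  have basis1: "koszul_basis r 1 = (\<lambda>j. {j}) ` {..<r}"
    by (auto simp: koszul_basis_def card_Suc_eq elim!: card_1_singletonE)
  \<comment> \<open>The relation as a 1-chain, the basis in degree 1 being the singletons.\<close>
  define \<xi> where "\<xi> = (\<lambda>U\<in>koszul_basis r 1. x (the_elem U))"
  have \<xi>_sing: "\<xi> {j} = x j" if "j < r" for j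
    using that by (simp add: \<xi>_def basis1)
  define C where "C = koszul_chains R fs"
  define d where "d = koszul_diff R fs"
  define G where "G = (C 1)\<lparr>carrier := kernel (C 1) (C 0) (d 1)\<rparr>"
  define H where "H = d 2 ` carrier (C 2)"
  have \<xi>: "\<xi> \<in> carrier (C 1)"
    using x by (auto simp: C_def koszul_chains_def r_def[symmetric] \<xi>_def basis1)
  have "d 1 \<xi> = \<one>\<^bsub>C 0\<^esub>"
  proof -
    have "(\<Oplus>j\<in>{..<r} - {}. (\<ominus> \<one>) [^] card {t \<in> {}. t < j} \<otimes> fs ! j \<otimes> \<xi> (insert j {})) =
        (\<Oplus>j\<in>{..<r}. fs ! j \<otimes> x j)"
      using fs x by (intro finsum_cong') (auto simp: \<xi>_sing r_def)
    also have "\<dots> = \<zero>"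
      using x by (simp add: r_def)
    finally show ?thesis
      by (auto simp: d_def koszul_diff_def C_def koszul_chains_def r_def[symmetric] basis0)
  qed
  then have \<xi>_G: "\<xi> \<in> carrier G"
    using \<xi> by (simp add: G_def kernel_def)
  have H1: "carrier (G Mod H) = {\<one>\<^bsub>G Mod H\<^esub>}"
    using assms by (simp add: H1_regular_def koszul_homology_def G_def H_def C_def d_def)
  have "H #>\<^bsub>G\<^esub> \<xi> \<in> carrier (G Mod H)"
    using \<xi>_G by (auto simp: FactGroup_def RCOSETS_def)
  then have "H #>\<^bsub>G\<^esub> \<xi> = H"
    using H1 by (simp add: FactGroup_def)
  \<comment> \<open>The coset of the cycle equals the group \<open>H\<close> of boundaries, and the
    cycle belongs to its own coset because 0 is the boundary of 0.\<close>
  moreover have "\<one>\<^bsub>C 1\<^esub> \<otimes>\<^bsub>G\<^esub> \<xi> \<in> H #>\<^bsub>G\<^esub> \<xi>"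
  proof -
    have "\<one>\<^bsub>C 2\<^esub> \<in> carrier (C 2)"
      by (auto simp: C_def koszul_chains_def)
    moreover have "d 2 \<one>\<^bsub>C 2\<^esub> = \<one>\<^bsub>C 1\<^esub>"
    proof -
      have "(\<Oplus>j\<in>{..<r} - T. (\<ominus> \<one>) [^] card {t \<in> T. t < j} \<otimes> fs ! j \<otimes>
          \<one>\<^bsub>C 2\<^esub> (insert j T)) = \<zero>" if T: "T \<in> koszul_basis r 1" for T
      proof (rule add.finprod_one_eqI)
        fix j assume j: "j \<in> {..<r} - T"
        have "insert j T \<in> koszul_basis r 2"
          using T j finite_subset[of T "{..<r}"] by (auto simp: koszul_basis_def)
        then show "(\<ominus> \<one>) [^] card {t \<in> T. t < j} \<otimes> fs ! j \<otimes> \<one>\<^bsub>C 2\<^esub> (insert j T) = \<zero>"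
          using fs j by (simp add: C_def koszul_chains_def r_def)
      qed
      then show ?thesis
        by (auto simp: d_def koszul_diff_def C_def koszul_chains_def r_def[symmetric])
    qed
    ultimately show ?thesis
      unfolding r_coset_def H_def by force
  qed
  moreover have "\<one>\<^bsub>C 1\<^esub> \<otimes>\<^bsub>G\<^esub> \<xi> = \<xi>"
    using \<xi> by (auto simp: G_def C_def koszul_chains_def fun_eq_iff PiE_iff extensional_def)
  ultimately obtain Y where Y: "Y \<in> carrier (C 2)" "\<xi> = d 2 Y"
    unfolding H_def by auto
  have pair: "{i, j} \<in> koszul_basis r 2" if "i < r" "j < r" "i \<noteq> j" for i j
    using that by (auto simp: koszul_basis_def)
  have Y_cl: "Y {i, j} \<in> carrier R" if "i < r" "j < r" "i \<noteq> j" for i j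
    using Y(1) pair[OF that] by (auto simp: C_def koszul_chains_def r_def)
  \<comment> \<open>At {i} the boundary of Y carries Y {i, j} with the sign -1 exactly when i < j,
    the case in which the inserted j has an element of {i} below it.\<close>
  define w where "w i j = (if j < i then Y {i, j} else if i < j then \<ominus> Y {i, j} else \<zero>)" for i j
  have w_cl: "w i j \<in> carrier R" if "i < r" "j < r" for i j
    using that Y_cl[of i j] by (auto simp: w_def)
  have w_alt: "w i j = \<ominus> w j i" if "i < r" "j < r" for i j
    using that Y_cl[of i j] by (auto simp: w_def insert_commute)
  have w_sum: "x i = (\<Oplus>j\<in>{..<r}. fs ! j \<otimes> w i j)" if i: "i < r" for i
  proof -
    have i1: "{i} \<in> koszul_basis r 1"
      using i by (simp add: basis1)
    have "x i = d 2 Y {i}"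
      using \<xi>_sing[OF i] Y(2) by simp
    also have "\<dots> = (\<Oplus>j\<in>{..<r} - {i}. (\<ominus> \<one>) [^] card {t \<in> {i}. t < j} \<otimes> fs ! j \<otimes> Y (insert j {i}))"
      using i1 by (simp add: d_def koszul_diff_def r_def)
    also have "\<dots> = (\<Oplus>j\<in>{..<r} - {i}. fs ! j \<otimes> w i j)"
    proof (rule finsum_cong')
      fix j assume j: "j \<in> {..<r} - {i}"
      have "{t \<in> {i}. t < j} = (if i < j then {i} else {})"
        by auto
      then have card: "card {t \<in> {i}. t < j} = (if i < j then 1 else 0)"
        by (simp only:) simp
      show "(\<ominus> \<one>) [^] card {t \<in> {i}. t < j} \<otimes> fs ! j \<otimes> Y (insert j {i}) = fs ! j \<otimes> w i j"
        unfolding card using j i fs[of j] Y_cl[of i j]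
        by (cases "i < j") (auto simp: w_def insert_commute l_minus r_minus)
    qed (use i fs w_cl in auto)
    also have "\<dots> = (\<Oplus>j\<in>{..<r}. fs ! j \<otimes> w i j)"
      using i fs w_cl by (intro add.finprod_mono_neutral_cong_left) (auto simp: w_def)
    finally show ?thesis .
  qed
  show "\<exists>w. (\<forall>i\<in>{..<length fs}. \<forall>j\<in>{..<length fs}. w i j \<in> carrier R \<and> w i j = \<ominus> w j i) \<and>
      (\<forall>i\<in>{..<length fs}. w i i = \<zero>) \<and>
      (\<forall>i\<in>{..<length fs}. x i = (\<Oplus>j\<in>{..<length fs}. fs ! j \<otimes> w i j))"
  proof (fold r_def, intro exI[of _ w] conjI ballI)
    fix i j assume "i \<in> {..<r}" "j \<in> {..<r}"
    then have "i < r" "j < r"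
      by simp_all
    then show "w i j \<in> carrier R" "w i j = \<ominus> w j i"
      by (rule w_cl, rule w_alt)
  next
    fix i assume "i \<in> {..<r}"
    then show "w i i = \<zero>" "x i = (\<Oplus>j\<in>{..<r}. fs ! j \<otimes> w i j)"
      using w_sum by (simp_all add: w_def)
  qed
qed

text \<open>With \<open>c o = 1\<close> and \<open>z\<close> the relation that comes from \<open>F o \<otimes> p \<in> J\<close>, one has
  \<open>p = \<Sum>\<^sub>i c\<^sub>i z\<^sub>i = \<Sum>\<^sub>i\<^sub>j c\<^sub>i F\<^sub>j w\<^sub>i\<^sub>j\<close>; modulo the ideal \<open>F\<^sub>j\<close> is \<open>F o \<otimes> c\<^sub>j\<close>, and the sum of the
  alternating family \<open>c\<^sub>i c\<^sub>j w\<^sub>i\<^sub>j\<close> vanishes.\<close>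

lemma koszul_exact_ideal_cancel:
  assumes exact: "koszul_exact J F" and J: "finite J" "o' \<in> J"
    and F: "F \<in> J \<rightarrow> carrier R" and c: "c \<in> J \<rightarrow> carrier R" "c o' = \<one>"
    and p: "p \<in> carrier R" "F o' \<otimes> p \<in> Idl ((\<lambda>j. F j \<ominus> F o' \<otimes> c j) ` (J - {o'}))"
  shows "p \<in> Idl ((\<lambda>j. F j \<ominus> F o' \<otimes> c j) ` (J - {o'}))"
proof -
  define b where "b = F o'"
  define h where "h j = F j \<ominus> b \<otimes> c j" for j
  define K where "K = Idl (h ` (J - {o'}))"
  have Fc: "F j \<in> carrier R" "c j \<in> carrier R" if "j \<in> J" for j
    using F c that by auto
  have b: "b \<in> carrier R"
    unfolding b_def using Fc J by simp
  have h: "h j \<in> carrier R" if "j \<in> J" for j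
    using Fc[OF that] b by (simp add: h_def)
  have K: "ideal K R"
    unfolding K_def using h by (intro genideal_ideal) auto
  interpret K: ideal K R
    by (rule K)
  \<comment> \<open>For j = o' the element is zero because c o' = 1; including it lets the final
    sums run over all of J.\<close>
  have hK: "h j \<in> K" if j: "j \<in> J" for j
  proof (cases "j = o'")
    case True
    then show ?thesis
      using b c(2) K.zero_closed by (simp add: h_def b_def[symmetric] minus_eq r_neg)
  next
    case False
    have "h ` (J - {o'}) \<subseteq> carrier R"
      using h by auto
    then show ?thesis
      unfolding K_def using False j genideal_self by blast
  qed
  have "b \<otimes> p \<in> Idl (h ` (J - {o'}))"
    using p(2) unfolding h_def b_def .
  then obtain q where q: "q \<in> J - {o'} \<rightarrow> carrier R" "b \<otimes> p = (\<Oplus>j\<in>J - {o'}. q j \<otimes> h j)"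
    using J h by (elim Idl_finite_imageE[rotated 2]) auto
  \<comment> \<open>With h j = F j - b c j, the expression of b p as the sum of the q j h j becomes
    the relation b (p + s) - (sum of F j q j) = 0. Its coefficients are the entries of
    \<open>z\<close> below.\<close>
  define s where "s = (\<Oplus>j\<in>J - {o'}. c j \<otimes> q j)"
  have s: "s \<in> carrier R"
    unfolding s_def using Fc q(1) by (intro finsum_closed) auto
  define z where "z j = (if j = o' then p \<oplus> s else \<ominus> q j)" for j
  have z: "z j \<in> carrier R" if "j \<in> J" for j
    using that q(1) p(1) s by (auto simp: z_def)
  have JI: "J = insert o' (J - {o'})"
    using J by blast
  have split: "(\<Oplus>j\<in>J. t j) = t o' \<oplus> (\<Oplus>j\<in>J - {o'}. t j)"
    if "\<And>j. j \<in> J \<Longrightarrow> t j \<in> carrier R" for t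
    using J that by (subst JI, subst finsum_insert) auto
  have qc: "q j \<in> carrier R" if "j \<in> J - {o'}" for j
    using q(1) that by auto
  have split_z: "(\<Oplus>j\<in>J. y j \<otimes> z j) = y o' \<otimes> (p \<oplus> s) \<oplus> (\<Oplus>j\<in>J - {o'}. y j \<otimes> \<ominus> q j)"
    if y: "\<And>j. j \<in> J \<Longrightarrow> y j \<in> carrier R" for y
  proof -
    have "(\<Oplus>j\<in>J. y j \<otimes> z j) = y o' \<otimes> z o' \<oplus> (\<Oplus>j\<in>J - {o'}. y j \<otimes> z j)"
      using y z by (intro split) simp
    also have "(\<Oplus>j\<in>J - {o'}. y j \<otimes> z j) = (\<Oplus>j\<in>J - {o'}. y j \<otimes> \<ominus> q j)"
      using y qc by (intro finsum_cong') (auto simp: z_def)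
    finally show ?thesis
      by (simp add: z_def)
  qed
  have "(\<Oplus>j\<in>J. F j \<otimes> z j) = \<zero>"
  proof -
    have "(\<Oplus>j\<in>J. F j \<otimes> z j) = b \<otimes> (p \<oplus> s) \<oplus> (\<Oplus>j\<in>J - {o'}. F j \<otimes> \<ominus> q j)"
      unfolding b_def using Fc(1) by (rule split_z)
    also have "b \<otimes> (p \<oplus> s) = (\<Oplus>j\<in>J - {o'}. q j \<otimes> h j) \<oplus> (\<Oplus>j\<in>J - {o'}. b \<otimes> (c j \<otimes> q j))"
    proof -
      have "b \<otimes> s = (\<Oplus>j\<in>J - {o'}. b \<otimes> (c j \<otimes> q j))"
        unfolding s_def using J b Fc qc by (intro finsum_rdistr) auto
      then show ?thesis
        using b p(1) s by (simp add: r_distr q(2))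
    qed
    also have "(\<Oplus>j\<in>J - {o'}. q j \<otimes> h j) \<oplus> (\<Oplus>j\<in>J - {o'}. b \<otimes> (c j \<otimes> q j)) =
        (\<Oplus>j\<in>J - {o'}. q j \<otimes> h j \<oplus> b \<otimes> (c j \<otimes> q j))"
      using b Fc qc h by (intro finsum_addf[symmetric]) auto
    also have "(\<Oplus>j\<in>J - {o'}. q j \<otimes> h j \<oplus> b \<otimes> (c j \<otimes> q j)) \<oplus> (\<Oplus>j\<in>J - {o'}. F j \<otimes> \<ominus> q j) =
        (\<Oplus>j\<in>J - {o'}. q j \<otimes> h j \<oplus> b \<otimes> (c j \<otimes> q j) \<oplus> F j \<otimes> \<ominus> q j)"
      using b Fc qc h by (intro finsum_addf[symmetric]) (auto simp: Pi_iff)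
    also have "\<dots> = (\<Oplus>j\<in>J - {o'}. \<zero>)"
    proof (rule finsum_cong')
      fix j assume j: "j \<in> J - {o'}"
      have qj: "q j \<in> carrier R"
        using qc[OF j] .
      have Fj: "F j \<in> carrier R" "c j \<in> carrier R"
        using Fc j by auto
      show "q j \<otimes> h j \<oplus> b \<otimes> (c j \<otimes> q j) \<oplus> F j \<otimes> \<ominus> q j = \<zero>"
        unfolding h_def using qj Fj b by algebra
    qed auto
    finally show ?thesis
      by simp
  qed
  moreover have "z \<in> J \<rightarrow> carrier R"
    using z by simp
  ultimately obtain w where
    "(\<forall>i\<in>J. \<forall>j\<in>J. w i j \<in> carrier R \<and> w i j = \<ominus> w j i) \<and> (\<forall>i\<in>J. w i i = \<zero>) \<and>
      (\<forall>i\<in>J. z i = (\<Oplus>j\<in>J. F j \<otimes> w i j))"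
    using exact unfolding koszul_exact_def by blast
  then have w: "\<And>i j. i \<in> J \<Longrightarrow> j \<in> J \<Longrightarrow> w i j \<in> carrier R"
      "\<And>i j. i \<in> J \<Longrightarrow> j \<in> J \<Longrightarrow> w i j = \<ominus> w j i" "\<And>i. i \<in> J \<Longrightarrow> w i i = \<zero>"
      "\<And>i. i \<in> J \<Longrightarrow> z i = (\<Oplus>j\<in>J. F j \<otimes> w i j)"
    by blast+
  have "(\<Oplus>i\<in>J. c i \<otimes> z i) = p \<oplus> s \<oplus> (\<Oplus>j\<in>J - {o'}. c j \<otimes> \<ominus> q j)"
    using split_z[of c] Fc(2) c(2) p(1) s by simp
  also have "(\<Oplus>j\<in>J - {o'}. c j \<otimes> \<ominus> q j) = \<ominus> s"
  proof (rule minus_equality[symmetric])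
    have "(\<Oplus>j\<in>J - {o'}. c j \<otimes> \<ominus> q j) \<oplus> s = (\<Oplus>j\<in>J - {o'}. c j \<otimes> \<ominus> q j \<oplus> c j \<otimes> q j)"
      unfolding s_def using Fc qc by (intro finsum_addf[symmetric]) auto
    also have "\<dots> = (\<Oplus>j\<in>J - {o'}. \<zero>)"
      using Fc qc by (intro finsum_cong') (auto simp: r_minus l_neg Pi_iff)
    finally show "(\<Oplus>j\<in>J - {o'}. c j \<otimes> \<ominus> q j) \<oplus> s = \<zero>"
      by simp
  qed (use s Fc qc in \<open>auto intro!: finsum_closed\<close>)
  finally have p_eq: "p = (\<Oplus>i\<in>J. c i \<otimes> z i)"
    using p(1) s by (simp add: a_assoc r_neg)
  have summand: "c i \<otimes> z i = (\<Oplus>j\<in>J. c i \<otimes> w i j \<otimes> h j) \<oplus> b \<otimes> (\<Oplus>j\<in>J. c i \<otimes> c j \<otimes> w i j)"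
    if i: "i \<in> J" for i
  proof -
    have "c i \<otimes> z i = (\<Oplus>j\<in>J. c i \<otimes> (F j \<otimes> w i j))"
      unfolding w(4)[OF i] using J Fc w(1) i by (intro finsum_rdistr) auto
    also have "\<dots> = (\<Oplus>j\<in>J. c i \<otimes> w i j \<otimes> h j \<oplus> b \<otimes> (c i \<otimes> c j \<otimes> w i j))"
    proof (rule finsum_cong')
      fix j assume j: "j \<in> J"
      show "c i \<otimes> (F j \<otimes> w i j) = c i \<otimes> w i j \<otimes> h j \<oplus> b \<otimes> (c i \<otimes> c j \<otimes> w i j)"
        unfolding h_def using Fc[OF i] Fc[OF j] w(1)[OF i j] b by algebra
    qed (use Fc w(1) h b i in auto)
    also have "\<dots> = (\<Oplus>j\<in>J. c i \<otimes> w i j \<otimes> h j) \<oplus> (\<Oplus>j\<in>J. b \<otimes> (c i \<otimes> c j \<otimes> w i j))"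
      using Fc w(1) h b i by (intro finsum_addf) auto
    also have "(\<Oplus>j\<in>J. b \<otimes> (c i \<otimes> c j \<otimes> w i j)) = b \<otimes> (\<Oplus>j\<in>J. c i \<otimes> c j \<otimes> w i j)"
      using J Fc w(1) b i by (intro finsum_rdistr[symmetric]) auto
    finally show ?thesis .
  qed
  have "p = (\<Oplus>i\<in>J. (\<Oplus>j\<in>J. c i \<otimes> w i j \<otimes> h j) \<oplus> b \<otimes> (\<Oplus>j\<in>J. c i \<otimes> c j \<otimes> w i j))"
    unfolding p_eq using Fc w(1) h b
    by (intro finsum_cong') (auto simp: summand intro!: finsum_closed a_closed m_closed)
  also have "\<dots> = (\<Oplus>i\<in>J. \<Oplus>j\<in>J. c i \<otimes> w i j \<otimes> h j) \<oplus> (\<Oplus>i\<in>J. b \<otimes> (\<Oplus>j\<in>J. c i \<otimes> c j \<otimes> w i j))"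
    using Fc w(1) h b by (intro finsum_addf) (auto intro!: finsum_closed m_closed)
  also have "(\<Oplus>i\<in>J. b \<otimes> (\<Oplus>j\<in>J. c i \<otimes> c j \<otimes> w i j)) = b \<otimes> (\<Oplus>i\<in>J. \<Oplus>j\<in>J. c i \<otimes> c j \<otimes> w i j)"
    using J Fc w(1) b by (intro finsum_rdistr[symmetric]) (auto intro!: finsum_closed m_closed)
  also have "(\<Oplus>i\<in>J. \<Oplus>j\<in>J. c i \<otimes> c j \<otimes> w i j) = \<zero>"
  proof (rule finsum_alternating[OF J(1)])
    fix i j assume ij: "i \<in> J" "j \<in> J"
    have "c i \<otimes> c j \<otimes> w i j = c i \<otimes> c j \<otimes> \<ominus> w j i"
      using w(2)[OF ij] by simp
    also have "\<dots> = \<ominus> (c j \<otimes> c i \<otimes> w j i)"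
      using Fc[OF ij(1)] Fc[OF ij(2)] w(1)[OF ij(2,1)] by algebra
    finally show "c i \<otimes> c j \<otimes> w i j = \<ominus> (c j \<otimes> c i \<otimes> w j i)" .
  qed (use Fc w(1,3) in auto)
  finally have "p = (\<Oplus>i\<in>J. \<Oplus>j\<in>J. c i \<otimes> w i j \<otimes> h j)"
    using b Fc w(1) h by (simp add: finsum_closed Pi_iff)
  also have "\<dots> \<in> K"
    using J Fc w(1) hK by (intro finsum_in_ideal[OF K] K.I_l_closed) auto
  finally show ?thesis
    unfolding K_def h_def b_def .
qed

text \<open>Constants do not mix coefficients of different monomials, so an alternating family can
  be chosen for one monomial at a time. What remains is to keep the chosen coefficients within a
  finite support.\<close>

lemma koszul_exact_mpoly:
  assumes exact: "koszul_exact J F" and J: "finite J" and F: "F \<in> J \<rightarrow> carrier R"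
  shows "cring.koszul_exact (mpoly_ring R V) J (\<lambda>j. indexed_const (F j))"
proof -
  let ?P = "mpoly_ring R V"
  interpret P: cring "mpoly_ring R V"
    by (rule mpoly_ring_cring)
  note simps = mpoly_ring_simps
  show ?thesis
    unfolding P.koszul_exact_def
  proof (intro allI impI)
    fix z assume z: "z \<in> J \<rightarrow> carrier ?P \<and>
      (\<Oplus>\<^bsub>?P\<^esub>j\<in>J. indexed_const (F j) \<otimes>\<^bsub>?P\<^esub> z j) = \<zero>\<^bsub>?P\<^esub>"
    then have zc: "z j \<in> mpolys V" if "j \<in> J" for j
      using that by (auto simp: simps)
    have zm: "z j m \<in> carrier R" if "j \<in> J" for j m
      using mpolys_coeff[OF zc[OF that]] by (simp add: carrier_coeff_def)
    have const: "indexed_const (F j) \<in> mpolys V" if "j \<in> J" for j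
      using that F by (intro indexed_pset.indexed_const) auto
    have coeff: "(\<Oplus>\<^bsub>?P\<^esub>j\<in>J. indexed_const (F j) \<otimes>\<^bsub>?P\<^esub> Q j) m =
        (\<Oplus>j\<in>J. F j \<otimes> Q j m)" if Q: "\<And>j. j \<in> J \<Longrightarrow> Q j \<in> mpolys V" for Q m
    proof -
      have Qm: "Q j m \<in> carrier R" if "j \<in> J" for j
        using mpolys_coeff[OF Q[OF that]] by (simp add: carrier_coeff_def)
      have "(\<Oplus>\<^bsub>?P\<^esub>j\<in>J. indexed_const (F j) \<otimes>\<^bsub>?P\<^esub> Q j) m =
          (\<Oplus>j\<in>J. conv (indexed_const (F j)) (Q j) m)"
        unfolding simps(2) using const Q by (intro mpoly_finsum_coeff[OF J]) (simp add: simps(1) conv_mpolys)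
      also have "\<dots> = (\<Oplus>j\<in>J. F j \<otimes> Q j m)"
      proof (rule finsum_cong')
        fix j assume j: "j \<in> J"
        show "conv (indexed_const (F j)) (Q j) m = F j \<otimes> Q j m"
          using fun_cong[OF conv_const[OF funcset_mem[OF F j] mpolys_coeff[OF Q[OF j]]], of m] .
      qed (use F Qm in auto)
      finally show ?thesis .
    qed
    have "\<exists>w. (\<forall>i\<in>J. \<forall>j\<in>J. w i j \<in> carrier R \<and> w i j = \<ominus> w j i) \<and> (\<forall>i\<in>J. w i i = \<zero>) \<and>
        (\<forall>i\<in>J. z i m = (\<Oplus>j\<in>J. F j \<otimes> w i j))" for m
    proof -
      have "(\<Oplus>j\<in>J. F j \<otimes> z j m) = \<zero>"
        using coeff[of z m, OF zc] z by (simp add: simps indexed_const_def)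
      then show ?thesis
        using exact[unfolded koszul_exact_def, rule_format, of "\<lambda>j. z j m"] zm by blast
    qed
    then have "\<exists>w. \<forall>m. (\<forall>i\<in>J. \<forall>j\<in>J. w m i j \<in> carrier R \<and> w m i j = \<ominus> w m j i) \<and>
        (\<forall>i\<in>J. w m i i = \<zero>) \<and> (\<forall>i\<in>J. z i m = (\<Oplus>j\<in>J. F j \<otimes> w m i j))"
      by (intro choice allI)
    then obtain w where
      "\<forall>m. (\<forall>i\<in>J. \<forall>j\<in>J. w m i j \<in> carrier R \<and> w m i j = \<ominus> w m j i) \<and>
        (\<forall>i\<in>J. w m i i = \<zero>) \<and> (\<forall>i\<in>J. z i m = (\<Oplus>j\<in>J. F j \<otimes> w m i j))" ..
    then have w: "\<And>m i j. i \<in> J \<Longrightarrow> j \<in> J \<Longrightarrow> w m i j \<in> carrier R"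
      "\<And>m i j. i \<in> J \<Longrightarrow> j \<in> J \<Longrightarrow> w m i j = \<ominus> w m j i" "\<And>m i. i \<in> J \<Longrightarrow> w m i i = \<zero>"
      "\<And>m i. i \<in> J \<Longrightarrow> z i m = (\<Oplus>j\<in>J. F j \<otimes> w m i j)"
      by blast+
    define supp where "supp = (\<Union>j\<in>J. {m. z j m \<noteq> \<zero>})"
    have "finite {m. z j m \<noteq> \<zero>}" "\<And>m. z j m \<noteq> \<zero> \<Longrightarrow> set_mset m \<subseteq> V" if "j \<in> J" for j
      using zc[OF that] unfolding mpolys_iff by blast+
    then have supp: "finite supp" "\<And>m. m \<in> supp \<Longrightarrow> set_mset m \<subseteq> V"
      unfolding supp_def using J by blast+
    \<comment> \<open>Truncation to the monomials that occur in some \<open>z j\<close> makes the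
      choice a polynomial; elsewhere all \<open>z j\<close> vanish, so zero coefficients are a
      solution there, and they are alternating.\<close>
    define W where "W i j = (\<lambda>m. if m \<in> supp then w m i j else \<zero>)" for i j
    have W: "W i j \<in> mpolys V" if "i \<in> J" "j \<in> J" for i j
    proof -
      have sub: "{m. W i j m \<noteq> \<zero>} \<subseteq> supp"
        by (auto simp: W_def)
      have "carrier_coeff (W i j)"
        using w(1)[OF that] by (simp add: carrier_coeff_def W_def)
      moreover have "finite {m. W i j m \<noteq> \<zero>}"
        using sub supp(1) by (rule finite_subset)
      moreover have "\<forall>m. W i j m \<noteq> \<zero> \<longrightarrow> set_mset m \<subseteq> V"
        using sub supp(2) by blast
      ultimately show ?thesis
        unfolding mpolys_iff by blast
    qed
    have W_alt: "W i j = \<ominus>\<^bsub>?P\<^esub> W j i" if "i \<in> J" "j \<in> J" for i j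
    proof (rule P.minus_equality[symmetric])
      show "W i j \<oplus>\<^bsub>?P\<^esub> W j i = \<zero>\<^bsub>?P\<^esub>"
      proof
        fix m
        have "w m i j \<oplus> w m j i = \<zero>"
          using w(1)[OF that(2,1)] by (subst w(2)[OF that]) (simp add: l_neg)
        then show "(W i j \<oplus>\<^bsub>?P\<^esub> W j i) m = \<zero>\<^bsub>?P\<^esub> m"
          by (simp add: simps indexed_padd_def indexed_const_def W_def)
      qed
    qed (use W that in \<open>simp_all add: simps\<close>)
    have W_diag: "W i i = \<zero>\<^bsub>?P\<^esub>" if "i \<in> J" for i
      using w(3)[OF that] by (auto simp: W_def simps indexed_const_def)
    have W_sum: "z i = (\<Oplus>\<^bsub>?P\<^esub>j\<in>J. indexed_const (F j) \<otimes>\<^bsub>?P\<^esub> W i j)"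
      if i: "i \<in> J" for i
    proof
      fix m
      have "(\<Oplus>\<^bsub>?P\<^esub>j\<in>J. indexed_const (F j) \<otimes>\<^bsub>?P\<^esub> W i j) m =
          (\<Oplus>j\<in>J. F j \<otimes> W i j m)"
        using W i by (intro coeff)
      also have "\<dots> = z i m"
      proof (cases "m \<in> supp")
        case True
        then show ?thesis
          using w(4)[OF i] by (simp add: W_def)
      next
        case False
        have "(\<Oplus>j\<in>J. F j \<otimes> W i j m) = \<zero>"
          using False F by (intro add.finprod_one_eqI) (auto simp: W_def Pi_iff)
        then show ?thesis
          using False i by (auto simp: supp_def)
      qed
      finally show "z i m = (\<Oplus>\<^bsub>?P\<^esub>j\<in>J. indexed_const (F j) \<otimes>\<^bsub>?P\<^esub> W i j) m" ..
    qed
    show "\<exists>w. (\<forall>i\<in>J. \<forall>j\<in>J. w i j \<in> carrier ?P \<and>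
        w i j = \<ominus>\<^bsub>?P\<^esub> w j i) \<and> (\<forall>i\<in>J. w i i = \<zero>\<^bsub>?P\<^esub>) \<and>
        (\<forall>i\<in>J. z i = (\<Oplus>\<^bsub>?P\<^esub>j\<in>J. indexed_const (F j) \<otimes>\<^bsub>?P\<^esub> w i j))"
      by (intro exI[of _ W] conjI ballI)
        (unfold simps(1), fact W, fact W_alt, fact W_diag, fact W_sum)
  qed
qed

end


section \<open>Dilatations as quotients of polynomial rings\<close>

text \<open>The quotient becomes a target of the dilatation once b is known to be regular in it,
  because there x_i solves b^(d_i) x_i = g_i. The criterion gives an isomorphism from the
  dilatation, and its inverse is the map of the statement.\<close>

theorem (in cring) dil_iso_polynomial_quotient:
  fixes n :: nat and b :: 'a and g :: "nat \<Rightarrow> 'a" and d :: "nat \<Rightarrow> nat"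
  assumes H1: "H1_regular R (b # map g [1..<Suc n])" and d: "\<forall>i\<in>{1..n}. 0 < d i"
  defines "P \<equiv> mpoly_ring R {1..n}"
    and "x \<equiv> indexed_var"
    and "N \<equiv> \<lambda>i. PIdl (g i)"
    and "c \<equiv> \<lambda>i. b [^] d i"
  defines "K \<equiv> Idl\<^bsub>P\<^esub> ((\<lambda>i. indexed_const (g i) \<ominus>\<^bsub>P\<^esub> indexed_const (b [^] d i) \<otimes>\<^bsub>P\<^esub> x i) ` {1..n})"
  shows "\<exists>\<theta>\<in>alg_iso R (P Quot K) (\<lambda>r. K +>\<^bsub>P\<^esub> indexed_const r) (dilatation R {1..n} N c) (dil_map R {1..n} N c).
    \<forall>i\<in>{1..n}. \<theta> (K +>\<^bsub>P\<^esub> x i) = dil_frac R {1..n} N c (g i) (Poly_Mapping.single i 1)"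
proof -
  define V where "V = {1..n}"
  define fs where "fs = b # map g [1..<Suc n]"
  have len: "length fs = Suc n"
    by (simp add: fs_def)
  \<comment> \<open>Position 0 of the list holds \<open>b\<close> and position \<open>i\<close>
    holds \<open>g i\<close>, so the Koszul indices are 0 together with the indices of the
    variables.\<close>
  have fs0: "fs ! 0 = b"
    by (simp add: fs_def)
  have fsi: "fs ! i = g i" if "i \<in> V" for i
    using that by (auto simp: fs_def V_def nth_Cons split: nat.split simp del: upt_Suc)
  have fsR: "fs ! j \<in> carrier R" if "j \<in> {..<Suc n}" for j
    using H1 that nth_mem[of j fs] len unfolding H1_regular_def fs_def[symmetric] by auto
  have b: "b \<in> carrier R"
    using fsR[of 0] fs0 by simp
  have g: "g i \<in> carrier R" if "i \<in> V" for i
    using fsR[of i] fsi[OF that] that by (simp add: V_def)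
  have V: "{..<Suc n} - {0} = V" "finite V"
    by (auto simp: V_def)
  interpret P: cring P
    unfolding P_def by (rule mpoly_ring_cring)
  interpret const: ring_hom_cring R P indexed_const
    unfolding P_def by (rule indexed_const_hom)
  have x: "x i \<in> carrier P" if "i \<in> V" for i
    using indexed_var_mpolys[of i V] that by (simp add: P_def x_def mpoly_ring_simps V_def)
  define h where "h i = indexed_const (g i) \<ominus>\<^bsub>P\<^esub> indexed_const (b [^] d i) \<otimes>\<^bsub>P\<^esub> x i" for i
  have K_eq: "K = Idl\<^bsub>P\<^esub> (h ` V)"
    unfolding K_def h_def V_def ..
  have h: "h i \<in> carrier P" if "i \<in> V" for i
    unfolding h_def using that g b x by simp
  have K: "ideal K P"
    unfolding K_eq using h by (intro P.genideal_ideal) auto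
  interpret K: ideal K P
    by (rule K)
  define B where "B = P Quot K"
  define \<pi> where "\<pi> = (\<lambda>p. K +>\<^bsub>P\<^esub> p)"
  interpret \<pi>: ring_hom_cring P B \<pi>
    unfolding B_def \<pi>_def by (rule K.rcos_ring_hom_cring[OF P.is_cring])
  have zero_B: "\<zero>\<^bsub>B\<^esub> = K"
    by (simp add: B_def FactRing_def)
  have \<pi>_zero: "\<pi> p = \<zero>\<^bsub>B\<^esub> \<longleftrightarrow> p \<in> K" if "p \<in> carrier P" for p
    unfolding zero_B \<pi>_def using that K.rcos_const_imp_mem P.a_rcos_zero[OF K] by blast
  have B_cases: "\<exists>p\<in>carrier P. y = \<pi> p" if "y \<in> carrier B" for y
    using that by (auto simp: B_def \<pi>_def FactRing_def A_RCOSETS_def')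
  define f where "f r = \<pi> (indexed_const r)" for r
  have f: "ring_hom_cring R B f"
  proof (rule ring_hom_cringI)
    show "f \<in> ring_hom R B"
      by (rule ring_hom_memI) (auto simp: f_def)
  qed (use is_cring \<pi>.S.is_cring in auto)
  interpret f: ring_hom_cring R B f
    by (rule f)
  have h_zero: "f (g i) = f (b [^] d i) \<otimes>\<^bsub>B\<^esub> \<pi> (x i)" if i: "i \<in> V" for i
  proof -
    have "h i \<in> K"
      unfolding K_eq using h i P.genideal_self[of "h ` V"] by blast
    then have "\<pi> (h i) = \<zero>\<^bsub>B\<^esub>"
      using \<pi>_zero h[OF i] by simp
    then have "f (g i) \<ominus>\<^bsub>B\<^esub> f (b [^] d i) \<otimes>\<^bsub>B\<^esub> \<pi> (x i) = \<zero>\<^bsub>B\<^esub>"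
      using g[OF i] b x[OF i] by (simp add: h_def f_def P.minus_eq \<pi>.S.minus_eq)
    then show ?thesis
      using g[OF i] b x[OF i] by (simp add: f_def)
  qed
  have b_nzd: "nonzerodivisor B (f b)"
  proof (rule \<pi>.S.nonzerodivisorI)
    show "f b \<in> carrier B"
      using b by simp
    fix y assume y: "y \<in> carrier B" "f b \<otimes>\<^bsub>B\<^esub> y = \<zero>\<^bsub>B\<^esub>"
    obtain p where p: "p \<in> carrier P" "y = \<pi> p"
      using B_cases[OF y(1)] by blast
    define F :: "nat \<Rightarrow> nat multiset \<Rightarrow> 'a" where "F j = indexed_const (fs ! j)" for j
    \<comment> \<open>The multipliers for \<open>koszul_exact_ideal_cancel\<close>: modulo K, g j is
      b times b^(d j - 1) x j. Positivity of d j makes d j - 1 a true predecessor, as truncated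
      subtraction would otherwise give 0.\<close>
    define e where "e j = (if j = 0 then \<one>\<^bsub>P\<^esub> else indexed_const (b [^] (d j - 1)) \<otimes>\<^bsub>P\<^esub> x j)" for j
    have exact: "P.koszul_exact {..<Suc n} F"
      using koszul_exact_mpoly[OF H1_regular_koszul_exact[OF H1], of V] fsR len
      unfolding F_def P_def V_def fs_def[symmetric] by simp
    have F0: "F 0 = indexed_const b"
      by (simp add: F_def fs0)
    have h_eq: "F j \<ominus>\<^bsub>P\<^esub> F 0 \<otimes>\<^bsub>P\<^esub> e j = h j" if j: "j \<in> V" for j
    proof -
      have "b [^] d j = b \<otimes> b [^] (d j - 1)"
        using d j b nat_pow_Suc2[OF b, of "d j - 1"] by (simp add: V_def)
      moreover have "j \<noteq> 0"
        using j by (simp add: V_def)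
      ultimately show ?thesis
        unfolding h_def F0 using j b x[OF j] by (simp add: F_def fsi e_def P.m_assoc)
    qed
    have img: "(\<lambda>j. F j \<ominus>\<^bsub>P\<^esub> F 0 \<otimes>\<^bsub>P\<^esub> e j) ` ({..<Suc n} - {0}) = h ` V"
      unfolding V(1) using h_eq by (intro image_cong) auto
    have "indexed_const b \<otimes>\<^bsub>P\<^esub> p \<in> K"
      using y(2) p b \<pi>_zero[of "indexed_const b \<otimes>\<^bsub>P\<^esub> p"] by (simp add: f_def)
    moreover have "F \<in> {..<Suc n} \<rightarrow> carrier P"
      using fsR by (auto simp: F_def)
    moreover have "e \<in> {..<Suc n} \<rightarrow> carrier P"
      using b x V(1) by (auto simp: e_def)
    ultimately have "p \<in> K"
      using P.koszul_exact_ideal_cancel[OF exact, of 0 e p, unfolded img, folded K_eq] p(1)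
      by (simp add: F0 e_def)
    then show "y = \<zero>\<^bsub>B\<^esub>"
      using p \<pi>_zero by simp
  qed
  have c [simp]: "c i \<in> carrier R" for i
    unfolding c_def using b by simp
  have h_c: "h i = indexed_const (g i) \<ominus>\<^bsub>P\<^esub> indexed_const (c i) \<otimes>\<^bsub>P\<^esub> x i" for i
    by (simp add: h_def c_def)
  interpret D: multi_centered R V N c
    using g by unfold_locales (auto simp: multi_center_def N_def intro: cgenideal_ideal)
  have gN: "g i \<in> N i" if "i \<in> V" for i
    unfolding N_def using g[OF that] by (rule cgenideal_self)
  have gL: "g i \<in> D.Lid i" if "i \<in> V" for i
    using gN[OF that] D.M_subset_Lid[OF that] by blast
  have reg: "nonzerodivisor B (f (c i))" for i
    using \<pi>.S.nonzerodivisor_pow[OF b_nzd] b by (simp add: c_def)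
  have div: "\<exists>y\<in>carrier B. f m = f (c i) \<otimes>\<^bsub>B\<^esub> y" if i: "i \<in> V" and m: "m \<in> N i" for i m
  proof -
    obtain r where r: "r \<in> carrier R" "m = r \<otimes> g i"
      using m by (auto simp: N_def cgenideal_def)
    have "f m = f r \<otimes>\<^bsub>B\<^esub> (f (c i) \<otimes>\<^bsub>B\<^esub> \<pi> (x i))"
      unfolding r(2) c_def h_zero[OF i, symmetric] using r(1) g[OF i] by simp
    also have "\<dots> = f (c i) \<otimes>\<^bsub>B\<^esub> (f r \<otimes>\<^bsub>B\<^esub> \<pi> (x i))"
      using r(1) x[OF i] by (intro \<pi>.S.m_lcomm) auto
    finally show ?thesis
      using r(1) x[OF i] by blast
  qed
  interpret T: regular_target R V N c B f
    by (intro regular_target.intro regular_target_axioms.intro D.multi_centered_axioms f reg div)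
  have "canonically_isomorphic R D.D D.\<iota> B f"
  proof (rule T.canonically_isomorphicI)
    fix m assume m: "m \<in> carrier R" "f m = \<zero>\<^bsub>B\<^esub>"
    interpret \<iota>: ring_hom_cring R D.D D.\<iota>
      by (rule D.dil_map_hom)
    define y where "y i = D.dfr (g i) (Poly_Mapping.single i 1)" for i
    have y: "y i \<in> carrier D.D" "D.\<iota> (c i) \<otimes>\<^bsub>D.D\<^esub> y i = D.\<iota> (g i)" if "i \<in> V" for i
      using D.dil_map_times_dfr_single[OF that gL[OF that]] by (simp_all add: y_def)
    \<comment> \<open>Evaluation at the fractions g_i/c_i sends the generators of K to zero. Hence
      m, whose constant polynomial lies in K, maps to zero in the dilatation, which means that a
      monomial kills it.\<close>
    obtain \<phi> where \<phi>: "ring_hom_cring P D.D \<phi>"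
      "\<And>r. r \<in> carrier R \<Longrightarrow> \<phi> (indexed_const r) = D.\<iota> r" "\<And>i. i \<in> V \<Longrightarrow> \<phi> (x i) = y i"
      using \<iota>.mpoly_eval_exists[OF V(2), of y] y(1) unfolding P_def x_def V_def[symmetric] by blast
    interpret \<phi>: ring_hom_cring P D.D \<phi>
      by (rule \<phi>(1))
    have "h ` V \<subseteq> a_kernel P D.D \<phi>"
    proof
      fix q assume "q \<in> h ` V"
      then obtain i where i: "i \<in> V" "q = h i"
        by blast
      have "\<phi> (h i) = D.\<iota> (g i) \<ominus>\<^bsub>D.D\<^esub> D.\<iota> (c i) \<otimes>\<^bsub>D.D\<^esub> y i"
        unfolding h_c using g[OF i(1)] x[OF i(1)]
        by (simp add: P.minus_eq \<iota>.S.minus_eq \<phi>(2) \<phi>(3)[OF i(1)])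
      also have "\<dots> = \<zero>\<^bsub>D.D\<^esub>"
        unfolding y(2)[OF i(1)] using g[OF i(1)] by (simp add: \<iota>.S.minus_eq \<iota>.S.r_neg)
      finally show "q \<in> a_kernel P D.D \<phi>"
        unfolding a_kernel_def' i(2) using h[OF i(1)] by blast
    qed
    then have "K \<subseteq> a_kernel P D.D \<phi>"
      unfolding K_eq by (intro P.genideal_minimal \<phi>.ring.kernel_is_ideal)
    moreover have "indexed_const m \<in> K"
      using m \<pi>_zero[of "indexed_const m"] by (simp add: f_def)
    ultimately have "\<phi> (indexed_const m) = \<zero>\<^bsub>D.D\<^esub>"
      unfolding a_kernel_def' by blast
    then show "\<exists>\<beta>\<in>exponents V. m \<otimes> D.pw \<beta> = \<zero>"
      using m(1) \<phi>(2) D.dil_map_eq_zero_iff by simp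
  next
    fix y assume "y \<in> carrier B"
    then obtain p where p: "p \<in> carrier P" "y = \<pi> p"
      using B_cases by blast
    have "\<pi> p \<in> T.fraction_like"
      using p(1) unfolding P_def
    proof (induction rule: mpolys_induct)
      case (const r)
      then show ?case
        using T.fraction_like_map[of r] by (simp only: f_def[of r])
    next
      case (add p q)
      then show ?case
        using T.fraction_like_add unfolding P_def[symmetric] by simp
    next
      case (times_var p i)
      then have i: "i \<in> V"
        by (simp add: V_def)
      have "\<pi> (x i) \<in> T.fraction_like"
        using i gL x h_zero[OF i] by (intro T.fraction_like_single[of i "g i"]) (auto simp: c_def)
      then show ?case
        using times_var T.fraction_like_mult x[OF i] unfolding P_def[symmetric] x_def by simp
    qed
    then show "y \<in> T.fraction_like"
      by (simp add: p(2))
  qed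
  then obtain \<theta> where \<theta>: "\<theta> \<in> alg_iso R D.D D.\<iota> B f"
    unfolding canonically_isomorphic_def by blast
  then have hom: "\<theta> \<in> alg_hom R D.D D.\<iota> B f" and bij: "bij_betw \<theta> (carrier D.D) (carrier B)"
    by (auto simp: alg_iso_def ring_iso_def)
  define \<psi> where "\<psi> = restrict (inv_into (carrier D.D) \<theta>) (carrier B)"
  have "\<psi> \<in> alg_iso R B f D.D D.\<iota>"
    unfolding \<psi>_def using D.dil_map_closed
    by (intro alg_iso_sym \<theta> cring.axioms(1) D.dil_cring \<pi>.S.is_cring) auto
  moreover have "\<psi> (\<pi> (x i)) = D.dfr (g i) (Poly_Mapping.single i 1)" if i: "i \<in> V" for i
  proof -
    define u where "u = D.dfr (g i) (Poly_Mapping.single i 1)"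
    have u: "u \<in> carrier D.D"
      using D.dil_map_times_dfr_single(2)[OF i gL[OF i]] by (simp add: u_def)
    \<comment> \<open>The image of g_i/c_i in the quotient is identified with the class of x_i by
      cancelling the regular element f(c_i).\<close>
    have "f (c i) \<otimes>\<^bsub>B\<^esub> \<theta> u = f (g i)"
      using T.alg_hom_times_pw[OF hom, of "Poly_Mapping.single i 1" "g i"] i gL[OF i]
      by (simp add: u_def D.Lpw_single_one D.pow.multi_power_single_one del: One_nat_def)
    also have "\<dots> = f (c i) \<otimes>\<^bsub>B\<^esub> \<pi> (x i)"
      using h_zero[OF i] by (simp add: c_def)
    finally have "\<theta> u = \<pi> (x i)"
      using \<pi>.S.nonzerodivisor_cancel[OF reg] x[OF i] bij_betwE[OF bij] u by blast
    then show ?thesis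
      using bij_betw_inv_into_left[OF bij u] x[OF i] by (simp add: \<psi>_def u_def)
  qed
  ultimately have "\<exists>\<theta>\<in>alg_iso R B f D.D D.\<iota>. \<forall>i\<in>V. \<theta> (\<pi> (x i)) = D.dfr (g i) (Poly_Mapping.single i 1)"
    by blast
  then show ?thesis
    unfolding f_def B_def \<pi>_def V_def .
qed


theorem proposition1p2:
  fixes A :: "('a, 'm) ring_scheme"
    and I :: "'i set"
    and M :: "'i \<Rightarrow> 'a set"
    and a :: "'i \<Rightarrow> 'a"
  assumes "cring A"
    and "multi_center A I M a"
  shows
    "(set_functor A I a
        (dil_functor A I M a :: 'b ring \<Rightarrow> ('a \<Rightarrow> 'b) \<Rightarrow> unit set) dil_functor_map \<and>
      represents A I a
        (dil_functor A I M a :: 'b ring \<Rightarrow> ('a \<Rightarrow> 'b) \<Rightarrow> unit set) dil_functor_map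
        (dilatation A I M a) (dil_map A I M a)) \<and>
     (\<forall>i \<in> I. nonzerodivisor (dilatation A I M a) (dil_map A I M a (a i)) \<and>
        PIdl\<^bsub>dilatation A I M a\<^esub> (dil_map A I M a (a i)) =
        Idl\<^bsub>dilatation A I M a\<^esub> (dil_map A I M a ` center_ideal A M a i)) \<and>
     (domain A \<and> (\<forall>i \<in> I. a i \<noteq> \<zero>\<^bsub>A\<^esub>) \<longrightarrow> domain (dilatation A I M a)) \<and>
     (reduced A \<longrightarrow> reduced (dilatation A I M a)) \<and>
     (finite I \<longrightarrow>
        (let N = finsum (ideals_set A)
                   (\<lambda>i. ideal_prod A (M i) (PIdl\<^bsub>A\<^esub> (finprod A a (I - {i})))) I;
             b = finprod A a I
         in canonically_isomorphic A
              (dilatation A I M a) (dil_map A I M a)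
              (dilatation A {()} (\<lambda>_. N) (\<lambda>_. b)) (dil_map A {()} (\<lambda>_. N) (\<lambda>_. b)))) \<and>
     ((\<forall>i \<in> I. M i = carrier A) \<longrightarrow>
        (let S = generated_submonoid A (a ` I)
         in canonically_isomorphic A
              (dilatation A I M a) (dil_map A I M a)
              (localization A S) (loc_map A S))) \<and>
     (let S = generated_submonoid A (a ` I);
          C = generated_subalgebra A (localization A S) (loc_map A S)
                {loc_frac A S m (a i) | i m. i \<in> I \<and> m \<in> M i}
      in canonically_isomorphic A
           (dilatation A I M a) (dil_map A I M a)
           (localization A S \<lparr>carrier := C\<rparr>) (loc_map A S)) \<and>
     (\<forall>S C. submonoid S A \<and> subalgebra_of A (localization A S) (loc_map A S) C \<longrightarrow>
        (\<exists>(J :: 'a set) N c. multi_center A J N c \<and>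
           alg_iso A (localization A S \<lparr>carrier := C\<rparr>) (loc_map A S)
             (dilatation A J N c) (dil_map A J N c) \<noteq> {})) \<and>
     (\<forall>K k. K \<subseteq> I \<and>
        (\<forall>i \<in> I - K. k i \<in> K \<and> a (k i) \<in> center_ideal A M a i \<and>
           center_ideal A M a i \<subseteq> center_ideal A M a (k i)) \<longrightarrow>
        (let D = dilatation A K M a;
             T = generated_submonoid D
                   {dil_frac A K M a (a i) (Poly_Mapping.single (k i) 1) | i. i \<in> I - K}
         in canonically_isomorphic A
              (dilatation A I M a) (dil_map A I M a)
              (localization D T) (\<lambda>x. loc_map D T (dil_map A K M a x)))) \<and>
     (\<forall>(n :: nat) b g d.
        H1_regular A (b # map g [1..<Suc n]) \<and> (\<forall>i \<in> {1..n}. (0 :: nat) < d i) \<longrightarrow>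
        (let P = mpoly_ring A {1..n};
             const = ring.indexed_const A;
             x = ring.indexed_var A;
             R = Idl\<^bsub>P\<^esub> ((\<lambda>i. const (g i) \<ominus>\<^bsub>P\<^esub> const (b [^]\<^bsub>A\<^esub> d i) \<otimes>\<^bsub>P\<^esub> x i) ` {1..n});
             N = (\<lambda>i. PIdl\<^bsub>A\<^esub> (g i));
             c = (\<lambda>i. b [^]\<^bsub>A\<^esub> d i)
         in \<exists>\<theta> \<in> alg_iso A (P Quot R) (\<lambda>x. R +>\<^bsub>P\<^esub> const x)
                   (dilatation A {1..n} N c) (dil_map A {1..n} N c).
              \<forall>i \<in> {1..n}. \<theta> (R +>\<^bsub>P\<^esub> x i) =
                dil_frac A {1..n} N c (g i) (Poly_Mapping.single i 1)))"
proof -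
  interpret A: multi_centered A I M a
    using assms by (intro multi_centered.intro multi_centered_axioms.intro)
  \<comment> \<open>The generated monoids in the statement become sets of monomials, the form in
    which the dilatation is compared with a localization.\<close>
  have S: "generated_submonoid A (a ` I) = A.Sm"
    by (rule A.pow.generated_submonoid_eq_multi_powers)
  show ?thesis
    unfolding Let_def S
    apply (intro conjI)
    subgoal by (rule A.dil_set_functor)
    subgoal by (rule A.dil_represents)
    subgoal by (intro ballI conjI A.dil_map_a_nonzerodivisor A.dil_map_ideal_eq)
    subgoal by (intro impI A.dil_domain) simp_all
    subgoal by (intro impI A.dil_reduced)
    subgoal by (intro impI A.dil_iso_single_center)
    subgoal by (intro impI A.dil_iso_localization) simp
    subgoal by (rule A.dil_iso_generated_subalgebra)
    subgoal using A.subalgebra_iso_dilatation by fast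
    subgoal by (intro allI impI A.dil_iso_localized_dil) simp_all
    subgoal by (intro allI impI A.dil_iso_polynomial_quotient) simp_all
    done
qed

end
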